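(* Let $\chi$ be a function whose Fourier transform $\tilde\chi\in C^\infty(\mathbb R)$ satisfies $\tilde\chi(0)\ne0$, tends to $0$ at infinity, and has all its derivatives vanishing at the origin and at infinity. For $\alpha>0$ let $f_\alpha$ be defined by $\tilde f_\alpha(p)=\theta(p)p^\alpha\tilde\chi(p)$ ($p\in\mathbb R$), and assume $f_\alpha$ is normalised, i.e. $\int_0^\infty \frac{dp}{2p}|\tilde f_\alpha(p)|^2=1$. Then (1) $\bar N[f_\alpha]<\infty$ if and only if $\alpha>1/2$; (2) $\bar N^{Th}_{2\pi}[f_\alpha]<\infty$ if and only if $\alpha>1/2$; (3) the integral $\int_0^\infty\frac{dk}{2k}\big(|\widetilde{\check f_\alpha}(-k)|^2-|\widetilde{\check f_\alpha}^{\,Th}(-k)|^2\big)$ (which represents $\bar N[f_\alpha]-\bar N^{Th}_{2\pi}[f_\alpha]$) converges absolutely if and only if $\alpha>1/2$. Moreover, if $\alpha\le1/2$: $\int_0^1\frac{dk}{2k}|\widetilde{\check f_\alpha}(-k)|^2<\infty$ while $\int_1^\infty\frac{dk}{2k}|\widetilde{\check f_\alpha}(-k)|^2=\infty$; both $\int_0^1\frac{dk}{2k}|\widetilde{\check f_\alpha}^{\,Th}(-k)|^2$ and $\int_1^\infty\frac{dk}{2k}|\widetilde{\check f_\alpha}^{\,Th}(-k)|^2$ are infinite; and the integral of $\frac{1}{2k}\big||\widetilde{\check f_\alpha}(-k)|^2-|\widetilde{\check f_\alpha}^{\,Th}(-k)|^2\big|$ is finite over $[1,\infty)$ but infinite over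 $(0,1]$.
   Context: $\theta$ is the Heaviside step function. Fourier transforms are $\tilde g(p)=(2\pi)^{-1/2}\int g(y)e^{-ipy}dy$. With $x(y)=-\log(1+e^{-y})$, define for $k\ge0$: $\widetilde{\check f}(-k)=(2\pi)^{-1/2}\int_{\mathbb R} f(y)e^{ikx(y)}dy$ and $\widetilde{\check f}^{\,Th}(-k)=(2\pi)^{-1/2}\int_{\mathbb R} f(y)e^{-ike^{-y}}dy$. The mean number of created particles is $\bar N[f]=\int_0^\infty\frac{dk}{2k}|\widetilde{\check f}(-k)|^2\in[0,\infty]$, and the thermal average at inverse temperature $\beta$ is $\bar N^{Th}_\beta[f]=\int_0^\infty\frac{dp}{2p}\frac{|\tilde f(p)|^2}{e^{\beta p}-1}$; one has $\bar N^{Th}_{2\pi}[f]=\int_0^\infty\frac{dk}{2k}|\widetilde{\check f}^{\,Th}(-k)|^2$. *)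

theory Defs
  imports "HOL-Analysis.Analysis"
begin

definition fourier :: "(real \<Rightarrow> complex) \<Rightarrow> real \<Rightarrow> complex" where
  "fourier g p = complex_of_real (1 / sqrt (2 * pi)) *
     (LINT y|lborel. g y * exp (- \<i> * complex_of_real (p * y)))"

fun vderivs :: "nat \<Rightarrow> (real \<Rightarrow> complex) \<Rightarrow> real \<Rightarrow> complex" where
  "vderivs 0 g = g"
| "vderivs (Suc n) g = (\<lambda>x. vector_derivative (vderivs n g) (at x))"

definition xcoord :: "real \<Rightarrow> real" where
  "xcoord y = - ln (1 + exp (- y))"

text \<open>The transform tilde-check f(-k) = (2 pi)^(-1/2) int f(y) e^(i k x(y)) dy.\<close>
definition checkF :: "(real \<Rightarrow> complex) \<Rightarrow> real \<Rightarrow> complex" where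
  "checkF f k = complex_of_real (1 / sqrt (2 * pi)) *
     (LINT y|lborel. f y * exp (\<i> * complex_of_real (k * xcoord y)))"

definition checkTh :: "(real \<Rightarrow> complex) \<Rightarrow> real \<Rightarrow> complex" where
  "checkTh f k = complex_of_real (1 / sqrt (2 * pi)) *
     (LINT y|lborel. f y * exp (- \<i> * complex_of_real (k * exp (- y))))"

definition Npart :: "(real \<Rightarrow> complex) \<Rightarrow> real set \<Rightarrow> ennreal" where
  "Npart f A = (\<integral>\<^sup>+ k \<in> A. ennreal ((cmod (checkF f k))\<^sup>2 / (2 * k)) \<partial>lborel)"

definition NThpart :: "(real \<Rightarrow> complex) \<Rightarrow> real set \<Rightarrow> ennreal" where
  "NThpart f A = (\<integral>\<^sup>+ k \<in> A. ennreal ((cmod (checkTh f k))\<^sup>2 / (2 * k)) \<partial>lborel)"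

definition DiffAbs :: "(real \<Rightarrow> complex) \<Rightarrow> real set \<Rightarrow> ennreal" where
  "DiffAbs f A = (\<integral>\<^sup>+ k \<in> A.
      ennreal (\<bar>(cmod (checkF f k))\<^sup>2 - (cmod (checkTh f k))\<^sup>2\<bar> / (2 * k)) \<partial>lborel)"

definition Nbar :: "(real \<Rightarrow> complex) \<Rightarrow> ennreal" where
  "Nbar f = Npart f {0<..}"

definition NTh :: "real \<Rightarrow> (real \<Rightarrow> complex) \<Rightarrow> ennreal" where
  "NTh beta f = (\<integral>\<^sup>+ p \<in> {0<..}.
      ennreal ((cmod (fourier f p))\<^sup>2 / (2 * p) / (exp (beta * p) - 1)) \<partial>lborel)"

end

theory Submission
  imports Defs "HOL-Complex_Analysis.Complex_Analysis" "HOL-Probability.Characteristic_Functions"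
begin

text \<open>
  Since the Fourier transform of \<open>f\<close> lives on positive frequencies, \<open>f\<close> extends analytically to the
  upper half plane, and both oscillatory integrals may be moved to the line \<open>Im z = pi / 2\<close>. There
  \<open>exp (- i k exp (- z))\<close> becomes \<open>exp (- k exp (- y))\<close> and \<open>exp (i k x(z))\<close> becomes
  \<open>(1 - i exp (- y)) powr (- i k)\<close>; up to errors decaying exponentially in \<open>y - ln k\<close> both
  are step functions jumping at \<open>y = ln k\<close> (the second one only for \<open>k \<ge> 1\<close>). The shifted function
  \<open>\<phi>\<close> has transform \<open>p powr \<alpha> * exp (- pi p / 2)\<close> times that of \<open>chi\<close> for \<open>p > 0\<close>, so by flatness at
  the origin it is a multiple of \<open>(pi / 2 - i y) powr (- 1 - \<alpha>)\<close> plus \<open>O(1 / y\<^sup>2)\<close>. Hence both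
  transforms behave like the tail of \<open>\<phi>\<close> beyond \<open>ln k\<close>, which is of the exact order \<open>\<bar>ln k\<bar> powr (- \<alpha>)\<close>
  for \<open>\<alpha> < 1\<close>, and the square of this is integrable against \<open>dk / k\<close> precisely for \<open>\<alpha> > 1/2\<close>.
  For \<open>k \<le> 1\<close> the kernel of the first transform is instead close to 1, and
  \<open>\<integral>\<phi> = 0\<close> makes that transform small.
\<close>

subsection \<open>Integrals on the line and half-line\<close>

text \<open>The height pi / 2 suits both kernels: they are bounded by 1 for 0 \<le> Im z \<le> pi /
  2, and on the upper edge exp (- z) = - i exp (- y) turns oscillation into decay. The obstacle is
  that f is merely integrable, with no pointwise continuation at hand. Its shift is therefore
  defined on the Fourier side by the damping exp (- a p), and the contour argument is carried out on
  a Gaussian approximate identity.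

  The O(1 / y^2) remainder caps the usable decay, so upper bounds are stated with \<beta> = min
  \<alpha> 1. The lower bound for the tail has content when \<alpha> < 1, which covers \<alpha>
  \<le> 1/2.

  Over [1, \<infinity>) the difference is finite for every \<alpha> because both kernels approximate
  the same step: the transforms differ by O(|ln k|^(-1-\<beta>)), one power better than either of
  them.

  The thermal mean is read off from its Bose factor: 1 / (exp (2 pi p) - 1) has a simple pole at 0,
  so near 0 the integrand behaves like p^(2 \<alpha> - 2), integrable there exactly for \<alpha> >
  1/2.\<close>

lemma integral_FTC_UNIV:
  fixes g G :: "real \<Rightarrow> complex"
  assumes G: "\<And>x. (G has_vector_derivative g x) (at x)" and cont: "continuous_on UNIV g"
    and int: "integrable lborel g" and bot: "(G \<longlongrightarrow> A) at_bot" and top: "(G \<longlongrightarrow> B) at_top"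
  shows "(LINT x|lborel. g x) = B - A"
proof -
  have "(LBINT x=-\<infinity>..\<infinity>. g x) = B - A"
  proof (rule interval_integral_FTC_integrable)
    show "set_integrable lborel (einterval (-\<infinity>) \<infinity>) g"
      using int by (simp add: set_integrable_def)
  qed (use G cont bot top in \<open>auto simp: ereal_tendsto_simps continuous_on_eq_continuous_at\<close>)
  then show ?thesis
    by (simp add: interval_lebesgue_integral_le_eq set_lebesgue_integral_def)
qed

lemma integral_FTC_greaterThan:
  fixes g G :: "real \<Rightarrow> complex"
  assumes G: "\<And>x. s < x \<Longrightarrow> (G has_vector_derivative g x) (at x)"
    and cont: "\<And>x. s < x \<Longrightarrow> isCont g x"
    and int: "set_integrable lborel {s<..} g"
    and left: "(G \<longlongrightarrow> A) (at_right s)" and top: "(G \<longlongrightarrow> B) at_top"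
  shows "(LINT x:{s<..}|lborel. g x) = B - A"
proof -
  have "(LBINT x=ereal s..\<infinity>. g x) = B - A"
  proof (rule interval_integral_FTC_integrable)
    show "set_integrable lborel (einterval (ereal s) \<infinity>) g"
      using int by simp
  qed (use G cont left top in \<open>auto simp: ereal_tendsto_simps\<close>)
  then show ?thesis
    by (simp add: interval_lebesgue_integral_le_eq)
qed

lemma set_integrable_one_plus_powr:
  fixes \<gamma> :: real
  assumes "\<gamma> > 1"
  shows "set_integrable lborel {0<..} (\<lambda>y::real. (1 + y) powr (-\<gamma>))"
proof -
  have lim: "((\<lambda>y. (1 + y) powr (1 - \<gamma>) / (1 - \<gamma>)) \<longlongrightarrow> 0) at_top"
    using assms by real_asymp
  have lim0: "((\<lambda>y. (1 + y) powr (1 - \<gamma>) / (1 - \<gamma>)) \<longlongrightarrow> (1 + 0) powr (1 - \<gamma>) / (1 - \<gamma>)) (at_right 0)"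
    using assms by (intro tendsto_intros) auto
  have "set_integrable lborel (einterval (ereal 0) \<infinity>) (\<lambda>y::real. (1 + y) powr (-\<gamma>))"
  proof (rule interval_integral_FTC_nonneg(1)[where F = "\<lambda>y. (1 + y) powr (1 - \<gamma>) / (1 - \<gamma>)"])
    show "((\<lambda>y. (1 + y) powr (1 - \<gamma>) / (1 - \<gamma>)) has_real_derivative (1 + x) powr (-\<gamma>)) (at x)"
      if "ereal 0 < ereal x" for x
    proof -
      have "((\<lambda>y. (1 + y) powr (1 - \<gamma>)) has_real_derivative (1 - \<gamma>) * (1 + x) powr (1 - \<gamma> - 1)) (at x)"
        using that DERIV_fun_powr[of "\<lambda>y. 1 + y" 1 x "1 - \<gamma>"]
        by (auto intro!: derivative_eq_intros)
      from DERIV_cdivide[OF this, of "1 - \<gamma>"] show ?thesis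
        using assms by simp
    qed
    show "isCont (\<lambda>y. (1 + y) powr (-\<gamma>)) x" if "ereal 0 < ereal x" for x
      using that by (auto intro!: continuous_intros)
  qed (use lim lim0 in \<open>auto simp: ereal_tendsto_simps zero_ereal_def\<close>)
  then show ?thesis by simp
qed

lemma integrable_one_plus_abs_powr:
  fixes \<gamma> :: real
  assumes "\<gamma> > 1"
  shows "integrable lborel (\<lambda>y::real. (1 + \<bar>y\<bar>) powr (-\<gamma>))"
proof -
  define h where "h y = indicator {0<..} y * (1 + y) powr (-\<gamma>)" for y :: real
  have h: "integrable lborel h"
    using set_integrable_one_plus_powr[OF assms] by (simp add: h_def[abs_def] set_integrable_def)
  have h': "integrable lborel (\<lambda>y. h (0 + (-1) * y))"
    by (rule lborel_integrable_real_affine[OF h]) simp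
  \<comment> \<open>The origin lies in neither open half-line; its indicator completes the majorant
    there.\<close>
  have i0: "integrable lborel (indicator {0::real} :: real \<Rightarrow> real)"
    by simp
  show ?thesis
    by (rule Bochner_Integration.integrable_bound
        [OF Bochner_Integration.integrable_add[OF Bochner_Integration.integrable_add[OF h h'] i0]])
       (auto simp: h_def indicator_def abs_if)
qed

text \<open>The integrand is the modulus of the complex Gamma integrand with parameter
  \<open>c + 1\<close>, so the absolute convergence of the Gamma integral gives the claim.\<close>

lemma set_integrable_powr_exp:
  fixes a c :: real
  assumes "a > 0" "c > -1"
  shows "set_integrable lborel {0<..} (\<lambda>p. p powr c * exp (- (a * p)))"
proof -
  have "(\<lambda>t. complex_of_real t powr (complex_of_real (c + 1) - 1) / of_real (exp (a * t)))
          absolutely_integrable_on {0<..}"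
    using assms by (intro absolutely_integrable_Gamma_integral) auto
  then have "(\<lambda>t. norm (complex_of_real t powr (complex_of_real (c + 1) - 1) / of_real (exp (a * t))))
          absolutely_integrable_on {0<..}"
    by (rule absolutely_integrable_norm[unfolded o_def])
  then have "(\<lambda>p. p powr c * exp (- (a * p))) absolutely_integrable_on {0<..}"
    by (rule set_integrable_cong[THEN iffD1, rotated -1])
       (auto simp: norm_divide norm_mult norm_inverse norm_powr_real_powr exp_minus divide_inverse
         simp flip: exp_of_real)
  \<comment> \<open>Absolute integrability refers to the completed measure; since the integrand is
    Borel, it holds for \<open>lborel\<close> as well.\<close>
  then show ?thesis
    unfolding set_integrable_def
    by (subst (asm) integrable_completion) auto
qed

text \<open>On the convex half-plane Re w \<le> 0 the derivative of exp has modulus at most 1, so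
  exp is 1-Lipschitz there.\<close>

lemma norm_exp_minus_1_le:
  assumes "Re w \<le> 0"
  shows "norm (exp w - 1) \<le> norm w" "norm (exp w - 1) \<le> 2"
proof -
  have "norm (exp w - exp 0) \<le> 1 * norm (w - 0)"
  proof (rule field_differentiable_bound[where S = "{z. Re z \<le> 0}" and f' = exp])
    show "convex {z. Re z \<le> 0}" by (rule convex_halfspace_Re_le)
  qed (use assms in \<open>auto intro!: derivative_eq_intros\<close>)
  then show "norm (exp w - 1) \<le> norm w" by simp
  show "norm (exp w - 1) \<le> 2"
    using norm_triangle_ineq4[of "exp w" 1] assms by (simp add: norm_exp_eq_Re)
      (smt (verit) exp_le_one_iff norm_exp_eq_Re)
qed

text \<open>The second moment pays for the quadratic Taylor error of the exponential: the error of
  the linear approximation is at most h^2 / 2 times that moment, so the difference quotient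
  converges at an explicit rate.\<close>

lemma half_line_transform_deriv:
  fixes u :: "real \<Rightarrow> complex"
  assumes u0: "set_integrable lborel {0<..} u"
    and u1: "set_integrable lborel {0<..} (\<lambda>p. p * u p)"
    and u2: "set_integrable lborel {0<..} (\<lambda>p. p\<^sup>2 * u p)"
  shows "((\<lambda>y. LINT p:{0<..}|lborel. u p * exp (\<i> * of_real (p * y))) has_vector_derivative
          (LINT p:{0<..}|lborel. (\<i> * of_real p * u p) * exp (\<i> * of_real (p * y)))) (at y)"
proof -
  define E where "E y p = exp (\<i> * complex_of_real (p * y))" for y p
  have E[measurable]: "E y \<in> borel_measurable borel" for y unfolding E_def by measurable
  have nE [simp]: "norm (E y p) = 1" for y p by (simp add: E_def)
  have int: "set_integrable lborel {0<..} (\<lambda>p. v p * E y p)"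
    if "set_integrable lborel {0<..} v" for v :: "real \<Rightarrow> complex" and y
    using that unfolding set_integrable_def
    by (rule Bochner_Integration.integrable_bound)
       (use borel_measurable_integrable[OF that[unfolded set_integrable_def]] in
         \<open>auto simp: norm_mult mult.assoc[symmetric] scaleR_conv_of_real intro!: borel_measurable_times
           simp flip: mult_scaleR_left\<close>)
  define f where "f y = (LINT p:{0<..}|lborel. u p * E y p)" for y
  define f' where "f' y = (LINT p:{0<..}|lborel. (\<i> * of_real p * u p) * E y p)" for y
  define C where "C = (LINT p:{0<..}|lborel. norm (p\<^sup>2 * u p))"
  have i1: "set_integrable lborel {0<..} (\<lambda>p. \<i> * of_real p * u p)"
    using set_integrable_mult_right[of \<i>, OF u1] by (simp add: mult.assoc)
  have key: "norm (f (y + h) - f y - h *\<^sub>R f' y) \<le> \<bar>h\<bar>\<^sup>2 / 2 * C" for h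
  proof -
    have "f (y + h) - f y - h *\<^sub>R f' y =
        (LINT p:{0<..}|lborel. u p * E (y + h) p - u p * E y p - h *\<^sub>R ((\<i> * of_real p * u p) * E y p))"
      unfolding f_def f'_def
      by (subst set_integral_diff set_integral_scaleR_right, (intro set_integral_diff int u0 i1
           set_integrable_scaleR_right)+)+ (simp_all add: int u0 i1)
    also have "norm \<dots> \<le> (LINT p:{0<..}|lborel. \<bar>h\<bar>\<^sup>2 / 2 * norm (p\<^sup>2 * u p))"
      unfolding set_lebesgue_integral_def
    proof (rule Bochner_Integration.integral_norm_bound_integral)
      show "integrable lborel (\<lambda>x. indicat_real {0<..} x *\<^sub>R (u x * E (y + h) x - u x * E y x -
                   h *\<^sub>R (\<i> * complex_of_real x * u x * E y x)))"
        unfolding set_integrable_def[symmetric]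
        by (intro set_integral_diff int u0 i1 set_integrable_scaleR_right)
      show "integrable lborel (\<lambda>x. indicat_real {0<..} x *\<^sub>R (\<bar>h\<bar>\<^sup>2 / 2 * norm (complex_of_real x ^ 2 * u x)))"
        unfolding set_integrable_def[symmetric]
        using u2 by (intro set_integrable_mult_right set_integrable_norm) simp
      show "norm (indicat_real {0<..} p *\<^sub>R (u p * E (y + h) p - u p * E y p -
                   h *\<^sub>R (\<i> * complex_of_real p * u p * E y p)))
         \<le> indicat_real {0<..} p *\<^sub>R (\<bar>h\<bar>\<^sup>2 / 2 * norm (complex_of_real p ^ 2 * u p))" for p
      proof -
        have "E (y + h) p = E y p * exp (\<i> * of_real (p * h))"
          by (simp add: E_def exp_add[symmetric] algebra_simps)
        then have "u p * E (y + h) p - u p * E y p - h *\<^sub>R (\<i> * complex_of_real p * u p * E y p)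
          = u p * E y p * (iexp (p * h) - (\<Sum>k\<le>1. (\<i> * of_real (p * h)) ^ k / fact k))"
          by (simp add: algebra_simps scaleR_conv_of_real)
        also have "norm \<dots> \<le> norm (u p) * (\<bar>p * h\<bar> ^ Suc 1 / fact (Suc 1))"
          using mult_left_mono[OF iexp_approx1[of "p * h" 1] norm_ge_zero[of "u p"]]
          unfolding norm_mult nE mult_1_right by blast
        finally show ?thesis
          by (auto simp: indicator_def norm_mult norm_power abs_mult power2_eq_square algebra_simps)
      qed
    qed
    also have "\<dots> = \<bar>h\<bar>\<^sup>2 / 2 * C" by (simp add: C_def)
    finally show ?thesis .
  qed
  have "((\<lambda>h. norm (f (y + h) - f y - h *\<^sub>R f' y) / norm h) \<longlongrightarrow> 0) (at 0)"
  proof (rule Lim_null_comparison)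
    show "\<forall>\<^sub>F h in at 0. norm (norm (f (y + h) - f y - h *\<^sub>R f' y) / norm h) \<le> \<bar>h\<bar> / 2 * C"
      unfolding eventually_at_filter
      using key by (intro always_eventually) (auto simp: field_simps power2_eq_square abs_mult)
    show "((\<lambda>h. \<bar>h\<bar> / 2 * C) \<longlongrightarrow> 0) (at 0)"
      by (auto intro!: tendsto_eq_intros)
  qed
  then have "(f has_vector_derivative f' y) (at y)"
    unfolding has_vector_derivative_def has_derivative_at
    by (auto intro: bounded_linear_scaleR_left)
  then show ?thesis unfolding f_def[abs_def] f'_def E_def .
qed

subsection \<open>Shifting the line of integration\<close>

text \<open>A primitive of \<open>h\<close> on the convex strip replaces the rectangular contour.
  Its difference \<open>D\<close> between the two edges has the difference of the integrands as
  derivative, and the bound along vertical segments of length \<open>a\<close> makes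
  \<open>D\<close> vanish at both ends.\<close>

lemma integral_horizontal_shift:
  fixes h :: "complex \<Rightarrow> complex" and a :: real
  assumes "a \<ge> 0" and T: "open T" "{z. 0 \<le> Im z \<and> Im z \<le> a} \<subseteq> T" and holo: "h holomorphic_on T"
    and bound: "\<And>z. 0 \<le> Im z \<Longrightarrow> Im z \<le> a \<Longrightarrow> norm (h z) \<le> B (Re z)"
    and B: "(B \<longlongrightarrow> 0) at_top" "(B \<longlongrightarrow> 0) at_bot"
    and int0: "integrable lborel (\<lambda>x. h (of_real x))"
    and inta: "integrable lborel (\<lambda>x. h (of_real x + \<i> * of_real a))"
  shows "(LINT x|lborel. h (of_real x)) = (LINT x|lborel. h (of_real x + \<i> * of_real a))"
proof -
  define S where "S = {z. 0 \<le> Im z \<and> Im z \<le> a}"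
  have "S = {z. Im z \<ge> 0} \<inter> {z. Im z \<le> a}" by (auto simp: S_def)
  then have conv: "convex S"
    by (simp add: convex_Int convex_halfspace_Im_ge convex_halfspace_Im_le)
  have ST: "S \<subseteq> T" using T by (simp add: S_def)
  have contT: "continuous_on T h" using holo by (rule holomorphic_on_imp_continuous_on)
  obtain g where g: "\<And>z. z \<in> S \<Longrightarrow> (g has_field_derivative h z) (at z within S)"
  proof (rule holomorphic_convex_primitive[OF conv, of "{}" h])
    show "continuous_on S h" using contT ST by (rule continuous_on_subset)
    show "h field_differentiable at x" if "x \<in> interior S - {}" for x
      using that interior_subset ST holo T(1)
      by (meson DiffD1 holomorphic_on_imp_differentiable_at in_mono)
  qed auto
  have line: "((\<lambda>x. g (of_real x + \<i> * of_real v)) has_vector_derivative h (of_real x + \<i> * of_real v)) (at x)"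
    if "0 \<le> v" "v \<le> a" for x v
  proof -
    have "((\<lambda>x. of_real x + \<i> * of_real v) has_vector_derivative 1) (at x)"
      by (auto intro!: derivative_eq_intros)
    moreover have "(g has_field_derivative h (of_real x + \<i> * of_real v))
       (at (of_real x + \<i> * of_real v) within range (\<lambda>x. of_real x + \<i> * of_real v))"
      using that by (intro DERIV_subset[OF g]) (auto simp: S_def)
    ultimately show ?thesis
      using field_vector_diff_chain_within[of "\<lambda>x. of_real x + \<i> * of_real v" 1 x UNIV g]
      by (simp add: o_def)
  qed
  define D where "D x = g (of_real x + \<i> * of_real a) - g (of_real x)" for x
  have D: "(D has_vector_derivative h (of_real x + \<i> * of_real a) - h (of_real x)) (at x)" for x
    unfolding D_def using line[of a x] line[of 0 x] \<open>a \<ge> 0\<close>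
    by (intro derivative_intros) auto
  have Dbound: "norm (D x) \<le> B x * a" for x
  proof -
    have seg: "closed_segment (of_real x) (of_real x + \<i> * of_real a) \<subseteq> {z \<in> S. Re z = x}"
    proof -
      have "convex {z \<in> S. Re z = x}"
        using convex_Int[OF conv, of "{z. Re z = x}"] convex_hyperplane[of "1::complex" x]
        by (simp add: Int_def inner_complex_def)
      then show ?thesis using \<open>a \<ge> 0\<close>
        by (intro closed_segment_subset) (auto simp: S_def)
    qed
    have "norm (g (of_real x + \<i> * of_real a) - g (of_real x))
       \<le> B x * norm (of_real x + \<i> * of_real a - of_real x :: complex)"
    proof (rule field_differentiable_bound)
      show "convex (closed_segment (of_real x) (of_real x + \<i> * complex_of_real a))" by simp
      show "(g has_field_derivative h z) (at z within closed_segment (of_real x) (of_real x + \<i> * complex_of_real a))"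
        if "z \<in> closed_segment (of_real x) (of_real x + \<i> * complex_of_real a)" for z
        using that seg by (intro DERIV_subset[OF g]) auto
      show "norm (h z) \<le> B x" if "z \<in> closed_segment (of_real x) (of_real x + \<i> * complex_of_real a)" for z
        using that seg bound[of z] by (auto simp: S_def)
    qed auto
    then show ?thesis using \<open>a \<ge> 0\<close> by (simp add: D_def norm_mult)
  qed
  have "(LINT x|lborel. h (of_real x + \<i> * of_real a) - h (of_real x)) = 0 - 0"
  proof (rule integral_FTC_UNIV[OF D])
    have "continuous_on S h" using contT ST by (rule continuous_on_subset)
    then show "continuous_on UNIV (\<lambda>x. h (of_real x + \<i> * of_real a) - h (of_real x))"
    proof (intro continuous_on_diff)
      show "continuous_on UNIV (\<lambda>x. h (of_real x + \<i> * of_real a))" if "continuous_on S h"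
        using \<open>a \<ge> 0\<close>
        by (intro continuous_on_compose2[OF that, of UNIV "\<lambda>x. of_real x + \<i> * of_real a"] continuous_intros)
           (auto simp: S_def)
      show "continuous_on UNIV (\<lambda>x. h (of_real x))" if "continuous_on S h"
        using \<open>a \<ge> 0\<close>
        by (intro continuous_on_compose2[OF that, of UNIV of_real] continuous_intros)
           (auto simp: S_def)
    qed
    show "(D \<longlongrightarrow> 0) at_bot"
      by (rule Lim_null_comparison[OF _ tendsto_mult_left_zero[OF B(2), where c = a]]) (simp add: Dbound)
    show "(D \<longlongrightarrow> 0) at_top"
      by (rule Lim_null_comparison[OF _ tendsto_mult_left_zero[OF B(1), where c = a]]) (simp add: Dbound)
  qed (intro Bochner_Integration.integrable_diff int0 inta)
  then show ?thesis using int0 inta by simp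
qed

text \<open>One domination criterion for all the exchanges of integrals below: \<open>c = 0\<close>
  covers kernels dominated by a product of functions of \<open>t\<close> and \<open>y\<close>,
  \<open>c = 1\<close> those dominated by a convolution integrand.\<close>

lemma integrable_pair_dominated:
  fixes f g :: "real \<Rightarrow> complex" and H :: "real \<times> real \<Rightarrow> complex"
  assumes f: "integrable lborel f" and g: "integrable lborel g"
    and H: "H \<in> borel_measurable (lborel \<Otimes>\<^sub>M lborel)"
    and bound: "\<And>t y. norm (H (t, y)) \<le> norm (f t) * norm (g (y - c * t)) * M"
  shows "integrable (lborel \<Otimes>\<^sub>M lborel) H"
proof -
  have [measurable]: "f \<in> borel_measurable borel" "g \<in> borel_measurable borel"
    using f g by auto
  have g': "integrable lborel (\<lambda>y. g (y - d))" for d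
    using lborel_integrable_real_affine[OF g, of 1 "-d"] by simp
  have ng: "(LINT y|lborel. norm (g (y - d))) = (LINT y|lborel. norm (g y))" for d
    using lborel_integral_real_affine[of 1 "\<lambda>y. norm (g y)" "-d"] by simp
  have "integrable (lborel \<Otimes>\<^sub>M lborel) (\<lambda>(t, y). f t * g (y - c * t))"
  proof (rule lborel_pair.Fubini_integrable)
    show "integrable lborel (\<lambda>x. LINT y|lborel. norm (case (x, y) of (t, y) \<Rightarrow> f t * g (y - c * t)))"
      using f by (simp add: norm_mult ng)
  qed (auto intro!: g')
  then have "integrable (lborel \<Otimes>\<^sub>M lborel) (\<lambda>x. (case x of (t, y) \<Rightarrow> f t * g (y - c * t)) * of_real M)"
    by (intro integrable_mult_left)
  then show ?thesis
  proof (rule Bochner_Integration.integrable_bound[OF _ H])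
    have "norm (H (t, y)) \<le> norm (f t) * norm (g (y - c * t)) * \<bar>M\<bar>" for t y
      using bound[of t y] by (rule order_trans) (simp add: mult_left_mono)
    then show "AE x in lborel \<Otimes>\<^sub>M lborel. norm (H x) \<le> norm ((case x of (t, y) \<Rightarrow> f t * g (y - c * t)) * of_real M)"
      by (auto simp: norm_mult)
  qed
qed

section \<open>The Gaussian approximate identity and its Fourier transform\<close>

lemma integral_gaussian_exp:
  fixes s p :: real
  assumes "s > 0"
  shows "integrable lborel (\<lambda>u. complex_of_real (exp (- (s * u)\<^sup>2 / 2)))"
    and "(LINT u|lborel. complex_of_real (exp (- (s * u)\<^sup>2 / 2)) * exp (\<i> * of_real (p * u))) =
      of_real (sqrt (2 * pi) / s * exp (- (p / s)\<^sup>2 / 2))"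
proof -
  have std: "integrable lborel (\<lambda>u. complex_of_real (exp (- u\<^sup>2 / 2)))"
  proof -
    have "integrable lborel (\<lambda>u. sqrt (2 * pi) * std_normal_density u)"
      using integrable_std_normal_moment[of 0] by simp
    then show ?thesis
      by (intro integrable_of_real) (simp add: std_normal_density_def)
  qed
  then show "integrable lborel (\<lambda>u. complex_of_real (exp (- (s * u)\<^sup>2 / 2)))"
    using lborel_integrable_real_affine[OF std, of s 0] assms by simp
  \<comment> \<open>This is the characteristic function of the standard normal law; other widths
    follow by rescaling.\<close>
  have "(LINT u|lborel. std_normal_density u *\<^sub>R exp (\<i> * of_real (t * u))) = of_real (exp (- t\<^sup>2 / 2))" for t
  proof -
    have "(LINT u|lborel. std_normal_density u *\<^sub>R exp (\<i> * of_real (t * u))) = char std_normal_distribution t"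
      unfolding char_def by (subst integral_density) (auto simp: mult_ac)
    then show ?thesis by (simp add: char_std_normal_distribution)
  qed
  note * = this
  have **: "(LINT u|lborel. complex_of_real (exp (- u\<^sup>2 / 2)) * exp (\<i> * of_real (t * u))) = of_real (sqrt (2 * pi) * exp (- t\<^sup>2 / 2))" for t
  proof -
    have "(LINT u|lborel. complex_of_real (exp (- u\<^sup>2 / 2)) * exp (\<i> * of_real (t * u)))
      = (LINT u|lborel. of_real (sqrt (2 * pi)) * (std_normal_density u *\<^sub>R exp (\<i> * of_real (t * u))))"
      by (intro Bochner_Integration.integral_cong refl)
         (simp add: std_normal_density_def scaleR_conv_of_real real_sqrt_mult)
    also have "\<dots> = of_real (sqrt (2 * pi)) * of_real (exp (- t\<^sup>2 / 2))"
      by (simp only: integral_mult_right_zero *)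
    finally show ?thesis by simp
  qed
  have "(LINT u|lborel. complex_of_real (exp (- u\<^sup>2 / 2)) * exp (\<i> * of_real (p / s * u)))
     = \<bar>s\<bar> *\<^sub>R (LINT u|lborel. complex_of_real (exp (- (0 + s * u)\<^sup>2 / 2)) * exp (\<i> * of_real (p / s * (0 + s * u))))"
    using assms by (intro lborel_integral_real_affine) auto
  also have "(\<lambda>u. complex_of_real (exp (- (0 + s * u)\<^sup>2 / 2)) * exp (\<i> * of_real (p / s * (0 + s * u)))) =
      (\<lambda>u. complex_of_real (exp (- (s * u)\<^sup>2 / 2)) * exp (\<i> * of_real (p * u)))"
    using assms by (auto simp: fun_eq_iff)
  finally show "(LINT u|lborel. complex_of_real (exp (- (s * u)\<^sup>2 / 2)) * exp (\<i> * of_real (p * u))) =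
      of_real (sqrt (2 * pi) / s * exp (- (p / s)\<^sup>2 / 2))"
    using assms unfolding ** by (auto simp: scaleR_conv_of_real field_simps)
qed

text \<open>Defined on the complex plane because it is the factor that gets shifted off the real
  axis. The width is \<open>1 / s\<close>, so large \<open>s\<close> gives an approximate
  identity.\<close>

definition gauss :: "real \<Rightarrow> complex \<Rightarrow> complex" where
  "gauss s z = of_real (s / sqrt (2 * pi)) * exp (- (of_real s * z)\<^sup>2 / 2)"

lemma gauss_of_real: "gauss s (of_real x) = of_real (s / sqrt (2 * pi)) * of_real (exp (- (s * x)\<^sup>2 / 2))"
  by (simp add: gauss_def flip: exp_of_real)

lemma norm_gauss:
  assumes "s > 0"
  shows "norm (gauss s (of_real x + \<i> * of_real v)) = exp ((s * v)\<^sup>2 / 2) * norm (gauss s (of_real x))"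
proof -
  have "norm (exp (- (of_real s * (of_real x + \<i> * of_real v))\<^sup>2 / 2)) = exp ((s * v)\<^sup>2 / 2) * exp (- (s * x)\<^sup>2 / 2)"
    unfolding norm_exp_eq_Re exp_add[symmetric]
    by (simp add: power2_eq_square algebra_simps diff_divide_distrib)
  then show ?thesis
    unfolding gauss_of_real gauss_def norm_mult by simp
qed

lemma gauss_measurable [measurable]: "gauss s \<in> borel_measurable borel"
  unfolding gauss_def by measurable

lemma integrable_gauss_line:
  assumes "s > 0"
  shows "integrable lborel (\<lambda>x. gauss s (of_real (x - t) + \<i> * of_real v))"
proof -
  have "integrable lborel (\<lambda>x. gauss s (of_real x))"
    unfolding gauss_of_real using integral_gaussian_exp(1)[OF assms]
    by (intro integrable_mult_right)
  from lborel_integrable_real_affine[OF this, of 1 "-t"]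
  have "integrable lborel (\<lambda>x. exp ((s * v)\<^sup>2 / 2) *\<^sub>R gauss s (of_real (x - t)))"
    by simp
  then show ?thesis
    by (rule Bochner_Integration.integrable_bound) (auto simp: norm_gauss[OF assms] simp del: of_real_diff)
qed

lemma gauss_fourier:
  assumes "s > 0"
  shows "(LINT t|lborel. exp (\<i> * of_real (p * t)) * gauss s (of_real (y - t))) =
     exp (\<i> * of_real (p * y)) * of_real (exp (- (p / s)\<^sup>2 / 2))"
proof -
  have "(LINT t|lborel. exp (\<i> * of_real (p * t)) * gauss s (of_real (y - t))) =
    (LINT u|lborel. exp (\<i> * of_real (p * (y + (-1) * u))) * gauss s (of_real (y - (y + (-1) * u))))"
    using lborel_integral_real_affine[of "-1" "\<lambda>t. exp (\<i> * of_real (p * t)) * gauss s (of_real (y - t))" y]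
    by simp
  also have "\<dots> = (LINT u|lborel. exp (\<i> * of_real (p * y)) * of_real (s / sqrt (2 * pi)) *
     (complex_of_real (exp (- (s * u)\<^sup>2 / 2)) * exp (\<i> * of_real ((- p) * u))))"
    by (intro Bochner_Integration.integral_cong refl)
       (simp add: gauss_of_real exp_add[symmetric] algebra_simps exp_diff exp_minus divide_simps)
  also have "\<dots> = exp (\<i> * of_real (p * y)) * of_real (exp (- (p / s)\<^sup>2 / 2))"
    unfolding integral_mult_right_zero integral_gaussian_exp(2)[OF assms]
    using assms by (simp add: field_simps)
  finally show ?thesis .
qed

text \<open>Raising the Gaussian to height \<open>a\<close> multiplies its transform by exp (- a p),
  the same damping that defines \<open>shifted\<close>. The Gaussian decay in \<open>p\<close>
  absorbs the growth of this factor at negative frequencies.\<close>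

lemma gauss_shifted_fourier:
  assumes "s > 0"
  shows "integrable lborel (\<lambda>p. complex_of_real (exp (- (p / s)\<^sup>2 / 2) * exp (- (a * p))))"
    and "gauss s (of_real x + \<i> * of_real a) = of_real (1 / (2 * pi)) *
     (LINT p|lborel. of_real (exp (- (p / s)\<^sup>2 / 2) * exp (- (a * p))) * exp (\<i> * of_real (p * x)))"
proof -
  \<comment> \<open>Completing the square: the product is again a Gaussian, centred at - a
    s^2.\<close>
  have sq: "exp (- (p / s)\<^sup>2 / 2) * exp (- (a * p)) = exp ((a * s)\<^sup>2 / 2) * exp (- (1 / s * (p + a * s\<^sup>2))\<^sup>2 / 2)" for p
    using assms by (simp add: exp_add[symmetric] field_simps power2_eq_square)
  have i: "integrable lborel (\<lambda>u. complex_of_real (exp (- (1 / s * u)\<^sup>2 / 2)))"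
    using assms by (intro integral_gaussian_exp) simp
  have "integrable lborel (\<lambda>p. of_real (exp ((a * s)\<^sup>2 / 2)) * complex_of_real (exp (- (1 / s * (p + a * s\<^sup>2))\<^sup>2 / 2)))"
    using lborel_integrable_real_affine[OF i, of 1 "a * s\<^sup>2"]
    by (intro integrable_mult_right) (simp add: add.commute)
  then show "integrable lborel (\<lambda>p. complex_of_real (exp (- (p / s)\<^sup>2 / 2) * exp (- (a * p))))"
    unfolding sq by simp
  have "(LINT p|lborel. of_real (exp (- (p / s)\<^sup>2 / 2) * exp (- (a * p))) * exp (\<i> * of_real (p * x)))
    = (LINT w|lborel. of_real (exp (- ((-(a * s\<^sup>2) + 1 * w) / s)\<^sup>2 / 2) * exp (- (a * (-(a * s\<^sup>2) + 1 * w)))) * exp (\<i> * of_real ((-(a * s\<^sup>2) + 1 * w) * x)))"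
    using lborel_integral_real_affine[of 1 "\<lambda>p. of_real (exp (- (p / s)\<^sup>2 / 2) * exp (- (a * p))) * exp (\<i> * of_real (p * x))" "- (a * s\<^sup>2)"]
    by simp
  also have "\<dots> = (LINT w|lborel. of_real (exp ((a * s)\<^sup>2 / 2)) * exp (- \<i> * of_real (a * s\<^sup>2 * x)) * (of_real (exp (- (1 / s * w)\<^sup>2 / 2)) * exp (\<i> * of_real (x * w))))"
    unfolding sq by (intro Bochner_Integration.integral_cong refl) (simp add: exp_add[symmetric] algebra_simps exp_diff exp_minus divide_simps)
  also have "\<dots> = of_real (exp ((a * s)\<^sup>2 / 2)) * exp (- \<i> * of_real (a * s\<^sup>2 * x)) * of_real (sqrt (2 * pi) * s * exp (- (x * s)\<^sup>2 / 2))"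
    unfolding integral_mult_right_zero using assms by (subst integral_gaussian_exp(2)) auto
  also have "\<dots> = of_real (2 * pi) * gauss s (of_real x + \<i> * of_real a)"
  proof -
    have "sqrt (2 * pi) * s = 2 * pi * (s / sqrt (2 * pi))"
      by (simp add: field_simps flip: power2_eq_square)
    moreover have "of_real (exp ((a * s)\<^sup>2 / 2)) * exp (- \<i> * of_real (a * s\<^sup>2 * x)) * complex_of_real (exp (- (x * s)\<^sup>2 / 2))
       = exp (- (of_real s * (of_real x + \<i> * of_real a))\<^sup>2 / 2)"
      by (simp add: exp_of_real[symmetric] exp_add[symmetric] power2_eq_square algebra_simps add_divide_distrib diff_divide_distrib)
    ultimately show ?thesis
      unfolding gauss_def by (simp only: of_real_mult mult_ac)
  qed
  finally show "gauss s (of_real x + \<i> * of_real a) = of_real (1 / (2 * pi)) *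
     (LINT p|lborel. of_real (exp (- (p / s)\<^sup>2 / 2) * exp (- (a * p))) * exp (\<i> * of_real (p * x)))"
    by simp
qed

lemma gauss_1: "integrable lborel (\<lambda>v. gauss 1 (of_real v))" "(LINT v|lborel. gauss 1 (of_real v)) = 1"
proof -
  show "integrable lborel (\<lambda>v. gauss 1 (of_real v))"
    using integrable_gauss_line[of 1 0 0] by simp
  have "(LINT v|lborel. gauss 1 (of_real v)) =
     (LINT v|lborel. of_real (1 / sqrt (2 * pi)) * (complex_of_real (exp (- (1 * v)\<^sup>2 / 2)) * exp (\<i> * of_real (0 * v))))"
    unfolding gauss_of_real by simp
  also have "\<dots> = 1"
    unfolding integral_mult_right_zero by (subst integral_gaussian_exp(2)) auto
  finally show "(LINT v|lborel. gauss 1 (of_real v)) = 1" .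
qed

text \<open>After the substitution y = t + v / s the Gaussian no longer depends on \<open>s\<close>,
  which yields a fixed dominating function for the limit.\<close>

lemma gauss_mollify_inner:
  assumes "s > 0"
  shows "(LINT y|lborel. gauss s (of_real (y - t)) * U y) =
         (LINT v|lborel. gauss 1 (of_real v) * U (t + v / s))"
proof -
  have "(LINT y|lborel. gauss s (of_real (y - t)) * U y) =
      \<bar>1 / s\<bar> *\<^sub>R (LINT v|lborel. gauss s (of_real ((t + 1 / s * v) - t)) * U (t + 1 / s * v))"
    using assms by (intro lborel_integral_real_affine) auto
  also have "\<dots> = (LINT v|lborel. gauss 1 (of_real v) * U (t + v / s))"
    using assms
    by (subst integral_scaleR_right[symmetric], intro Bochner_Integration.integral_cong refl)
       (simp add: gauss_def scaleR_conv_of_real field_simps)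
  finally show ?thesis .
qed

text \<open>Dominated convergence is applied twice: in \<open>v\<close>, by continuity of
  \<open>U\<close> at each \<open>t\<close>, and then in \<open>t\<close>, where the inner integrals
  are bounded by \<open>K\<close> uniformly in \<open>t\<close> and in the width.\<close>

lemma gauss_mollify:
  fixes f U :: "real \<Rightarrow> complex"
  assumes f: "integrable lborel f" and U: "continuous_on UNIV U" and M: "\<And>x. norm (U x) \<le> M"
  shows "(\<lambda>n. LINT t|lborel. f t * (LINT y|lborel. gauss (real (Suc n)) (of_real (y - t)) * U y))
           \<longlonglongrightarrow> (LINT t|lborel. f t * U t)"
proof -
  define K where "K = (LINT v|lborel. norm (gauss 1 (of_real v)) * M)"
  have [measurable]: "U \<in> borel_measurable borel" "f \<in> borel_measurable borel"
    using U f by (auto intro: borel_measurable_continuous_onI)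
  have ibd: "integrable lborel (\<lambda>v. norm (gauss 1 (of_real v)) * M)"
    using gauss_1(1) by (intro integrable_mult_left integrable_norm)
  have bd: "norm (gauss 1 (of_real v) * U (t + v / s)) \<le> norm (gauss 1 (of_real v)) * M" for v t s
    unfolding norm_mult by (intro mult_left_mono M) auto
  have meas: "(\<lambda>t. LINT v|lborel. gauss 1 (of_real v) * U (t + v / s)) \<in> borel_measurable borel" for s
    by measurable
  have inner: "norm (LINT v|lborel. gauss 1 (of_real v) * U (t + v / s)) \<le> K" for t s
    unfolding K_def
    by (rule Bochner_Integration.integral_norm_bound_integral[OF _ ibd bd])
       (rule Bochner_Integration.integrable_bound[OF ibd], auto intro!: always_eventually order_trans[OF bd])
  have "(\<lambda>n. LINT t|lborel. f t * (LINT v|lborel. gauss 1 (of_real v) * U (t + v / real (Suc n))))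
           \<longlonglongrightarrow> (LINT t|lborel. f t * U t)"
  proof (rule integral_dominated_convergence[where w = "\<lambda>t. norm (f t) * K"])
    show "AE t in lborel. (\<lambda>n. f t * (LINT v|lborel. gauss 1 (of_real v) * U (t + v / real (Suc n)))) \<longlonglongrightarrow> f t * U t"
    proof (intro always_eventually allI tendsto_mult tendsto_const)
      fix t
      have "(\<lambda>n. LINT v|lborel. gauss 1 (of_real v) * U (t + v / real (Suc n)))
        \<longlonglongrightarrow> (LINT v|lborel. gauss 1 (of_real v) * U t)"
      proof (rule integral_dominated_convergence[OF _ _ ibd])
        show "AE v in lborel. (\<lambda>n. gauss 1 (of_real v) * U (t + v / real (Suc n))) \<longlonglongrightarrow> gauss 1 (of_real v) * U t"
        proof (intro always_eventually allI tendsto_mult tendsto_const)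
          fix v
          have "isCont U t" using U by (simp add: continuous_on_eq_continuous_at)
          moreover have "(\<lambda>n. t + v / real (Suc n)) \<longlonglongrightarrow> t" by real_asymp
          ultimately show "(\<lambda>n. U (t + v / real (Suc n))) \<longlonglongrightarrow> U t"
            by (rule isCont_tendsto_compose)
        qed
      qed (auto intro!: always_eventually simp del: of_nat_Suc intro: bd)
      then show "(\<lambda>n. LINT v|lborel. gauss 1 (of_real v) * U (t + v / real (Suc n))) \<longlonglongrightarrow> U t"
        using gauss_1(2) by simp
    qed
    show "integrable lborel (\<lambda>t. norm (f t) * K)"
      using f by (intro integrable_mult_left integrable_norm)
    show "AE t in lborel. norm (f t * (LINT v|lborel. gauss 1 (of_real v) * U (t + v / real (Suc n)))) \<le> norm (f t) * K" for n
      unfolding norm_mult by (intro always_eventually allI mult_left_mono inner) auto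
    show "(\<lambda>t. f t * (LINT v|lborel. gauss 1 (of_real v) * U (t + v / real (Suc n)))) \<in> borel_measurable lborel" for n
      using meas by (auto intro!: borel_measurable_times)
  qed auto
  then show ?thesis
    by (simp only: gauss_mollify_inner of_nat_0_less_iff zero_less_Suc)
qed

lemma fourier_measurable [measurable]:
  assumes [measurable]: "f \<in> borel_measurable borel"
  shows "fourier f \<in> borel_measurable borel"
  unfolding fourier_def[abs_def] by measurable

lemma norm_fourier_le:
  "norm (fourier f p) \<le> 1 / sqrt (2 * pi) * (LINT y|lborel. norm (f y))"
proof -
  have "norm (LINT y|lborel. f y * exp (- \<i> * complex_of_real (p * y))) \<le>
     (LINT y|lborel. norm (f y * exp (- \<i> * complex_of_real (p * y))))"
    by (rule integral_norm_bound)
  then show ?thesis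
    unfolding fourier_def norm_mult by (simp add: norm_mult norm_divide divide_right_mono)
qed

text \<open>Formally the value of \<open>f\<close> at y + i a, since exp (i p (y + i a)) = exp (- a
  p) exp (i p y). The Fourier side gives it a meaning without any regularity of
  \<open>f\<close>.\<close>

definition shifted :: "real \<Rightarrow> (real \<Rightarrow> complex) \<Rightarrow> real \<Rightarrow> complex" where
  "shifted a f y = of_real (1 / sqrt (2 * pi)) *
     (LINT p:{0<..}|lborel. fourier f p * of_real (exp (- (a * p))) * exp (\<i> * of_real (p * y)))"

lemma set_integrable_exp_neg:
  assumes "a > (0::real)"
  shows "set_integrable lborel {0<..} (\<lambda>p. exp (- (a * p)))"
proof -
  have "set_integrable lborel {0<..} (\<lambda>p. p powr 0 * exp (- (a * p)))"
    using assms by (intro set_integrable_powr_exp) auto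
  then show ?thesis
    unfolding set_integrable_def
    by (rule Bochner_Integration.integrable_bound) (auto simp: indicator_def)
qed

text \<open>In the frequency expansion the factor exp (- a p) may be credited to the Gaussian, which
  raises it to height \<open>a\<close>, or to \<open>f\<close>, which turns it into
  \<open>shifted a f\<close>. The second reading converges because all frequencies of
  \<open>f\<close> are positive.\<close>

lemma shifted_convolution:
  assumes f: "integrable lborel f" and pos: "\<And>p. p \<le> 0 \<Longrightarrow> fourier f p = 0" and "a > 0" "s > 0"
  shows "(LINT t|lborel. f t * gauss s (of_real (y - t) + \<i> * of_real a)) =
         (LINT t|lborel. shifted a f t * gauss s (of_real (y - t)))"
proof -
  have [measurable]: "f \<in> borel_measurable borel" using f by auto
  define E where "E p x = exp (\<i> * complex_of_real (p * x))" for p x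
  have [measurable]: "(\<lambda>(p, x). E p x) \<in> borel_measurable (borel \<Otimes>\<^sub>M borel)"
    unfolding E_def by measurable
  have [measurable]: "E p \<in> borel_measurable borel" for p unfolding E_def by measurable
  have nE [simp]: "norm (E p x) = 1" for p x by (simp add: E_def)
  define w where "w p = complex_of_real (exp (- (p / s)\<^sup>2 / 2) * exp (- (a * p)))" for p
  have w: "integrable lborel w"
    unfolding w_def using gauss_shifted_fourier(1)[OF \<open>s > 0\<close>] .
  have [measurable]: "w \<in> borel_measurable borel" unfolding w_def by measurable
  \<comment> \<open>The damped transform of \<open>f\<close>. It is integrable because the transform
    of an integrable function is bounded and exp (- a p) is integrable on the half-line.\<close>
  define \<psi> where "\<psi> p = indicator {0<..} p *\<^sub>R (fourier f p * of_real (exp (- (a * p))))" for p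
  have [measurable]: "\<psi> \<in> borel_measurable borel" unfolding \<psi>_def by measurable
  have \<psi>: "integrable lborel \<psi>"
  proof -
    have "integrable lborel (\<lambda>p. 1 / sqrt (2 * pi) * (LINT y|lborel. norm (f y)) * (indicator {0<..} p * exp (- (a * p))))"
      using set_integrable_exp_neg[OF \<open>a > 0\<close>]
      by (intro integrable_mult_right) (simp add: set_integrable_def)
    then show ?thesis
    proof (rule Bochner_Integration.integrable_bound)
      show "AE p in lborel. norm (\<psi> p) \<le> norm (1 / sqrt (2 * pi) * (LINT y|lborel. norm (f y)) * (indicator {0<..} p * exp (- (a * p))))"
      proof (intro always_eventually allI)
        fix p
        have "norm (\<psi> p) = norm (fourier f p) * (indicator {0<..} p * exp (- (a * p)))"
          by (simp add: \<psi>_def norm_mult)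
        also have "\<dots> \<le> 1 / sqrt (2 * pi) * (LINT y|lborel. norm (f y)) * (indicator {0<..} p * exp (- (a * p)))"
          by (intro mult_right_mono norm_fourier_le) auto
        finally show "norm (\<psi> p) \<le> norm (1 / sqrt (2 * pi) * (LINT y|lborel. norm (f y)) * (indicator {0<..} p * exp (- (a * p))))"
          unfolding real_norm_def by (rule order_trans) (rule abs_ge_self)
      qed
    qed simp
  qed
  have g: "integrable lborel (\<lambda>t. gauss s (of_real (y - t)))"
    using lborel_integrable_real_affine[OF integrable_gauss_line[OF \<open>s > 0\<close>, of 0 0], of "-1" y] by simp
  have "(LINT t|lborel. f t * gauss s (of_real (y - t) + \<i> * of_real a)) =
     (LINT t|lborel. LINT p|lborel. of_real (1 / (2 * pi)) * (f t * w p * E p (y - t)))"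
    unfolding gauss_shifted_fourier(2)[OF \<open>s > 0\<close>] w_def[symmetric] E_def[symmetric] integral_mult_right_zero
    by (simp add: mult_ac flip: integral_mult_right_zero)
  also have "\<dots> = (LINT p|lborel. LINT t|lborel. of_real (1 / (2 * pi)) * (f t * w p * E p (y - t)))"
    by (rule lborel_pair.Fubini_integral[symmetric],
        rule integrable_pair_dominated[where c = 0 and M = "1 / (2 * pi)", OF f w])
       (auto simp: norm_mult norm_divide)
  also have "\<dots> = (LINT p|lborel. of_real (1 / sqrt (2 * pi)) * (\<psi> p * (E p y * of_real (exp (- (p / s)\<^sup>2 / 2)))))"
  proof (intro Bochner_Integration.integral_cong refl)
    fix p
    have "(LINT t|lborel. of_real (1 / (2 * pi)) * (f t * w p * E p (y - t)))
      = (LINT t|lborel. of_real (1 / (2 * pi)) * w p * E p y * (f t * exp (- \<i> * complex_of_real (p * t))))"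
      by (intro Bochner_Integration.integral_cong refl)
         (simp add: E_def algebra_simps exp_diff exp_minus divide_simps)
    also have "\<dots> = of_real (1 / (2 * pi)) * w p * E p y * (of_real (sqrt (2 * pi)) * fourier f p)"
      unfolding integral_mult_right_zero fourier_def by simp
    \<comment> \<open>For p \<le> 0 both sides vanish, the left by the assumption on the transform
      and the right by the indicator in \<open>\<psi>\<close>.\<close>
    also have "\<dots> = of_real (1 / sqrt (2 * pi)) * (\<psi> p * (E p y * of_real (exp (- (p / s)\<^sup>2 / 2))))"
    proof -
      have "1 / sqrt (2 * pi) = 1 / (2 * pi) * sqrt (2 * pi)" by (simp add: field_simps flip: power2_eq_square)
      then show ?thesis
        using pos[of p] by (simp only: of_real_mult) (auto simp: \<psi>_def w_def indicator_def)
    qed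
    finally show "(LINT t|lborel. of_real (1 / (2 * pi)) * (f t * w p * E p (y - t))) =
       of_real (1 / sqrt (2 * pi)) * (\<psi> p * (E p y * of_real (exp (- (p / s)\<^sup>2 / 2))))" .
  qed
  also have "\<dots> = (LINT p|lborel. LINT t|lborel. of_real (1 / sqrt (2 * pi)) * (\<psi> p * (E p t * gauss s (of_real (y - t)))))"
    unfolding integral_mult_right_zero E_def gauss_fourier[OF \<open>s > 0\<close>] ..
  also have "\<dots> = (LINT t|lborel. LINT p|lborel. of_real (1 / sqrt (2 * pi)) * (\<psi> p * (E p t * gauss s (of_real (y - t)))))"
    by (rule lborel_pair.Fubini_integral,
        rule integrable_pair_dominated[where c = 0 and M = "1 / sqrt (2 * pi)", OF g \<psi>])
       (auto simp: norm_mult norm_divide mult_ac simp del: of_real_diff)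
  also have "\<dots> = (LINT t|lborel. shifted a f t * gauss s (of_real (y - t)))"
    unfolding shifted_def set_lebesgue_integral_def E_def[symmetric]
    by (simp add: \<psi>_def mult_ac del: of_real_diff flip: integral_mult_right_zero integral_mult_left_zero)
  finally show ?thesis .
qed

text \<open>Convolving with a Gaussian makes everything absolutely convergent, so that the contour shift can be
  done on the Gaussian and undone again on the Fourier side.\<close>
lemma positive_frequency_shift:
  fixes f :: "real \<Rightarrow> complex" and W :: "complex \<Rightarrow> complex"
  assumes f: "integrable lborel f" and pos: "\<And>p. p \<le> 0 \<Longrightarrow> fourier f p = 0" and "a > 0"
    and \<phi>: "integrable lborel (shifted a f)"
    and T: "open T" "{z. 0 \<le> Im z \<and> Im z \<le> a} \<subseteq> T" and holo: "W holomorphic_on T"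
    and bound: "\<And>z. 0 \<le> Im z \<Longrightarrow> Im z \<le> a \<Longrightarrow> norm (W z) \<le> M"
  shows "(LINT y|lborel. f y * W (of_real y)) = (LINT y|lborel. shifted a f y * W (of_real y + \<i> * of_real a))"
proof -
  define V where "V v y = W (of_real y + \<i> * of_real v)" for v y
  have contV: "continuous_on UNIV (V v)" if "0 \<le> v" "v \<le> a" for v
    unfolding V_def
    by (rule continuous_on_compose2[OF holomorphic_on_imp_continuous_on[OF holo]])
       (use T that in \<open>auto intro!: continuous_intros\<close>)
  have Vm: "V v \<in> borel_measurable borel" if "0 \<le> v" "v \<le> a" for v
    using contV[OF that] by (rule borel_measurable_continuous_onI)
  have [measurable]: "V 0 \<in> borel_measurable borel" "V a \<in> borel_measurable borel"
    using Vm \<open>a > 0\<close> by auto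
  have VM: "norm (V v y) \<le> M" if "0 \<le> v" "v \<le> a" for v y
    unfolding V_def using that by (intro bound) auto
  have M0: "M \<ge> 0" using order_trans[OF norm_ge_zero VM[of 0 0]] \<open>a > 0\<close> by simp
  have [measurable]: "f \<in> borel_measurable borel" "shifted a f \<in> borel_measurable borel"
    using f \<phi> by auto
  \<comment> \<open>The actual contour shift: the Gaussian supplies the horizontal decay that the
    bounded function \<open>W\<close> lacks.\<close>
  have shift: "(LINT y|lborel. gauss s (of_real (y - t)) * V 0 y) =
     (LINT y|lborel. gauss s (of_real (y - t) + \<i> * of_real a) * V a y)" if "s > 0" for s t
  proof -
    have int: "integrable lborel (\<lambda>x. gauss s (of_real x + \<i> * of_real v - of_real t) * W (of_real x + \<i> * of_real v))"
      if v: "0 \<le> v" "v \<le> a" for v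
    proof -
      have [measurable]: "V v \<in> borel_measurable borel" using Vm v by auto
      have "integrable lborel (\<lambda>x. of_real M * gauss s (of_real (x - t) + \<i> * of_real v))"
        by (intro integrable_mult_right integrable_gauss_line \<open>s > 0\<close>)
      then have "integrable lborel (\<lambda>x. gauss s (of_real x + \<i> * of_real v - of_real t) * V v x)"
        by (rule Bochner_Integration.integrable_bound)
           (use VM[OF v] M0 in \<open>auto simp: norm_mult algebra_simps mult_left_mono mult_right_mono\<close>)
      then show ?thesis by (simp add: V_def)
    qed
    define B where "B x = exp ((s * a)\<^sup>2 / 2) * norm (gauss s (of_real (x - t))) * M" for x
    have "(LINT x|lborel. gauss s (of_real x - of_real t) * W (of_real x)) =
      (LINT x|lborel. gauss s (of_real x + \<i> * of_real a - of_real t) * W (of_real x + \<i> * of_real a))"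
    proof (rule integral_horizontal_shift[where h = "\<lambda>z. gauss s (z - of_real t) * W z" and B = B, OF _ T])
      show "(\<lambda>z. gauss s (z - of_real t) * W z) holomorphic_on T"
        unfolding gauss_def by (intro holomorphic_intros holo) auto
      show "norm (gauss s (z - of_real t) * W z) \<le> B (Re z)" if "0 \<le> Im z" "Im z \<le> a" for z
      proof -
        have "norm (gauss s (z - of_real t)) = exp ((s * Im z)\<^sup>2 / 2) * norm (gauss s (of_real (Re z - t)))"
          using norm_gauss[OF \<open>s > 0\<close>, of "Re z - t" "Im z"]
          by (metis (no_types, lifting) add_diff_eq diff_add_eq of_real_diff complex_eq)
        also have "\<dots> \<le> exp ((s * a)\<^sup>2 / 2) * norm (gauss s (of_real (Re z - t)))"
          using that \<open>s > 0\<close> by (intro mult_right_mono) (auto intro!: power_mono mult_left_mono)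
        finally show ?thesis
          unfolding B_def norm_mult using that by (intro mult_mono bound) auto
      qed
      have B: "B = (\<lambda>x. exp ((s * a)\<^sup>2 / 2) * (s / sqrt (2 * pi) * exp (- (s * (x - t))\<^sup>2 / 2)) * M)"
        unfolding B_def gauss_of_real using \<open>s > 0\<close> by (auto simp: fun_eq_iff norm_mult norm_divide simp flip: of_real_mult)
      have "((\<lambda>x. exp (- (s * (x - t))\<^sup>2 / 2)) \<longlongrightarrow> 0) at_top" using \<open>s > 0\<close> by real_asymp
      from tendsto_mult_right_zero[OF this, of "exp ((s * a)\<^sup>2 / 2) * M * (s / sqrt (2 * pi))"]
      show "(B \<longlongrightarrow> 0) at_top"
        unfolding B by (simp add: mult_ac)
      have "((\<lambda>x. exp (- (s * (x - t))\<^sup>2 / 2)) \<longlongrightarrow> 0) at_bot" using \<open>s > 0\<close> by real_asymp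
      from tendsto_mult_right_zero[OF this, of "exp ((s * a)\<^sup>2 / 2) * M * (s / sqrt (2 * pi))"]
      show "(B \<longlongrightarrow> 0) at_bot"
        unfolding B by (simp add: mult_ac)
    qed (use int[of 0] int[of a] \<open>a > 0\<close> in auto)
    then show ?thesis by (simp add: V_def algebra_simps)
  qed
  \<comment> \<open>Fubini brings the \<open>t\<close>-integral inside, where
    \<open>shifted_convolution\<close> moves the shift from the Gaussian to \<open>f\<close>; a
    second exchange restores the order.\<close>
  have key: "(LINT t|lborel. f t * (LINT y|lborel. gauss s (of_real (y - t)) * V 0 y)) =
     (LINT t|lborel. shifted a f t * (LINT y|lborel. gauss s (of_real (y - t)) * V a y))" if "s > 0" for s
  proof -
    have VMa: "norm (V a y) \<le> M" for y using VM \<open>a > 0\<close> by auto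
    have gi: "integrable lborel (\<lambda>u. gauss s (of_real u + \<i> * of_real v))" for v
      using integrable_gauss_line[OF \<open>s > 0\<close>, of 0] by simp
    have "(LINT t|lborel. f t * (LINT y|lborel. gauss s (of_real (y - t)) * V 0 y)) =
      (LINT t|lborel. LINT y|lborel. f t * gauss s (of_real (y - t) + \<i> * of_real a) * V a y)"
      unfolding shift[OF \<open>s > 0\<close>] by (simp add: mult_ac flip: integral_mult_right_zero)
    also have "\<dots> = (LINT y|lborel. LINT t|lborel. f t * gauss s (of_real (y - t) + \<i> * of_real a) * V a y)"
      by (rule lborel_pair.Fubini_integral[symmetric],
          rule integrable_pair_dominated[where c = 1 and M = M, OF f gi[of a]])
         (use VMa in \<open>auto simp: norm_mult intro!: mult_left_mono\<close>)
    also have "\<dots> = (LINT y|lborel. LINT t|lborel. shifted a f t * gauss s (of_real (y - t)) * V a y)"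
    proof -
      have "(LINT t|lborel. f t * gauss s (of_real (y - t) + \<i> * of_real a)) =
         (LINT t|lborel. shifted a f t * gauss s (of_real (y - t)))" for y
        by (rule shifted_convolution[OF f pos \<open>a > 0\<close> \<open>s > 0\<close>])
      then show ?thesis unfolding integral_mult_left_zero by simp
    qed
    also have "\<dots> = (LINT t|lborel. LINT y|lborel. shifted a f t * gauss s (of_real (y - t)) * V a y)"
      by (rule lborel_pair.Fubini_integral,
          rule integrable_pair_dominated[where c = 1 and M = M and g = "\<lambda>u. gauss s (of_real u)", OF \<phi>])
         (use VMa gi[of 0] in \<open>auto simp: norm_mult intro!: mult_left_mono\<close>)
    finally show ?thesis by (simp add: mult_ac flip: integral_mult_right_zero)
  qed
  \<comment> \<open>The mollifier disappears on both edges as the width tends to 0, and the two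
    limits must agree. \<open>Suc n\<close> keeps the parameter positive for every index.\<close>
  have "(\<lambda>n. LINT t|lborel. f t * (LINT y|lborel. gauss (real (Suc n)) (of_real (y - t)) * V 0 y))
           \<longlonglongrightarrow> (LINT t|lborel. f t * V 0 t)"
    using \<open>a > 0\<close> by (intro gauss_mollify[where M = M] f contV VM) auto
  moreover have "(\<lambda>n. LINT t|lborel. f t * (LINT y|lborel. gauss (real (Suc n)) (of_real (y - t)) * V 0 y))
           \<longlonglongrightarrow> (LINT t|lborel. shifted a f t * V a t)"
  proof -
    have "(\<lambda>n. LINT t|lborel. shifted a f t * (LINT y|lborel. gauss (real (Suc n)) (of_real (y - t)) * V a y))
           \<longlonglongrightarrow> (LINT t|lborel. shifted a f t * V a t)"
      using \<open>a > 0\<close> by (intro gauss_mollify[where M = M] \<phi> contV VM) auto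
    then show ?thesis by (simp only: key of_nat_0_less_iff zero_less_Suc)
  qed
  ultimately have "(LINT t|lborel. f t * V 0 t) = (LINT t|lborel. shifted a f t * V a t)"
    by (rule LIMSEQ_unique)
  then show ?thesis by (simp add: V_def)
qed

subsection \<open>Low-frequency asymptotics\<close>

definition wexp :: "real \<Rightarrow> real \<Rightarrow> real \<Rightarrow> real" where
  "wexp a c p = p powr c * exp (- (a * p))"

lemma wexp_measurable [measurable]: "wexp a c \<in> borel_measurable borel"
  unfolding wexp_def by measurable

lemma wexp_nonneg [simp]: "wexp a c p \<ge> 0"
  by (simp add: wexp_def)

lemma wexp_mult: "p > 0 \<Longrightarrow> p * wexp a c p = wexp a (c + 1) p"
  by (simp add: wexp_def powr_add)

lemma set_integrable_wexp:
  assumes "a > 0" "c > -1"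
  shows "set_integrable lborel {0<..} (wexp a c)"
  using set_integrable_powr_exp[OF assms] by (simp add: wexp_def[abs_def])

lemma wexp_tendsto:
  assumes "a > 0" "c > 0"
  shows "(wexp a c \<longlongrightarrow> 0) (at_right 0)" "(wexp a c \<longlongrightarrow> 0) at_top"
  unfolding wexp_def using assms by real_asymp+

lemma wexp_deriv:
  assumes "p > 0"
  shows "(wexp a c has_real_derivative c * wexp a (c - 1) p - a * wexp a c p) (at p)"
  unfolding wexp_def using assms
  by (auto intro!: derivative_eq_intros DERIV_fun_powr[of "\<lambda>p. p" 1, THEN DERIV_cong])

lemma wexp_vderiv:
  assumes "p > 0" "(H has_vector_derivative H') (at p)"
  shows "((\<lambda>p. complex_of_real (wexp a c p) * H p) has_vector_derivative
     of_real (c * wexp a (c - 1) p - a * wexp a c p) * H p + of_real (wexp a c p) * H') (at p)"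
proof -
  have "((\<lambda>p. complex_of_real (wexp a c p)) has_vector_derivative of_real (c * wexp a (c - 1) p - a * wexp a c p)) (at p)"
    using wexp_deriv[OF assms(1)]
    by (intro has_vector_derivative_of_real) (simp add: has_real_derivative_iff_has_vector_derivative)
  from has_vector_derivative_mult[OF this assms(2)] show ?thesis
    by (simp add: add.commute)
qed

lemma set_integrable_unimodular:
  fixes v :: "real \<Rightarrow> complex"
  assumes "set_integrable lborel A v"
  shows "set_integrable lborel A (\<lambda>p. v p * exp (\<i> * of_real (p * y)))"
proof -
  have [measurable]: "(\<lambda>x. indicat_real A x *\<^sub>R v x) \<in> borel_measurable lborel"
    using assms by (auto simp: set_integrable_def)
  have "(\<lambda>x. (indicat_real A x *\<^sub>R v x) * exp (\<i> * of_real (x * y))) \<in> borel_measurable lborel"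
    by measurable
  then show ?thesis
    using assms unfolding set_integrable_def
    by (elim Bochner_Integration.integrable_bound) (auto simp: norm_mult)
qed

lemma norm_set_integral_unimodular_le:
  fixes v :: "real \<Rightarrow> complex"
  assumes "set_integrable lborel A v"
  shows "norm (LINT p:A|lborel. v p * exp (\<i> * of_real (p * y))) \<le> (LINT p:A|lborel. norm (v p))"
proof -
  have "norm (LINT p:A|lborel. v p * exp (\<i> * of_real (p * y))) \<le>
        (LINT p:A|lborel. norm (v p * exp (\<i> * of_real (p * y))))"
    unfolding set_lebesgue_integral_def by (rule order_trans[OF integral_norm_bound]) simp
  then show ?thesis by (simp add: norm_mult)
qed

section \<open>The transform of the pure power symbol\<close>

lemma exp_vderiv: "((\<lambda>p. exp (\<i> * of_real (p * y))) has_vector_derivative \<i> * of_real y * exp (\<i> * of_real (p * y))) (at p)"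
proof -
  have "((\<lambda>p. \<i> * complex_of_real (p * y)) has_vector_derivative \<i> * of_real y) (at p)"
    by (auto intro!: derivative_eq_intros simp: has_vector_derivative_of_real)
  from field_vector_diff_chain_at[OF this DERIV_exp] show ?thesis by (simp add: o_def)
qed

text \<open>For a > 0 and c > -1 this is Gamma (c + 1) times (a - i y)^(- c - 1). The argument uses
  the power and the fact that its constant factor is nonzero, not the value of that factor.\<close>

definition gamma_transform :: "real \<Rightarrow> real \<Rightarrow> real \<Rightarrow> complex" where
  "gamma_transform a c y = (LINT p:{0<..}|lborel. of_real (wexp a c p) * exp (\<i> * of_real (p * y)))"

lemma set_integrable_wexp_complex:
  assumes "a > 0" "c > -1"
  shows "set_integrable lborel {0<..} (\<lambda>p. complex_of_real (wexp a c p))"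
  using integrable_of_real[OF set_integrable_wexp[OF assms, unfolded set_integrable_def], where 'a = complex]
  by (simp add: set_integrable_def scaleR_conv_of_real)

lemma gamma_transform_deriv:
  assumes "a > 0" "c > -1"
  shows "(gamma_transform a c has_vector_derivative \<i> * gamma_transform a (c + 1) y) (at y)"
proof -
  have *: "set_integrable lborel {0<..} (\<lambda>p. complex_of_real p ^ n * of_real (wexp a c p))" for n
  proof -
    have "set_integrable lborel {0<..} (\<lambda>p. complex_of_real (wexp a (c + real n) p))"
      using assms by (intro set_integrable_wexp_complex) auto
    then show ?thesis
      by (rule set_integrable_cong[THEN iffD1, rotated -1])
         (auto simp: wexp_def powr_add powr_realpow)
  qed
  have "(gamma_transform a c has_vector_derivative
     (LINT p:{0<..}|lborel. (\<i> * of_real p * of_real (wexp a c p)) * exp (\<i> * of_real (p * y)))) (at y)"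
    unfolding gamma_transform_def[abs_def]
    using *[of 0] *[of 1] *[of 2] by (intro half_line_transform_deriv) auto
  also have "(LINT p:{0<..}|lborel. (\<i> * of_real p * of_real (wexp a c p)) * exp (\<i> * of_real (p * y))) =
     (LINT p:{0<..}|lborel. \<i> * (of_real (wexp a (c + 1) p) * exp (\<i> * of_real (p * y))))"
    by (intro set_lebesgue_integral_cong) (auto simp: wexp_mult[symmetric])
  also have "\<dots> = \<i> * gamma_transform a (c + 1) y"
    by (simp add: gamma_transform_def)
  finally show ?thesis .
qed

text \<open>Integration by parts: p^(c+1) exp (- (a - i y) p) vanishes at 0, because c + 1 > 0, and
  at infinity, so its derivative integrates to 0.\<close>

lemma gamma_transform_rec:
  assumes "a > 0" "c > -1"
  shows "(of_real a - \<i> * of_real y) * gamma_transform a (c + 1) y = of_real (c + 1) * gamma_transform a c y"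
proof -
  define E where "E p = exp (\<i> * complex_of_real (p * y))" for p
  have nE: "norm (E p) = 1" for p by (simp add: E_def)
  have i1: "set_integrable lborel {0<..} (\<lambda>p. of_real (wexp a c p) * E p)"
    and i2: "set_integrable lborel {0<..} (\<lambda>p. of_real (wexp a (c+1) p) * E p)"
    unfolding E_def using assms by (intro set_integrable_unimodular set_integrable_wexp_complex; simp)+
  define g where "g p = of_real (c + 1) * (of_real (wexp a c p) * E p) - (of_real a - \<i> * of_real y) * (of_real (wexp a (c+1) p) * E p)" for p
  have int: "set_integrable lborel {0<..} g"
    unfolding g_def[abs_def] by (intro set_integral_diff set_integrable_mult_right i1 i2)
  have "(LINT p:{0<..}|lborel. g p) = 0 - 0"
  proof (rule integral_FTC_greaterThan[OF _ _ int])
    show "((\<lambda>p. of_real (wexp a (c+1) p) * E p) has_vector_derivative g p) (at p)" if "0 < p" for p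
      using wexp_vderiv[OF that exp_vderiv[of y], of a "c + 1"] unfolding g_def E_def[symmetric]
      by (simp add: algebra_simps)
    show "isCont g p" if "0 < p" for p
      unfolding g_def E_def wexp_def using that by (auto intro!: continuous_intros)
    show "((\<lambda>p. of_real (wexp a (c+1) p) * E p) \<longlongrightarrow> 0) (at_right 0)"
      by (rule Lim_null_comparison[OF _ wexp_tendsto(1)[of a "c + 1"]])
         (use assms in \<open>auto simp: norm_mult nE\<close>)
    show "((\<lambda>p. of_real (wexp a (c+1) p) * E p) \<longlongrightarrow> 0) at_top"
      by (rule Lim_null_comparison[OF _ wexp_tendsto(2)[of a "c + 1"]])
         (use assms in \<open>auto simp: norm_mult nE\<close>)
  qed
  moreover have "(LINT p:{0<..}|lborel. g p) = of_real (c + 1) * gamma_transform a c y - (of_real a - \<i> * of_real y) * gamma_transform a (c + 1) y"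
    unfolding g_def gamma_transform_def E_def[symmetric]
    by (subst set_integral_diff(2)) (auto intro!: set_integrable_mult_right i1 i2)
  ultimately show ?thesis by simp
qed

lemma gamma_base_nonneg: "a > 0 \<Longrightarrow> of_real a - \<i> * of_real y \<notin> \<real>\<^sub>\<le>\<^sub>0"
  by (auto simp: complex_nonpos_Reals_iff)

lemma gamma_base_powr_deriv:
  assumes "a > 0"
  shows "((\<lambda>y. (of_real a - \<i> * of_real y) powr of_real r) has_vector_derivative
     - \<i> * of_real r * (of_real a - \<i> * of_real y) powr of_real (r - 1)) (at y)"
proof -
  have "((\<lambda>y. of_real a - \<i> * complex_of_real y) has_vector_derivative - \<i>) (at y)"
    by (auto intro!: derivative_eq_intros)
  from field_vector_diff_chain_at[OF this has_field_derivative_powr[OF gamma_base_nonneg[OF assms]], of "of_real r"]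
  show ?thesis by (simp add: o_def mult_ac)
qed

text \<open>Avoids a complex Gamma integral: the recurrence shows that the quotient of both sides has derivative 0.\<close>
lemma gamma_transform_eq:
  assumes "a > 0" "c > -1"
  obtains K where "K \<noteq> 0" "\<And>y. gamma_transform a c y = K * (of_real a - \<i> * of_real y) powr of_real (- c - 1)"
proof -
  define b where "b y = complex_of_real a - \<i> * of_real y" for y
  have b0: "b y \<noteq> 0" for y using assms by (auto simp: b_def complex_eq_iff)
  define D where "D y = gamma_transform a c y * b y powr of_real (c + 1)" for y
  have "(D has_vector_derivative 0) (at y)" for y
  proof -
    have "(D has_vector_derivative gamma_transform a c y * (- \<i> * of_real (c + 1) * b y powr of_real (c + 1 - 1))
        + \<i> * gamma_transform a (c + 1) y * b y powr of_real (c + 1)) (at y)"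
      unfolding D_def b_def
      by (rule has_vector_derivative_mult gamma_transform_deriv gamma_base_powr_deriv assms)+
    also have "b y powr of_real (c + 1) = b y powr of_real c * b y"
      using b0 by (simp add: powr_add)
    also have "gamma_transform a c y * (- \<i> * of_real (c + 1) * b y powr of_real (c + 1 - 1))
        + \<i> * gamma_transform a (c + 1) y * (b y powr of_real c * b y) =
        \<i> * b y powr of_real c * (b y * gamma_transform a (c + 1) y - of_real (c + 1) * gamma_transform a c y)"
      by (simp add: algebra_simps)
    also have "\<dots> = 0"
      using gamma_transform_rec[OF assms] by (simp add: b_def)
    finally show ?thesis .
  qed
  then have "\<exists>K. \<forall>y. D y = K"
    by (metis UNIV_I convex_UNIV has_vector_derivative_zero_constant)
  then obtain K where K: "D y = K" for y by auto
  have eq: "gamma_transform a c y = K * b y powr of_real (- c - 1)" for y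
  proof -
    have "K * b y powr of_real (- c - 1) = gamma_transform a c y * (b y powr of_real (c + 1) * b y powr of_real (- (c + 1)))"
      unfolding K[symmetric, of y] D_def minus_add_distrib by (simp only: mult.assoc diff_conv_add_uminus)
    also have "b y powr of_real (c + 1) * b y powr of_real (- (c + 1)) = 1"
      using b0 by (subst powr_add[symmetric]) simp
    finally show ?thesis by simp
  qed
  \<comment> \<open>At y = 0 the transform integrates a strictly positive weight; if it vanished,
    the interval (0, 1) would be a null set.\<close>
  have "K \<noteq> 0"
  proof
    assume "K = 0"
    then have "gamma_transform a c 0 = 0" using eq by simp
    then have "(LINT p:{0<..}|lborel. wexp a c p) = 0"
      unfolding gamma_transform_def by (simp add: set_integral_complex_of_real)
    then have "AE p in lborel. indicator {0<..} p *\<^sub>R wexp a c p = 0"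
      using set_integrable_wexp[OF assms] unfolding set_lebesgue_integral_def set_integrable_def
      by (subst (asm) integral_nonneg_eq_0_iff_AE) auto
    then have "AE p in lborel. p \<notin> {0<..<1::real}"
      by eventually_elim (auto simp: indicator_def wexp_def)
    then have "emeasure lborel {0<..<1::real} = 0"
      by (subst (asm) AE_iff_measurable[of "{0<..<1}"]) auto
    then show False by simp
  qed
  then show ?thesis using that eq by (simp add: b_def)
qed

lemma norm_gamma_base_ge:
  assumes "a > 0"
  shows "min a 1 / 2 * (1 + \<bar>y\<bar>) \<le> norm (of_real a - \<i> * of_real y)"
    "norm (of_real a - \<i> * of_real y) \<le> (1 + a) * (1 + \<bar>y\<bar>)"
proof -
  have "a \<le> norm (of_real a - \<i> * of_real y)" "\<bar>y\<bar> \<le> norm (of_real a - \<i> * of_real y)"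
    using abs_Re_le_cmod[of "of_real a - \<i> * of_real y"] abs_Im_le_cmod[of "of_real a - \<i> * of_real y"] by auto
  moreover have "min a 1 * \<bar>y\<bar> \<le> 1 * \<bar>y\<bar>" by (intro mult_right_mono) auto
  ultimately show "min a 1 / 2 * (1 + \<bar>y\<bar>) \<le> norm (of_real a - \<i> * of_real y)"
    by (simp add: algebra_simps)
  have "norm (of_real a - \<i> * of_real y) \<le> a + \<bar>y\<bar>"
    using norm_triangle_ineq4[of "of_real a" "\<i> * of_real y"] assms by (simp add: norm_mult)
  also have "\<dots> \<le> (1 + a) * (1 + \<bar>y\<bar>)" using assms by (simp add: algebra_simps)
  finally show "norm (of_real a - \<i> * of_real y) \<le> (1 + a) * (1 + \<bar>y\<bar>)" .
qed

lemma norm_gamma_base_powr: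
  assumes "a > 0" "r > 0"
  shows "norm ((of_real a - \<i> * of_real y) powr of_real (- r)) \<le> (min a 1 / 2) powr (- r) * (1 + \<bar>y\<bar>) powr (- r)"
    "(1 + a) powr (- r) * (1 + \<bar>y\<bar>) powr (- r) \<le> norm ((of_real a - \<i> * of_real y) powr of_real (- r))"
proof -
  define z where "z = of_real a - \<i> * of_real y"
  have z: "norm z > 0" using gamma_base_nonneg[OF assms(1), of y] by (auto simp: z_def)
  have n: "norm (z powr of_real (- r)) = norm z powr (- r)"
    using z by (subst norm_powr_real_powr') auto
  show "norm ((of_real a - \<i> * of_real y) powr of_real (- r)) \<le> (min a 1 / 2) powr (- r) * (1 + \<bar>y\<bar>) powr (- r)"
    using assms z norm_gamma_base_ge(1)[OF assms(1), of y] unfolding z_def[symmetric] n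
    by (subst powr_mult[symmetric]) (auto intro!: powr_mono2')
  show "(1 + a) powr (- r) * (1 + \<bar>y\<bar>) powr (- r) \<le> norm ((of_real a - \<i> * of_real y) powr of_real (- r))"
    using assms z norm_gamma_base_ge(2)[OF assms(1), of y] unfolding z_def[symmetric] n
    by (subst powr_mult[symmetric]) (auto intro!: powr_mono2')
qed

text \<open>The power has an explicit primitive that vanishes at infinity. The exact value of the
  tail is what allows bounds from above and from below with the same exponent.\<close>

lemma integral_gamma_base_powr_tail:
  assumes "a > 0" "\<alpha> > 0"
  shows "integrable lborel (\<lambda>y. (of_real a - \<i> * of_real y) powr of_real (- \<alpha> - 1))"
    and "(LINT y:{s<..}|lborel. (of_real a - \<i> * of_real y) powr of_real (- \<alpha> - 1)) =
       \<i> / of_real \<alpha> * (of_real a - \<i> * of_real s) powr of_real (- \<alpha>)"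
proof -
  define b where "b y = complex_of_real a - \<i> * of_real y" for y
  have contb: "continuous_on UNIV (\<lambda>y. b y powr r)" for r
    unfolding b_def
    by (intro continuous_intros ballI) (use gamma_base_nonneg[OF assms(1)] assms(1) in auto)
  have [measurable]: "(\<lambda>y. b y powr r) \<in> borel_measurable borel" for r
    using contb by (rule borel_measurable_continuous_onI)
  have int: "integrable lborel (\<lambda>y. b y powr of_real (- \<alpha> - 1))"
  proof (rule Bochner_Integration.integrable_bound)
    show "integrable lborel (\<lambda>y. (min a 1 / 2) powr (- (\<alpha> + 1)) * (1 + \<bar>y\<bar>) powr (- (\<alpha> + 1)))"
      using assms by (intro integrable_mult_right integrable_one_plus_abs_powr) auto
    show "AE y in lborel. norm (b y powr of_real (- \<alpha> - 1)) \<le> norm ((min a 1 / 2) powr (- (\<alpha> + 1)) * (1 + \<bar>y\<bar>) powr (- (\<alpha> + 1)))"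
    proof -
      have e: "- \<alpha> - 1 = - (\<alpha> + 1)" by simp
      show ?thesis
        unfolding b_def e using assms
        by (intro always_eventually allI order_trans[OF norm_gamma_base_powr(1)]) auto
    qed
  qed simp
  then show "integrable lborel (\<lambda>y. (of_real a - \<i> * of_real y) powr of_real (- \<alpha> - 1))"
    by (simp add: b_def)
  define P where "P y = - \<i> / of_real \<alpha> * b y powr of_real (- \<alpha>)" for y
  have P: "(P has_vector_derivative b y powr of_real (- \<alpha> - 1)) (at y)" for y
    using has_vector_derivative_mult_right[OF gamma_base_powr_deriv[OF assms(1), of "- \<alpha>" y], of "- \<i> / of_real \<alpha>"] assms
    unfolding P_def b_def by (simp add: field_simps)
  have lim: "((\<lambda>y. (min a 1 / 2) powr (- \<alpha>) * (1 + \<bar>y\<bar>) powr (- \<alpha>)) \<longlongrightarrow> 0) at_top"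
  proof -
    have "((\<lambda>y. (1 + \<bar>y\<bar>) powr (- \<alpha>)) \<longlongrightarrow> 0) at_top" using assms by real_asymp
    from tendsto_mult_right_zero[OF this] show ?thesis .
  qed
  have "(LINT y:{s<..}|lborel. b y powr of_real (- \<alpha> - 1)) = - \<i> / of_real \<alpha> * 0 - P s"
  proof (rule integral_FTC_greaterThan[OF P])
    show "isCont (\<lambda>y. b y powr of_real (- \<alpha> - 1)) x" for x
      using contb by (simp add: continuous_on_eq_continuous_at)
    show "set_integrable lborel {s<..} (\<lambda>y. b y powr of_real (- \<alpha> - 1))"
      unfolding set_integrable_def by (intro integrable_mult_indicator int) auto
    have "isCont P s" using P has_vector_derivative_continuous by blast
    then show "(P \<longlongrightarrow> P s) (at_right s)"
      by (meson continuous_at_imp_continuous_within continuous_within)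
    show "(P \<longlongrightarrow> - \<i> / of_real \<alpha> * 0) at_top"
      unfolding P_def
      by (intro tendsto_mult tendsto_const, rule Lim_null_comparison[OF _ lim])
         (use norm_gamma_base_powr(1)[OF assms] in \<open>auto simp: b_def\<close>)
  qed
  then show "(LINT y:{s<..}|lborel. (of_real a - \<i> * of_real y) powr of_real (- \<alpha> - 1)) =
       \<i> / of_real \<alpha> * (of_real a - \<i> * of_real s) powr of_real (- \<alpha>)"
    by (simp add: P_def b_def)
qed

section \<open>The remainder of a flat symbol\<close>

locale flat_symbol =
  fixes F F1 F2 :: "real \<Rightarrow> complex" and a \<alpha> M :: real
  assumes a: "a > 0" and \<alpha>: "\<alpha> > 0"
    and F: "\<And>p. (F has_vector_derivative F1 p) (at p)"
    and F1: "\<And>p. (F1 has_vector_derivative F2 p) (at p)"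
    and F2: "continuous_on UNIV F2" "\<And>p. norm (F2 p) \<le> M"
    and flat: "F1 0 = 0"
begin

definition R :: "real \<Rightarrow> complex" where "R p = F p - F 0"

lemma M_nonneg: "M \<ge> 0"
  using order_trans[OF norm_ge_zero F2(2)] .

lemma norm_F1: "p > 0 \<Longrightarrow> norm (F1 p) \<le> M * p"
proof -
  assume p: "p > 0"
  have "norm (F1 p - F1 0) \<le> M * norm (p - 0)"
  proof (rule differentiable_bound[where S = "{0..p}" and f' = "\<lambda>x h. h *\<^sub>R F2 x"])
    show "(F1 has_derivative (\<lambda>h. h *\<^sub>R F2 x)) (at x within {0..p})" for x
      using F1[of x] has_vector_derivative_at_within unfolding has_vector_derivative_def[symmetric] by blast
    show "onorm (\<lambda>h. h *\<^sub>R F2 x) \<le> M" for x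
      by (rule onorm_bound) (use F2(2)[of x] M_nonneg in \<open>auto simp: mult.commute[of M] intro!: mult_left_mono\<close>)
  qed (use p in auto)
  then show ?thesis using p flat by simp
qed

lemma norm_R: "p > 0 \<Longrightarrow> norm (R p) \<le> M * p\<^sup>2"
proof -
  assume p: "p > 0"
  have "norm (F p - F 0) \<le> M * p * norm (p - 0)"
  proof (rule differentiable_bound[where S = "{0..p}" and f' = "\<lambda>x h. h *\<^sub>R F1 x"])
    show "(F has_derivative (\<lambda>h. h *\<^sub>R F1 x)) (at x within {0..p})" for x
      using F[of x] has_vector_derivative_at_within unfolding has_vector_derivative_def[symmetric] by blast
    show "onorm (\<lambda>h. h *\<^sub>R F1 x) \<le> M * p" if "x \<in> {0..p}" for x
    proof -
      have "norm (F1 x) \<le> M * p"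
      proof (cases "x = 0")
        case False
        then have "norm (F1 x) \<le> M * x" using that by (intro norm_F1) auto
        also have "\<dots> \<le> M * p" using that M_nonneg by (intro mult_left_mono) auto
        finally show ?thesis .
      qed (use flat p M_nonneg in auto)
      then show ?thesis
        using p M_nonneg by (intro onorm_bound) (auto simp: mult.commute mult_left_mono)
    qed
  qed (use p in auto)
  then show ?thesis using p by (simp add: R_def power2_eq_square)
qed

lemma R_vderiv: "(R has_vector_derivative F1 p) (at p)"
  unfolding R_def by (auto intro!: derivative_eq_intros F)

lemma continuous_F1: "continuous_on UNIV F1"
  using F1 has_vector_derivative_continuous continuous_at_imp_continuous_on by blast

lemma continuous_R: "continuous_on UNIV R"
  using R_vderiv has_vector_derivative_continuous continuous_at_imp_continuous_on by blast

lemma symbol_measurable [measurable]: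
  "R \<in> borel_measurable borel" "F1 \<in> borel_measurable borel" "F2 \<in> borel_measurable borel"
  using continuous_R continuous_F1 F2(1) by (auto intro: borel_measurable_continuous_onI)

lemma norm_wexp_R: "p > 0 \<Longrightarrow> norm (of_real (wexp a c p) * R p) \<le> M * wexp a (c + 2) p"
proof -
  assume p: "p > 0"
  have "norm (of_real (wexp a c p) * R p) \<le> wexp a c p * (M * p\<^sup>2)"
    unfolding norm_mult using norm_R[OF p] by (auto intro!: mult_left_mono)
  also have "wexp a c p * (M * p\<^sup>2) = M * wexp a (c + 2) p"
    using p by (simp add: wexp_def powr_add powr_numeral)
  finally show ?thesis .
qed

lemma norm_wexp_F1: "p > 0 \<Longrightarrow> norm (of_real (wexp a c p) * F1 p) \<le> M * wexp a (c + 1) p"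
proof -
  assume p: "p > 0"
  have "norm (of_real (wexp a c p) * F1 p) \<le> wexp a c p * (M * p)"
    unfolding norm_mult using norm_F1[OF p] by (auto intro!: mult_left_mono)
  also have "wexp a c p * (M * p) = M * wexp a (c + 1) p"
    using p by (simp add: wexp_def powr_add)
  finally show ?thesis .
qed

lemma norm_wexp_F2: "norm (of_real (wexp a c p) * F2 p) \<le> M * wexp a c p"
  using F2(2)[of p] by (simp add: norm_mult mult.commute[of M] mult_left_mono)

lemma set_integrable_wexp_bound:
  fixes v :: "real \<Rightarrow> complex"
  assumes "c > -1" "v \<in> borel_measurable borel" "\<And>p. p > 0 \<Longrightarrow> norm (v p) \<le> M * wexp a c p"
  shows "set_integrable lborel {0<..} v"
proof -
  have "set_integrable lborel {0<..} (\<lambda>p. M * wexp a c p)"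
    using assms by (intro set_integrable_mult_right set_integrable_wexp a)
  then show ?thesis
    unfolding set_integrable_def
    by (rule Bochner_Integration.integrable_bound)
       (use assms in \<open>auto simp: indicator_def intro: order_trans[OF _ abs_ge_self]\<close>)
qed

lemma set_integrable_wexp_R: "c > -3 \<Longrightarrow> set_integrable lborel {0<..} (\<lambda>p. of_real (wexp a c p) * R p)"
  by (rule set_integrable_wexp_bound[where c = "c + 2"]) (auto intro: norm_wexp_R)

lemma set_integrable_wexp_F1: "c > -2 \<Longrightarrow> set_integrable lborel {0<..} (\<lambda>p. of_real (wexp a c p) * F1 p)"
  by (rule set_integrable_wexp_bound[where c = "c + 1"]) (auto intro: norm_wexp_F1)

lemma set_integrable_wexp_F2: "c > -1 \<Longrightarrow> set_integrable lborel {0<..} (\<lambda>p. of_real (wexp a c p) * F2 p)"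
  by (rule set_integrable_wexp_bound) (auto intro: norm_wexp_F2)

text \<open>The part of the transform left after the value \<open>F 0\<close> is split off from the
  symbol; the part with \<open>F 0\<close> is a multiple of \<open>gamma_transform\<close>.\<close>

definition remainder :: "real \<Rightarrow> complex" where
  "remainder y = (LINT p:{0<..}|lborel. of_real (wexp a \<alpha> p) * R p * exp (\<i> * of_real (p * y)))"

text \<open>\<open>q1\<close> and \<open>q2\<close> are the first and second derivatives of the
  weighted remainder \<open>wexp a \<alpha> p * R p\<close> for p > 0. They are kept expanded so
  that every summand is a weight times \<open>R\<close>, \<open>F1\<close> or \<open>F2\<close> and
  can be bounded separately.\<close>

definition q1 :: "real \<Rightarrow> complex" where
  "q1 p = of_real \<alpha> * (of_real (wexp a (\<alpha> - 1) p) * R p) - of_real a * (of_real (wexp a \<alpha> p) * R p)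
          + of_real (wexp a \<alpha> p) * F1 p"

definition q2 :: "real \<Rightarrow> complex" where
  "q2 p = of_real (\<alpha> * (\<alpha> - 1)) * (of_real (wexp a (\<alpha> - 2) p) * R p)
        - of_real (2 * a * \<alpha>) * (of_real (wexp a (\<alpha> - 1) p) * R p)
        + of_real (a\<^sup>2) * (of_real (wexp a \<alpha> p) * R p)
        + of_real (2 * \<alpha>) * (of_real (wexp a (\<alpha> - 1) p) * F1 p)
        - of_real (2 * a) * (of_real (wexp a \<alpha> p) * F1 p)
        + of_real (wexp a \<alpha> p) * F2 p"

lemma q1_vderiv: "p > 0 \<Longrightarrow> (q1 has_vector_derivative q2 p) (at p)"
proof -
  assume p: "p > 0"
  note w = wexp_vderiv[OF p]
  have "(q1 has_vector_derivative
     of_real \<alpha> * (of_real ((\<alpha> - 1) * wexp a (\<alpha> - 1 - 1) p - a * wexp a (\<alpha> - 1) p) * R p + of_real (wexp a (\<alpha> - 1) p) * F1 p)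
     - of_real a * (of_real (\<alpha> * wexp a (\<alpha> - 1) p - a * wexp a \<alpha> p) * R p + of_real (wexp a \<alpha> p) * F1 p)
     + (of_real (\<alpha> * wexp a (\<alpha> - 1) p - a * wexp a \<alpha> p) * F1 p + of_real (wexp a \<alpha> p) * F2 p)) (at p)"
    unfolding q1_def[abs_def]
    by (intro has_vector_derivative_add has_vector_derivative_diff has_vector_derivative_mult_right w R_vderiv F1)
  then show ?thesis
    by (rule has_vector_derivative_eq_rhs) (simp add: q2_def algebra_simps power2_eq_square)
qed

lemma q0_vderiv: "p > 0 \<Longrightarrow> ((\<lambda>p. of_real (wexp a \<alpha> p) * R p) has_vector_derivative q1 p) (at p)"
  by (rule has_vector_derivative_eq_rhs[OF wexp_vderiv[OF _ R_vderiv]]) (auto simp: q1_def algebra_simps)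

text \<open>Flatness makes this work: the weight p^(\<alpha>-2) meets R = O(p^2) and p^(\<alpha>-1)
  meets F1 = O(p), so near 0 each summand is O(p^\<alpha>) or smaller.\<close>

lemma set_integrable_q2: "set_integrable lborel {0<..} q2"
  unfolding q2_def[abs_def] using \<alpha>
  by (intro set_integral_add set_integral_diff set_integrable_mult_right set_integrable_wexp_R
      set_integrable_wexp_F1 set_integrable_wexp_F2) auto

lemma norm_q1: "p > 0 \<Longrightarrow> norm (q1 p) \<le> (\<alpha> + 1) * M * wexp a (\<alpha> + 1) p + a * M * wexp a (\<alpha> + 2) p"
proof -
  assume p: "p > 0"
  have scale: "norm (of_real r * z :: complex) \<le> r * B" if "r > 0" "norm z \<le> B" for r B :: real and z
    using that by (simp add: norm_mult)
  have "norm (q1 p) \<le> \<alpha> * (M * wexp a (\<alpha> - 1 + 2) p) + a * (M * wexp a (\<alpha> + 2) p) + M * wexp a (\<alpha> + 1) p"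
    unfolding q1_def
    by (intro norm_triangle_le norm_triangle_le_diff add_mono scale norm_wexp_R norm_wexp_F1 a \<alpha> p)
  then show ?thesis by (simp add: algebra_simps)
qed

lemma remainder_by_parts:
  "of_real (y\<^sup>2) * remainder y = - (LINT p:{0<..}|lborel. q2 p * exp (\<i> * of_real (p * y)))"
proof -
  define E where "E p = exp (\<i> * complex_of_real (p * y))" for p
  have nE: "norm (E p) = 1" for p by (simp add: E_def)
  have E: "(E has_vector_derivative \<i> * of_real y * E p) (at p)" for p
    using exp_vderiv[of y p] by (simp add: E_def[abs_def])
  define q0 where "q0 p = of_real (wexp a \<alpha> p) * R p" for p
  have q0: "(q0 has_vector_derivative q1 p) (at p)" if "p > 0" for p
    using q0_vderiv[OF that] by (simp add: q0_def[abs_def])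
  \<comment> \<open>\<open>G\<close> gathers the boundary terms of two integrations by parts at
    once; in its derivative the two terms with \<open>q1\<close> cancel, leaving
    \<open>g\<close>.\<close>
  define G where "G p = q1 p * E p - \<i> * of_real y * (q0 p * E p)" for p
  define g where "g p = q2 p * E p + of_real (y\<^sup>2) * (q0 p * E p)" for p
  have i0: "set_integrable lborel {0<..} (\<lambda>p. q0 p * E p)"
    unfolding E_def q0_def using \<alpha> by (intro set_integrable_unimodular set_integrable_wexp_R) auto
  have i2: "set_integrable lborel {0<..} (\<lambda>p. q2 p * E p)"
    unfolding E_def by (intro set_integrable_unimodular set_integrable_q2)
  have int: "set_integrable lborel {0<..} g"
    unfolding g_def[abs_def] by (intro set_integral_add set_integrable_mult_right i0 i2)
  have bound: "norm (G p) \<le> ((\<alpha> + 1) * M) * wexp a (\<alpha> + 1) p + (a * M + \<bar>y\<bar> * M) * wexp a (\<alpha> + 2) p" if "p > 0" for p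
  proof -
    have "norm (G p) \<le> norm (q1 p) + \<bar>y\<bar> * norm (q0 p)"
      unfolding G_def by (rule order_trans[OF norm_triangle_ineq4]) (simp add: norm_mult nE)
    also have "\<dots> \<le> ((\<alpha> + 1) * M * wexp a (\<alpha> + 1) p + a * M * wexp a (\<alpha> + 2) p) + \<bar>y\<bar> * (M * wexp a (\<alpha> + 2) p)"
      unfolding q0_def by (intro add_mono mult_left_mono norm_q1 norm_wexp_R that) auto
    finally show ?thesis by (simp add: algebra_simps)
  qed
  have lim: "((\<lambda>p. ((\<alpha> + 1) * M) * wexp a (\<alpha> + 1) p + (a * M + \<bar>y\<bar> * M) * wexp a (\<alpha> + 2) p) \<longlongrightarrow> 0) F"
    if "\<And>c. c > 0 \<Longrightarrow> (wexp a c \<longlongrightarrow> 0) F" for F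
    using \<alpha> by (intro tendsto_add_zero tendsto_mult_right_zero that) auto
  have "(LINT p:{0<..}|lborel. g p) = 0 - 0"
  proof (rule integral_FTC_greaterThan[OF _ _ int])
    show "(G has_vector_derivative g p) (at p)" if "0 < p" for p
    proof -
      have "(G has_vector_derivative (q1 p * (\<i> * of_real y * E p) + q2 p * E p) -
          \<i> * of_real y * (q0 p * (\<i> * of_real y * E p) + q1 p * E p)) (at p)"
        unfolding G_def[abs_def]
        by (intro has_vector_derivative_diff has_vector_derivative_mult_right has_vector_derivative_mult E q0 q1_vderiv that)
      then show ?thesis
        by (rule has_vector_derivative_eq_rhs) (simp add: g_def algebra_simps power2_eq_square)
    qed
    have c: "isCont R p" "isCont F1 p" "isCont F2 p" for p
      using continuous_R continuous_F1 F2(1) by (auto simp: continuous_on_eq_continuous_at)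
    show "isCont g p" if "0 < p" for p
      unfolding g_def q0_def q2_def E_def wexp_def using that by (intro continuous_intros c) auto
    show "(G \<longlongrightarrow> 0) (at_right 0)"
      by (rule Lim_null_comparison[OF _ lim])
         (use bound wexp_tendsto(1)[OF a] in \<open>auto intro!: eventually_at_right_less[THEN eventually_mono]\<close>)
    show "(G \<longlongrightarrow> 0) at_top"
      by (rule Lim_null_comparison[OF _ lim])
         (use bound wexp_tendsto(2)[OF a] in \<open>auto intro!: eventually_gt_at_top[THEN eventually_mono, of 0]\<close>)
  qed
  moreover have "(LINT p:{0<..}|lborel. g p) = (LINT p:{0<..}|lborel. q2 p * E p) + of_real (y\<^sup>2) * remainder y"
    unfolding g_def remainder_def q0_def[symmetric] E_def[symmetric]
    by (subst set_integral_add(2)) (auto intro!: set_integrable_mult_right i0 i2)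
  ultimately show ?thesis by (simp add: E_def add_eq_0_iff)
qed

lemma norm_remainder_le:
  "\<exists>C. C > 0 \<and> (\<forall>y. norm (remainder y) \<le> C * (1 + \<bar>y\<bar>) powr (-2))"
proof -
  define C0 where "C0 = (LINT p:{0<..}|lborel. norm (of_real (wexp a \<alpha> p) * R p))"
  define C2 where "C2 = (LINT p:{0<..}|lborel. norm (q2 p))"
  have 0: "norm (remainder y) \<le> C0" for y
    unfolding remainder_def C0_def using \<alpha> by (intro norm_set_integral_unimodular_le set_integrable_wexp_R) auto
  have 2: "y\<^sup>2 * norm (remainder y) \<le> C2" for y
  proof -
    have "y\<^sup>2 * norm (remainder y) = norm (of_real (y\<^sup>2) * remainder y)" by (simp add: norm_mult norm_power)
    also have "\<dots> \<le> C2" unfolding remainder_by_parts norm_minus_cancel C2_def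
      by (intro norm_set_integral_unimodular_le set_integrable_q2)
    finally show ?thesis .
  qed
  \<comment> \<open>The factor 2 comes from (1 + |y|)^2 \<le> 2 (1 + y^2), which combines the bounds
    \<open>C0\<close> and \<open>C2\<close>; the summand 1 makes the constant positive.\<close>
  have "norm (remainder y) \<le> (2 * (C0 + C2) + 1) * (1 + \<bar>y\<bar>) powr (-2)" for y
  proof -
    have "(1 + \<bar>y\<bar>)\<^sup>2 * norm (remainder y) \<le> (2 * (1 + y\<^sup>2)) * norm (remainder y)"
      using sum_squares_bound[of 1 "\<bar>y\<bar>"] by (intro mult_right_mono) (auto simp: power2_eq_square algebra_simps)
    also have "\<dots> \<le> 2 * (C0 + C2) + 1" using 0[of y] 2[of y] by (simp add: algebra_simps)
    finally have "norm (remainder y) \<le> (2 * (C0 + C2) + 1) / (1 + \<bar>y\<bar>)\<^sup>2"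
      by (simp add: field_simps pos_le_divide_eq add_pos_nonneg)
    then show ?thesis by (simp add: powr_minus_divide powr_numeral)
  qed
  moreover have "2 * (C0 + C2) + 1 > 0"
    using order_trans[OF norm_ge_zero 0[of 0]] 2[of 0] by simp
  ultimately show ?thesis by (intro exI[of _ "2 * (C0 + C2) + 1"]) auto
qed

end

section \<open>Decay and tails of the shifted function\<close>

lemma set_integrable_subset_UNIV:
  fixes g :: "real \<Rightarrow> 'b :: {banach, second_countable_topology}"
  assumes "integrable lborel g" "A \<in> sets borel"
  shows "set_integrable lborel A g"
  unfolding set_integrable_def using assms by (intro integrable_mult_indicator) auto

lemma LINT_one_plus_powr_2:
  fixes s :: real
  assumes "s \<ge> 0"
  shows "(LINT y:{s<..}|lborel. (1 + \<bar>y\<bar>) powr (-2)) = 1 / (1 + s)"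
proof -
  have lim: "((\<lambda>y::real. - 1 / (1 + y)) \<longlongrightarrow> 0) at_top" by real_asymp
  have left: "((\<lambda>y. - 1 / (1 + y)) \<longlongrightarrow> - 1 / (1 + s)) (at_right s)"
    using assms by (intro tendsto_intros) auto
  have deriv: "((\<lambda>y. - 1 / (1 + y)) has_real_derivative (1 + \<bar>y\<bar>) powr (-2)) (at y)" if "s < y" for y
    using that assms
    by (auto intro!: derivative_eq_intros simp: powr_minus_divide powr_numeral power2_eq_square)
  then have deriv: "((\<lambda>y. - (1 / (1 + y))) has_real_derivative (1 + \<bar>y\<bar>) powr (-2)) (at y)" if "s < y" for y
    using that by simp
  have "(LBINT y=ereal s..\<infinity>. (1 + \<bar>y\<bar>) powr (-2)) = 0 - (- 1 / (1 + s))"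
    by (rule interval_integral_FTC_nonneg(2)[where F = "\<lambda>y. - 1 / (1 + y)"])
       (use lim left in \<open>auto simp: ereal_tendsto_simps intro!: continuous_intros deriv\<close>)
  then show ?thesis by (simp add: interval_lebesgue_integral_le_eq)
qed

lemma LINT_reflect:
  fixes g :: "real \<Rightarrow> complex"
  shows "(LINT y:{..<s}|lborel. g y) = (LINT y:{-s<..}|lborel. g (- y))"
  unfolding set_lebesgue_integral_def
  using lborel_integral_real_affine[of "-1" "\<lambda>y. indicator {..<s} y *\<^sub>R g y" 0]
  by (simp add: indicator_def minus_less_iff)

text \<open>For s < 0 the half-line contains the bulk of \<open>g\<close>. The vanishing total
  integral trades it for the complementary half-line, and reflection reduces that to the case s >
  0.\<close>

lemma tail_bound_of_decay_2:
  fixes g :: "real \<Rightarrow> complex"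
  assumes g: "integrable lborel g" and 0: "(LINT y|lborel. g y) = 0"
    and C: "\<And>y. norm (g y) \<le> C * (1 + \<bar>y\<bar>) powr (-2)"
  shows "norm (LINT y:{s<..}|lborel. g y) \<le> C / (1 + \<bar>s\<bar>)"
proof -
  have main: "norm (LINT y:{s<..}|lborel. g y) \<le> C / (1 + s)"
    if "s \<ge> 0" and g: "integrable lborel g" and C: "\<And>y. norm (g y) \<le> C * (1 + \<bar>y\<bar>) powr (-2)" for s and g :: "real \<Rightarrow> complex"
  proof -
    have "norm (LINT y:{s<..}|lborel. g y) \<le> (LINT y:{s<..}|lborel. norm (g y))"
      unfolding set_lebesgue_integral_def by (rule order_trans[OF integral_norm_bound]) simp
    also have "\<dots> \<le> (LINT y:{s<..}|lborel. C * (1 + \<bar>y\<bar>) powr (-2))"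
      using g C
      by (intro set_integral_mono set_integrable_subset_UNIV integrable_norm integrable_mult_right
          integrable_one_plus_abs_powr) auto
    also have "\<dots> = C / (1 + s)"
      using LINT_one_plus_powr_2[OF that(1)] by simp
    finally show ?thesis .
  qed
  show ?thesis
  proof (cases "s \<ge> 0")
    case True
    then show ?thesis using main[OF True g C] by simp
  next
    case False
    have "(LINT y|lborel. g y) = (LINT y:{..<s} \<union> {s<..}|lborel. g y)"
      unfolding set_lebesgue_integral_def
    proof (rule integral_cong_AE)
      show "AE y in lborel. g y = indicat_real ({..<s} \<union> {s<..}) y *\<^sub>R g y"
        using AE_lborel_singleton[of s] by eventually_elim (auto simp: indicator_def)
    qed (use g in auto)
    also have "\<dots> = (LINT y:{..<s}|lborel. g y) + (LINT y:{s<..}|lborel. g y)"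
      using g by (intro set_integral_Un set_integrable_subset_UNIV) auto
    finally have "norm (LINT y:{s<..}|lborel. g y) = norm (LINT y:{-s<..}|lborel. g (- y))"
      using 0 LINT_reflect[of s g] by (metis add_eq_0_iff norm_minus_cancel)
    also have "\<dots> \<le> C / (1 + (- s))"
      using False C[of "- y" for y] lborel_integrable_real_affine[OF g, of "-1" 0] by (intro main) auto
    finally show ?thesis using False by simp
  qed
qed

context flat_symbol
begin

text \<open>This is \<open>shifted a f\<close> for any \<open>f\<close> whose transform on p > 0 is
  \<open>p powr \<alpha>\<close> times \<open>F\<close>, expressed through the symbol alone.\<close>

definition \<phi> :: "real \<Rightarrow> complex" where
  "\<phi> y = of_real (1 / sqrt (2 * pi)) *
     (LINT p:{0<..}|lborel. of_real (wexp a \<alpha> p) * F p * exp (\<i> * of_real (p * y)))"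

lemma \<phi>_decomposition:
  "\<exists>K. (F 0 \<noteq> 0 \<longrightarrow> K \<noteq> 0) \<and>
    (\<forall>y. \<phi> y = K * (of_real a - \<i> * of_real y) powr of_real (- \<alpha> - 1) + of_real (1 / sqrt (2 * pi)) * remainder y)"
proof -
  obtain K where K: "K \<noteq> 0" "\<And>y. gamma_transform a \<alpha> y = K * (of_real a - \<i> * of_real y) powr of_real (- \<alpha> - 1)"
    using gamma_transform_eq[of a \<alpha>] a \<alpha> by auto
  have "\<phi> y = of_real (1 / sqrt (2 * pi)) * (F 0 * gamma_transform a \<alpha> y + remainder y)" for y
  proof -
    have i1: "set_integrable lborel {0<..} (\<lambda>p. F 0 * (of_real (wexp a \<alpha> p) * exp (\<i> * of_real (p * y))))"
      using a \<alpha> by (intro set_integrable_mult_right set_integrable_unimodular set_integrable_wexp_complex) auto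
    have i2: "set_integrable lborel {0<..} (\<lambda>p. of_real (wexp a \<alpha> p) * R p * exp (\<i> * of_real (p * y)))"
      using \<alpha> by (intro set_integrable_unimodular set_integrable_wexp_R) auto
    have "(LINT p:{0<..}|lborel. of_real (wexp a \<alpha> p) * F p * exp (\<i> * of_real (p * y))) =
      (LINT p:{0<..}|lborel. F 0 * (of_real (wexp a \<alpha> p) * exp (\<i> * of_real (p * y)))
          + of_real (wexp a \<alpha> p) * R p * exp (\<i> * of_real (p * y)))"
      by (intro set_lebesgue_integral_cong) (auto simp: R_def algebra_simps)
    also have "\<dots> = F 0 * gamma_transform a \<alpha> y + remainder y"
      by (subst set_integral_add(2)[OF i1 i2]) (simp add: gamma_transform_def remainder_def)
    finally show ?thesis by (simp add: \<phi>_def)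
  qed
  \<comment> \<open>The constant of the power carries the factor \<open>F 0\<close>; this is where a
    nonzero symbol at the origin enters.\<close>
  then show ?thesis
    using K by (intro exI[of _ "of_real (1 / sqrt (2 * pi)) * F 0 * K"]) (auto simp: algebra_simps)
qed

lemma continuous_\<phi>: "continuous_on UNIV \<phi>"
proof -
  have gt: "isCont (gamma_transform a \<alpha>) y" for y
    using gamma_transform_deriv[of a \<alpha> y] a \<alpha> has_vector_derivative_continuous by fastforce
  have *: "set_integrable lborel {0<..} (\<lambda>p. complex_of_real p ^ n * (of_real (wexp a \<alpha> p) * F p))" for n
  proof -
    have eq: "complex_of_real (wexp a (\<alpha> + n) p) * F 0 + of_real (wexp a (\<alpha> + n) p) * R p =
       complex_of_real p ^ n * (of_real (wexp a \<alpha> p) * F p)" if "p > 0" for p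
      using that by (simp add: wexp_def powr_add powr_realpow R_def algebra_simps)
    have "set_integrable lborel {0<..} (\<lambda>p. complex_of_real (wexp a (\<alpha> + n) p) * F 0 + of_real (wexp a (\<alpha> + n) p) * R p)"
      using a \<alpha> by (intro set_integral_add set_integrable_mult_left set_integrable_wexp_complex set_integrable_wexp_R) auto
    then show ?thesis
      by (rule set_integrable_cong[THEN iffD1, rotated -1]) (auto simp: eq)
  qed
  have "isCont \<phi> y" for y
  proof -
    have "isCont (\<lambda>y. LINT p:{0<..}|lborel. of_real (wexp a \<alpha> p) * F p * exp (\<i> * of_real (p * y))) y"
      using *[of 0] *[of 1] *[of 2]
      by (intro has_vector_derivative_continuous[OF half_line_transform_deriv]) auto
    then show ?thesis unfolding \<phi>_def[abs_def] by (intro continuous_intros)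
  qed
  then show ?thesis by (simp add: continuous_at_imp_continuous_on)
qed

text \<open>The power part decays with exponent 1 + \<alpha> and the remainder with exponent 2, so
  the slower one is 1 + \<beta>. The lower bound is the exact tail of the power minus the tail of
  the remainder. A zero integral of \<phi> appears as a premise because it will come from the
  contour shift, which itself requires the integrability proved here.\<close>

lemma \<phi>_asymptotics:
  defines "\<beta> \<equiv> min \<alpha> 1"
  shows "integrable lborel \<phi>"
    and "\<exists>C>0. (\<forall>y. norm (\<phi> y) \<le> C * (1 + \<bar>y\<bar>) powr (- (1 + \<beta>))) \<and>
      ((LINT y|lborel. \<phi> y) = 0 \<longrightarrow> (\<forall>s. norm (LINT y:{s<..}|lborel. \<phi> y) \<le> C * (1 + \<bar>s\<bar>) powr (- \<beta>))) \<and>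
      ((LINT y|lborel. \<phi> y) = 0 \<longrightarrow> F 0 \<noteq> 0 \<longrightarrow>
        (\<exists>c>0. \<forall>s. c * (1 + \<bar>s\<bar>) powr (- \<alpha>) - C / (1 + \<bar>s\<bar>) \<le> norm (LINT y:{s<..}|lborel. \<phi> y)))"
proof -
  have \<beta>: "0 < \<beta>" "\<beta> \<le> 1" "\<beta> \<le> \<alpha>" using \<alpha> by (auto simp: \<beta>_def)
  obtain K where K': "(F 0 \<noteq> 0 \<longrightarrow> K \<noteq> 0) \<and>
    (\<forall>y. \<phi> y = K * (of_real a - \<i> * of_real y) powr of_real (- \<alpha> - 1) + of_real (1 / sqrt (2 * pi)) * remainder y)"
    using \<phi>_decomposition ..
  note K = K'[THEN conjunct1] K'[THEN conjunct2, rule_format]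
  obtain C2 where C2': "C2 > 0 \<and> (\<forall>y. norm (remainder y) \<le> C2 * (1 + \<bar>y\<bar>) powr (-2))"
    using norm_remainder_le ..
  note C2 = C2'[THEN conjunct1] C2'[THEN conjunct2, rule_format]
  define m where "m = min a 1 / 2"
  define b where "b y = complex_of_real a - \<i> * of_real y" for y
  define \<rho> where "\<rho> y = of_real (1 / sqrt (2 * pi)) * remainder y" for y
  have \<rho>: "norm (\<rho> y) \<le> C2 * (1 + \<bar>y\<bar>) powr (-2)" for y
  proof -
    have "1 \<le> sqrt (2 * pi)" using pi_gt3 by simp
    then have "norm (\<rho> y) \<le> 1 * norm (remainder y)"
      unfolding \<rho>_def norm_mult by (intro mult_right_mono) (auto simp: norm_divide)
    with C2(2)[of y] show ?thesis by simp
  qed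
  note tail = integral_gamma_base_powr_tail[OF a \<alpha>, folded b_def]
  have b: "norm (b y powr of_real (- r)) \<le> m powr (- r) * (1 + \<bar>y\<bar>) powr (- r)" if "r > 0" for y r
    unfolding b_def m_def by (rule norm_gamma_base_powr(1)[OF a that])
  have mono: "(1 + \<bar>y\<bar>) powr (- r) \<le> (1 + \<bar>y\<bar>) powr (- t)" if "t \<le> r" for y t r :: real
    using that by (intro powr_mono) auto
  define Ca where "Ca = norm K * m powr (- (1 + \<alpha>)) + C2"
  define Cb where "Cb = norm K / \<alpha> * m powr (- \<alpha>) + C2"
  define C where "C = Ca + Cb"
  have pos: "Ca \<ge> 0" "Cb > 0" using C2 \<alpha> by (auto simp: Ca_def Cb_def add_nonneg_pos)
  have \<phi>le: "norm (\<phi> y) \<le> Ca * (1 + \<bar>y\<bar>) powr (- (1 + \<beta>))" for y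
  proof -
    have "norm (\<phi> y) \<le> norm K * norm (b y powr of_real (- (1 + \<alpha>))) + norm (\<rho> y)"
    proof -
      have e: "- (1 + \<alpha>) = - \<alpha> - 1" by simp
      show ?thesis
        unfolding e K(2) \<rho>_def[symmetric] b_def[symmetric] norm_mult[symmetric]
        by (rule norm_triangle_ineq)
    qed
    also have "\<dots> \<le> norm K * (m powr (- (1 + \<alpha>)) * (1 + \<bar>y\<bar>) powr (- (1 + \<beta>))) + C2 * (1 + \<bar>y\<bar>) powr (- (1 + \<beta>))"
    proof (intro add_mono mult_left_mono)
      show "norm (b y powr of_real (- (1 + \<alpha>))) \<le> m powr (- (1 + \<alpha>)) * (1 + \<bar>y\<bar>) powr (- (1 + \<beta>))"
        using \<alpha> \<beta> by (intro order_trans[OF b] mult_left_mono mono) auto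
      show "norm (\<rho> y) \<le> C2 * (1 + \<bar>y\<bar>) powr (- (1 + \<beta>))"
        using C2(1) \<beta> by (intro order_trans[OF \<rho>] mult_left_mono mono) auto
    qed auto
    finally show ?thesis by (simp add: Ca_def algebra_simps)
  qed
  have int: "integrable lborel \<phi>"
  proof (rule Bochner_Integration.integrable_bound)
    show "integrable lborel (\<lambda>y. Ca * (1 + \<bar>y\<bar>) powr (- (1 + \<beta>)))"
      using \<beta> by (intro integrable_mult_right integrable_one_plus_abs_powr) auto
    show "\<phi> \<in> borel_measurable lborel"
      using borel_measurable_continuous_onI[OF continuous_\<phi>] by simp
    show "AE y in lborel. norm (\<phi> y) \<le> norm (Ca * (1 + \<bar>y\<bar>) powr (- (1 + \<beta>)))"
      using \<phi>le pos by (auto simp: abs_mult)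
  qed
  define J where "J y = K * b y powr of_real (- \<alpha> - 1)" for y
  have Jint: "integrable lborel J" unfolding J_def by (intro integrable_mult_right tail)
  have \<rho>_eq: "\<rho> y = \<phi> y - J y" for y unfolding K(2) J_def \<rho>_def b_def by simp
  have \<rho>int: "integrable lborel \<rho>" unfolding \<rho>_eq by (intro Bochner_Integration.integrable_diff int Jint)
  define P where "P s = K * (\<i> / of_real \<alpha> * b s powr of_real (- \<alpha>))" for s
  have J: "(LINT y:{s<..}|lborel. J y) = P s" for s
    unfolding J_def P_def by (simp only: set_integral_mult_right tail(2))
  have P: "norm (P s) \<le> norm K / \<alpha> * m powr (- \<alpha>) * (1 + \<bar>s\<bar>) powr (- \<alpha>)" for s
    unfolding P_def norm_mult using b[OF \<alpha>, of s] \<alpha>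
    by (auto simp: norm_divide mult.assoc intro!: mult_left_mono divide_right_mono)
  \<comment> \<open>The closed form \<open>P s\<close> of the tail also tends to 0 as s goes to
    minus infinity. Hence the power part integrates to 0 by itself, and \<open>\<rho>\<close>
    inherits a zero integral from \<open>\<phi>\<close>.\<close>
  have J0: "(LINT y|lborel. J y) = 0"
  proof -
    have "(\<lambda>n::nat. LINT y:{- real n<..}|lborel. J y) \<longlonglongrightarrow> (LINT y:(\<Union>n::nat. {- real n<..})|lborel. J y)"
      by (rule set_integral_cont_up)
         (use Jint in \<open>auto simp: incseq_def intro!: set_integrable_subset_UNIV\<close>)
    moreover have "(\<Union>n::nat. {- real n<..}) = UNIV"
    proof -
      have "\<exists>n. - real n < y" for y :: real
        using reals_Archimedean2[of "- y"] by (simp add: minus_less_iff)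
      then show ?thesis by blast
    qed
    ultimately have "(\<lambda>n::nat. P (- real n)) \<longlonglongrightarrow> (LINT y|lborel. J y)"
      unfolding J by (simp add: set_lebesgue_integral_def)
    moreover have "(\<lambda>n::nat. P (- real n)) \<longlonglongrightarrow> 0"
    proof (rule Lim_null_comparison)
      show "\<forall>\<^sub>F n in sequentially. norm (P (- real n)) \<le> norm K / \<alpha> * m powr (- \<alpha>) * (1 + real n) powr (- \<alpha>)"
        using P[of "- real n" for n] by simp
      have "(\<lambda>n. (1 + real n) powr (- \<alpha>)) \<longlonglongrightarrow> 0" using \<alpha> by real_asymp
      then show "(\<lambda>n. norm K / \<alpha> * m powr (- \<alpha>) * (1 + real n) powr (- \<alpha>)) \<longlonglongrightarrow> 0"
        by (rule tendsto_mult_right_zero)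
    qed
    ultimately show ?thesis by (rule LIMSEQ_unique)
  qed
  have T: "(LINT y:{s<..}|lborel. \<phi> y) = P s + (LINT y:{s<..}|lborel. \<rho> y)" for s
  proof -
    have "(LINT y:{s<..}|lborel. \<phi> y) = (LINT y:{s<..}|lborel. J y + \<rho> y)" by (simp add: \<rho>_eq)
    also have "\<dots> = P s + (LINT y:{s<..}|lborel. \<rho> y)"
      unfolding J[symmetric] by (intro set_integral_add(2) set_integrable_subset_UNIV Jint \<rho>int) auto
    finally show ?thesis .
  qed
  have \<rho>tail: "norm (LINT y:{s<..}|lborel. \<rho> y) \<le> C2 / (1 + \<bar>s\<bar>)" if "(LINT y|lborel. \<phi> y) = 0" for s
  proof (rule tail_bound_of_decay_2[OF \<rho>int _ \<rho>])
    show "(LINT y|lborel. \<rho> y) = 0" unfolding \<rho>_eq using that J0 int Jint by simp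
  qed
  show "integrable lborel \<phi>" by (rule int)
  show "\<exists>C>0. (\<forall>y. norm (\<phi> y) \<le> C * (1 + \<bar>y\<bar>) powr (- (1 + \<beta>))) \<and>
      ((LINT y|lborel. \<phi> y) = 0 \<longrightarrow> (\<forall>s. norm (LINT y:{s<..}|lborel. \<phi> y) \<le> C * (1 + \<bar>s\<bar>) powr (- \<beta>))) \<and>
      ((LINT y|lborel. \<phi> y) = 0 \<longrightarrow> F 0 \<noteq> 0 \<longrightarrow>
        (\<exists>c>0. \<forall>s. c * (1 + \<bar>s\<bar>) powr (- \<alpha>) - C / (1 + \<bar>s\<bar>) \<le> norm (LINT y:{s<..}|lborel. \<phi> y)))"
  proof (rule exI[of _ C], intro conjI allI impI)
    show "C > 0" using pos by (simp add: C_def)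
    show "norm (\<phi> y) \<le> C * (1 + \<bar>y\<bar>) powr (- (1 + \<beta>))" for y
      using pos by (intro order_trans[OF \<phi>le] mult_right_mono) (auto simp: C_def)
    show "norm (LINT y:{s<..}|lborel. \<phi> y) \<le> C * (1 + \<bar>s\<bar>) powr (- \<beta>)" if "(LINT y|lborel. \<phi> y) = 0" for s
    proof -
      have "norm (LINT y:{s<..}|lborel. \<phi> y) \<le> norm (P s) + norm (LINT y:{s<..}|lborel. \<rho> y)"
        unfolding T by (rule norm_triangle_ineq)
      also have "\<dots> \<le> norm K / \<alpha> * m powr (- \<alpha>) * (1 + \<bar>s\<bar>) powr (- \<beta>) + C2 * (1 + \<bar>s\<bar>) powr (- \<beta>)"
      proof (intro add_mono)
        show "norm (P s) \<le> norm K / \<alpha> * m powr (- \<alpha>) * (1 + \<bar>s\<bar>) powr (- \<beta>)"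
          using \<alpha> \<beta> by (intro order_trans[OF P] mult_left_mono mono) auto
        have "C2 / (1 + \<bar>s\<bar>) = C2 * (1 + \<bar>s\<bar>) powr (- 1)" by (simp add: powr_minus_divide)
        also have "\<dots> \<le> C2 * (1 + \<bar>s\<bar>) powr (- \<beta>)" using C2 \<beta> by (intro mult_left_mono mono) auto
        finally show "norm (LINT y:{s<..}|lborel. \<rho> y) \<le> C2 * (1 + \<bar>s\<bar>) powr (- \<beta>)"
          using \<rho>tail[OF that, of s] by simp
      qed
      also have "\<dots> = Cb * (1 + \<bar>s\<bar>) powr (- \<beta>)" by (simp add: Cb_def algebra_simps)
      also have "\<dots> \<le> C * (1 + \<bar>s\<bar>) powr (- \<beta>)" using pos by (intro mult_right_mono) (auto simp: C_def)
      finally show ?thesis .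
    qed
    show "\<exists>c>0. \<forall>s. c * (1 + \<bar>s\<bar>) powr (- \<alpha>) - C / (1 + \<bar>s\<bar>) \<le> norm (LINT y:{s<..}|lborel. \<phi> y)"
      if 0: "(LINT y|lborel. \<phi> y) = 0" and "F 0 \<noteq> 0"
    proof (intro exI[of _ "norm K / \<alpha> * (1 + a) powr (- \<alpha>)"] conjI allI)
      show "0 < norm K / \<alpha> * (1 + a) powr (- \<alpha>)" using K(1) that(2) \<alpha> a by simp
      fix s
      have "norm K / \<alpha> * ((1 + a) powr (- \<alpha>) * (1 + \<bar>s\<bar>) powr (- \<alpha>)) \<le> norm (P s)"
        unfolding P_def norm_mult using norm_gamma_base_powr(2)[OF a \<alpha>, of s, folded b_def] \<alpha>
        by (auto simp: norm_divide mult.assoc intro!: mult_left_mono divide_right_mono)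
      moreover have "C2 / (1 + \<bar>s\<bar>) \<le> C / (1 + \<bar>s\<bar>)"
        using pos \<alpha> by (intro divide_right_mono) (auto simp: C_def Cb_def intro: add_nonneg_nonneg)
      moreover have "norm (P s) - norm (LINT y:{s<..}|lborel. \<rho> y) \<le> norm (LINT y:{s<..}|lborel. \<phi> y)"
        unfolding T using norm_diff_ineq[of "P s" "LINT y:{s<..}|lborel. \<rho> y"] .
      ultimately show "norm K / \<alpha> * (1 + a) powr (- \<alpha>) * (1 + \<bar>s\<bar>) powr (- \<alpha>) - C / (1 + \<bar>s\<bar>) \<le> norm (LINT y:{s<..}|lborel. \<phi> y)"
        using \<rho>tail[OF 0, of s] by (simp add: mult.assoc)
    qed
  qed
qed

end

subsection \<open>The two kernels\<close>

definition thermal_kernel :: "real \<Rightarrow> complex \<Rightarrow> complex" where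
  "thermal_kernel k z = exp (- \<i> * of_real k * exp (- z))"

text \<open>Continues - k times the logarithm in \<open>xcoord\<close> by the principal branch; in
  the closed strip the argument of \<open>Ln\<close> has real part at least 1 and stays away from
  the cut.\<close>

definition vacuum_kernel :: "real \<Rightarrow> complex \<Rightarrow> complex" where
  "vacuum_kernel k z = exp (- \<i> * of_real k * Ln (1 + exp (- z)))"

lemma thermal_kernel_holomorphic: "thermal_kernel k holomorphic_on UNIV"
  unfolding thermal_kernel_def[abs_def] by (intro holomorphic_intros)

lemma norm_thermal_kernel_le:
  assumes "k \<ge> 0" "0 \<le> Im z" "Im z \<le> pi / 2"
  shows "norm (thermal_kernel k z) \<le> 1"
proof -
  have "0 \<le> sin (Im z)" using assms by (intro sin_ge_zero) auto
  then show ?thesis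
    using assms by (simp add: thermal_kernel_def norm_exp_eq_Re Im_exp mult_nonneg_nonneg)
qed

lemma Re_one_plus_exp:
  assumes "0 \<le> Im z" "Im z \<le> pi / 2"
  shows "Re (1 + exp (- z)) \<ge> 1" "Im (1 + exp (- z)) \<le> 0"
proof -
  have "0 \<le> cos (Im z)" "0 \<le> sin (Im z)" using assms by (auto intro!: cos_ge_zero sin_ge_zero)
  then show "Re (1 + exp (- z)) \<ge> 1" "Im (1 + exp (- z)) \<le> 0"
    by (auto simp: Re_exp Im_exp)
qed

lemma Im_Ln_nonpos:
  assumes "Re w > 0" "Im w \<le> 0"
  shows "Im (Ln w) \<le> 0"
proof (rule ccontr)
  assume "\<not> Im (Ln w) \<le> 0"
  moreover have w: "w \<noteq> 0" using assms by auto
  moreover have "\<bar>Im (Ln w)\<bar> < pi / 2" using assms w Re_Ln_pos_lt by blast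
  ultimately have "sin (Im (Ln w)) > 0" by (intro sin_gt_zero) auto
  then have "Im (exp (Ln w)) > 0" by (simp add: Im_exp)
  then show False using w assms by simp
qed

text \<open>The contour shift asks for holomorphy on an open set around the closed strip; this is
  the largest one on which the principal logarithm avoids its cut.\<close>

definition vacuum_domain :: "complex set" where
  "vacuum_domain = (\<lambda>z. 1 + exp (- z)) -` (- \<real>\<^sub>\<le>\<^sub>0)"

lemma open_vacuum_domain: "open vacuum_domain"
  unfolding vacuum_domain_def
  by (intro continuous_open_vimage) (auto intro!: continuous_intros simp: open_Compl)

lemma vacuum_domain_strip: "{z. 0 \<le> Im z \<and> Im z \<le> pi / 2} \<subseteq> vacuum_domain"
proof
  fix z assume "z \<in> {z. 0 \<le> Im z \<and> Im z \<le> pi / 2}"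
  then have "Re (1 + exp (- z)) \<ge> 1" by (intro Re_one_plus_exp) auto
  then show "z \<in> vacuum_domain" unfolding vacuum_domain_def vimage_def mem_Collect_eq Compl_iff complex_nonpos_Reals_iff by simp
qed

lemma vacuum_kernel_holomorphic: "vacuum_kernel k holomorphic_on vacuum_domain"
  unfolding vacuum_kernel_def[abs_def]
  by (intro holomorphic_intros) (auto simp: vacuum_domain_def)

lemma norm_vacuum_kernel_le:
  assumes "k \<ge> 0" "0 \<le> Im z" "Im z \<le> pi / 2"
  shows "norm (vacuum_kernel k z) \<le> 1"
proof -
  have "Im (Ln (1 + exp (- z))) \<le> 0"
    using Re_one_plus_exp[OF assms(2,3)] by (intro Im_Ln_nonpos) auto
  then have "k * Im (Ln (1 + exp (- z))) \<le> 0" using assms by (simp add: mult_nonneg_nonpos)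
  then show ?thesis by (simp add: vacuum_kernel_def norm_exp_eq_Re)
qed

lemma thermal_kernel_real: "thermal_kernel k (of_real y) = exp (- \<i> * complex_of_real (k * exp (- y)))"
  by (simp add: thermal_kernel_def exp_of_real[symmetric] mult.assoc)

lemma vacuum_kernel_real: "vacuum_kernel k (of_real y) = exp (\<i> * complex_of_real (k * xcoord y))"
proof -
  have "1 + exp (- complex_of_real y) = of_real (1 + exp (- y))" by (simp flip: exp_of_real)
  then have "Ln (1 + exp (- complex_of_real y)) = of_real (ln (1 + exp (- y)))"
    by (simp only: Ln_of_real add_pos_pos zero_less_one exp_gt_zero)
  then show ?thesis unfolding vacuum_kernel_def xcoord_def by (simp only:) (simp add: mult_ac)
qed

lemma exp_half_pi_shift: "exp (- (of_real y + \<i> * of_real (pi / 2))) = - \<i> * of_real (exp (- y))"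
  by (simp add: complex_eq_iff Re_exp Im_exp)

lemma thermal_kernel_shifted:
  "thermal_kernel k (of_real y + \<i> * of_real (pi / 2)) = of_real (exp (- (k * exp (- y))))"
proof -
  have "- \<i> * of_real k * (- \<i> * of_real (exp (- y))) = complex_of_real (- (k * exp (- y)))"
    by (simp add: complex_eq_iff)
  then show ?thesis unfolding thermal_kernel_def exp_half_pi_shift by (simp only: exp_of_real)
qed

lemma vacuum_kernel_shifted:
  "vacuum_kernel k (of_real y + \<i> * of_real (pi / 2)) = exp (- \<i> * of_real k * Ln (1 - \<i> * of_real (exp (- y))))"
  unfolding vacuum_kernel_def exp_half_pi_shift by simp

text \<open>The bounds serve different regimes: \<open>norm L \<le> r\<close> makes the kernel close
  to 1 beyond the step, the strictly negative imaginary part makes it decay before the step, and the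
  logarithmic bound controls small \<open>k\<close> uniformly in \<open>y\<close>.\<close>

lemma Ln_one_minus_ir:
  assumes "r > 0"
  defines "L \<equiv> Ln (1 - \<i> * of_real r)"
  shows "norm L \<le> r" and "Im L \<le> 0" and "Im L \<le> - (min r 1 / 2)" and "norm L \<le> ln (1 + r) + 2"
proof -
  define z where "z = 1 - \<i> * complex_of_real r"
  have z: "Re z = 1" "Im z = - r" "z \<noteq> 0" by (auto simp: z_def complex_eq_iff)
  have "norm (Ln z - Ln 1) \<le> 1 * norm (z - 1)"
  proof (rule field_differentiable_bound[where S = "{z. Re z \<ge> 1}" and f' = inverse])
    show "convex {z. 1 \<le> Re z}" by (rule convex_halfspace_Re_ge)
    show "(Ln has_field_derivative inverse w) (at w within {z. 1 \<le> Re z})" if "w \<in> {z. 1 \<le> Re z}" for w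
      using that by (intro has_field_derivative_Ln[THEN has_field_derivative_at_within]) (auto simp: complex_nonpos_Reals_iff)
    show "norm (inverse w) \<le> 1" if "w \<in> {z. 1 \<le> Re z}" for w
      using that complex_Re_le_cmod[of w] by (simp add: norm_inverse inverse_le_1_iff)
  qed (use z in auto)
  then show "norm L \<le> r" using assms by (simp add: L_def z_def norm_mult)
  show im: "Im L \<le> 0" unfolding L_def z_def[symmetric] using z assms by (intro Im_Ln_nonpos) auto
  have nz: "norm z \<le> 1 + r" "norm z > 0" "norm z \<ge> 1"
    using norm_triangle_ineq4[of 1 "\<i> * of_real r"] assms z complex_Re_le_cmod[of z] by (auto simp: z_def norm_mult)
  \<comment> \<open>Comparing imaginary parts in z = exp (Ln z); then sin t \<le> t turns the sine
    of the angle into a bound for the angle itself.\<close>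
  have "norm z * sin (Im (Ln z)) = - r"
    using z Im_exp[of "Ln z"] by (simp add: Re_Ln)
  then have "r / norm z = sin (- Im (Ln z))" using nz by (simp add: field_simps)
  also have "\<dots> \<le> - Im L" using im unfolding L_def z_def[symmetric] by (intro sin_x_le_x) auto
  finally have "r / norm z \<le> - Im L" .
  moreover have "min r 1 / 2 \<le> r / (1 + r)" using assms by (auto simp: min_def field_simps)
  moreover have "r / (1 + r) \<le> r / norm z" using nz assms by (intro divide_left_mono) auto
  ultimately show "Im L \<le> - (min r 1 / 2)" by linarith
  have "norm L \<le> \<bar>Re L\<bar> + \<bar>Im L\<bar>" by (rule cmod_le)
  moreover have "\<bar>Re L\<bar> \<le> ln (1 + r)"
    unfolding L_def z_def[symmetric] using z nz by (simp add: Re_Ln)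
  moreover have "\<bar>Im L\<bar> < pi / 2"
    using z Re_Ln_pos_lt[of z] unfolding L_def z_def[symmetric] by simp
  ultimately show "norm L \<le> ln (1 + r) + 2" using pi_half_less_two by linarith
qed

lemma exp_neg_le_inverse: "x > 0 \<Longrightarrow> exp (- x) \<le> 1 / (x::real)"
proof -
  assume "x > 0"
  moreover have "x \<le> exp x" using exp_ge_add_one_self[of x] by linarith
  ultimately show ?thesis by (simp add: exp_minus divide_inverse)
qed

text \<open>On the shifted line the kernel is exp (- exp (ln k - y)). Beyond the step 1 - x \<le>
  exp (- x) applies, before it exp (- x) \<le> 1 / x.\<close>

lemma thermal_kernel_indicator:
  assumes "k > 0"
  shows "norm (thermal_kernel k (of_real y + \<i> * of_real (pi / 2)) - of_bool (ln k < y)) \<le> exp (- \<bar>y - ln k\<bar>)"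
proof -
  define s where "s = ln k"
  have k: "k * exp (- y) = exp (s - y)" using assms by (simp add: s_def exp_diff exp_minus divide_inverse)
  show ?thesis
  proof (cases "s < y")
    case True
    have "norm (of_real (exp (- exp (s - y))) - 1 :: complex) = \<bar>exp (- exp (s - y)) - 1\<bar>"
      by (metis norm_of_real of_real_1 of_real_diff)
    also have "\<dots> \<le> exp (s - y)" using exp_ge_add_one_self[of "- exp (s - y)"] by simp
    finally show ?thesis using True unfolding thermal_kernel_shifted k s_def[symmetric] by simp
  next
    case False
    have "exp (- exp (s - y)) \<le> 1 / exp (s - y)" by (rule exp_neg_le_inverse) simp
    then show ?thesis using False unfolding thermal_kernel_shifted k s_def[symmetric]
      by (simp add: exp_diff divide_simps)
  qed
qed

text \<open>The extra term exp (- ln k) = 1 / k is due to saturation: as y goes to minus infinity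
  the argument of 1 - i exp (- y) tends to - pi / 2, so the kernel keeps modulus about exp (- k pi /
  2) instead of tending to 0.\<close>

lemma vacuum_kernel_indicator:
  assumes "k \<ge> 1"
  shows "norm (vacuum_kernel k (of_real y + \<i> * of_real (pi / 2)) - of_bool (ln k < y))
       \<le> 2 * (exp (- \<bar>y - ln k\<bar>) + exp (- ln k))"
proof -
  define s where "s = ln k"
  define r where "r = exp (- y)"
  have k: "k * r = exp (s - y)" using assms by (simp add: s_def r_def exp_diff exp_minus divide_inverse)
  have k': "k = exp s" using assms by (simp add: s_def)
  define L where "L = Ln (1 - \<i> * of_real r)"
  have L: "norm L \<le> r" "Im L \<le> 0" "Im L \<le> - (min r 1 / 2)"
    unfolding L_def by (rule Ln_one_minus_ir; simp add: r_def)+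
  have V: "vacuum_kernel k (of_real y + \<i> * of_real (pi / 2)) = exp (- \<i> * of_real k * L)"
    unfolding vacuum_kernel_shifted L_def r_def ..
  show ?thesis
  proof (cases "s < y")
    case True
    have "norm (exp (- \<i> * of_real k * L) - 1) \<le> norm (- \<i> * of_real k * L)"
      using assms L by (intro norm_exp_minus_1_le) (auto simp: mult_nonneg_nonpos)
    also have "\<dots> \<le> k * r" using assms L by (simp add: norm_mult)
    also have "\<dots> \<le> 2 * (exp (- \<bar>y - s\<bar>) + exp (- s))"
      unfolding k using True by (simp add: add_nonneg_nonneg)
    finally show ?thesis using True unfolding V s_def[symmetric] by simp
  next
    case False
    have "norm (exp (- \<i> * of_real k * L)) = exp (k * Im L)" by (simp add: norm_exp_eq_Re)
    also have "\<dots> \<le> exp (- (k * (min r 1 / 2)))"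
      using assms mult_left_mono[OF L(3), of k] by simp
    also have "\<dots> \<le> 1 / (k * (min r 1 / 2))"
      using assms by (intro exp_neg_le_inverse) (auto simp: r_def)
    also have "\<dots> = 2 * (1 / (k * min r 1))" by simp
    also have "\<dots> \<le> 2 * (1 / (k * r) + 1 / k)"
      using assms by (intro mult_left_mono) (auto simp: min_def r_def)
    also have "\<dots> = 2 * (exp (- \<bar>y - s\<bar>) + exp (- s))"
      unfolding k using False by (simp add: k' exp_diff exp_minus divide_simps)
    finally show ?thesis using False unfolding V s_def[symmetric] by simp
  qed
qed

text \<open>Interpolates between a bound linear in u = k (1 + |y|) and the trivial bound 2. A full
  power of 1 + |y| would be too much against a function known to decay with exponent 1 + \<beta> for
  some \<beta> \<le> 1, hence the free exponent \<delta>.\<close>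

lemma vacuum_kernel_small:
  assumes "0 < k" "0 < \<delta>" "\<delta> \<le> 1"
  shows "norm (vacuum_kernel k (of_real y + \<i> * of_real (pi / 2)) - 1) \<le> 6 * (k powr \<delta> * (1 + \<bar>y\<bar>) powr \<delta>)"
proof -
  define r where "r = exp (- y)"
  define L where "L = Ln (1 - \<i> * of_real r)"
  have L: "Im L \<le> 0" "norm L \<le> ln (1 + r) + 2"
    unfolding L_def by (rule Ln_one_minus_ir; simp add: r_def)+
  have V: "vacuum_kernel k (of_real y + \<i> * of_real (pi / 2)) = exp (- \<i> * of_real k * L)"
    unfolding vacuum_kernel_shifted L_def r_def ..
  have "r \<le> exp \<bar>y\<bar>" "1 \<le> exp \<bar>y\<bar>" by (auto simp: r_def)
  then have "1 + r \<le> 2 * exp \<bar>y\<bar>" by linarith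
  then have "ln (1 + r) \<le> ln (2 * exp \<bar>y\<bar>)" by (simp add: r_def add_pos_pos)
  also have "\<dots> \<le> 1 + \<bar>y\<bar>" using ln_2_less_1 by (simp add: ln_mult)
  finally have Ly: "norm L \<le> 3 * (1 + \<bar>y\<bar>)" using L by simp
  define u where "u = k * (1 + \<bar>y\<bar>)"
  have u: "u > 0" using assms by (simp add: u_def)
  have neg: "Re (- \<i> * of_real k * L) \<le> 0" using assms L by (auto simp: mult_nonneg_nonpos)
  have "norm (- \<i> * of_real k * L) \<le> 3 * u"
    using assms mult_left_mono[OF Ly, of k] by (simp add: norm_mult u_def algebra_simps)
  then have b: "norm (exp (- \<i> * of_real k * L) - 1) \<le> 3 * u" "norm (exp (- \<i> * of_real k * L) - 1) \<le> 2"
    using norm_exp_minus_1_le[OF neg] by auto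
  have "norm (exp (- \<i> * of_real k * L) - 1) \<le> 6 * u powr \<delta>"
  proof (cases "u \<le> 1")
    case True
    then have "u powr 1 \<le> u powr \<delta>" using assms u by (intro powr_mono') auto
    then show ?thesis using b(1) u by (simp add: powr_nonneg_iff)
  next
    case False
    then have "1 \<le> u powr \<delta>" using assms by (simp add: ge_one_powr_ge_zero)
    then show ?thesis using b(2) by simp
  qed
  then show ?thesis unfolding V u_def using assms by (simp add: powr_mult)
qed

section \<open>Replacing a kernel by a step function\<close>

lemma one_plus_power4_le_exp: "x \<ge> 0 \<Longrightarrow> (1 + x) ^ 4 \<le> 256 * exp (x::real)"
proof -
  assume x: "x \<ge> 0"
  \<comment> \<open>The constant is 256 = 4^4. The fourth power is chosen because the largest
    exponent to be absorbed below is \<open>\<gamma> + 2\<close> with \<gamma> \<le> 2.\<close>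
  have "((1 + x) / 4) ^ 4 \<le> exp (x / 4) ^ 4"
  proof (intro power_mono)
    have "1 + x / 4 \<le> exp (x / 4)" by (rule exp_ge_add_one_self)
    then show "(1 + x) / 4 \<le> exp (x / 4)" unfolding add_divide_distrib by linarith
  qed (use x in auto)
  also have "exp (x / 4) ^ 4 = exp x" by (simp flip: exp_of_nat_mult)
  finally show ?thesis by (simp add: power_divide)
qed

lemma exp_neg_le_powr:
  fixes u \<gamma> :: real
  assumes "0 \<le> \<gamma>" "\<gamma> \<le> 4"
  shows "exp (- \<bar>u\<bar>) \<le> 256 * (1 + \<bar>u\<bar>) powr (- \<gamma>)"
proof -
  have "exp (- \<bar>u\<bar>) \<le> 256 / (1 + \<bar>u\<bar>) ^ 4"
    using one_plus_power4_le_exp[of "\<bar>u\<bar>"] by (simp add: exp_minus field_simps add_pos_nonneg)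
  also have "\<dots> = 256 * (1 + \<bar>u\<bar>) powr (- 4)" by (simp add: powr_minus_divide powr_numeral)
  also have "\<dots> \<le> 256 * (1 + \<bar>u\<bar>) powr (- \<gamma>)" using assms by (intro mult_left_mono powr_mono) auto
  finally show ?thesis .
qed

text \<open>The inequality 1 + |s| \<le> (1 + |y|) (1 + |y - s|) moves the decay from
  \<open>y\<close> to \<open>s\<close> at the price of a power of 1 + |y - s|. The exponential pays
  this price and leaves an integrable factor.\<close>

lemma decay_times_exp_le:
  fixes y s \<gamma> :: real
  assumes "0 \<le> \<gamma>" "\<gamma> \<le> 2"
  shows "(1 + \<bar>y\<bar>) powr (- \<gamma>) * exp (- \<bar>y - s\<bar>) \<le> 256 * (1 + \<bar>s\<bar>) powr (- \<gamma>) * (1 + \<bar>y - s\<bar>) powr (- 2)"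
proof -
  define u where "u = y - s"
  have "\<bar>s\<bar> \<le> \<bar>y\<bar> + \<bar>u\<bar>" "0 \<le> \<bar>y\<bar> * \<bar>u\<bar>" by (auto simp: u_def)
  then have "1 + \<bar>s\<bar> \<le> 1 + \<bar>y\<bar> + \<bar>u\<bar> + \<bar>y\<bar> * \<bar>u\<bar>" by linarith
  then have "(1 + \<bar>s\<bar>) powr \<gamma> \<le> ((1 + \<bar>y\<bar>) * (1 + \<bar>u\<bar>)) powr \<gamma>"
    using assms by (intro powr_mono2) (auto simp: algebra_simps)
  also have "\<dots> = (1 + \<bar>y\<bar>) powr \<gamma> * (1 + \<bar>u\<bar>) powr \<gamma>" by (intro powr_mult)
  finally have le: "(1 + \<bar>s\<bar>) powr \<gamma> \<le> (1 + \<bar>y\<bar>) powr \<gamma> * (1 + \<bar>u\<bar>) powr \<gamma>" .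
  have "0 < (1 + \<bar>y\<bar>) powr \<gamma>" "0 < (1 + \<bar>s\<bar>) powr \<gamma>" by auto
  with le have 1: "(1 + \<bar>y\<bar>) powr (- \<gamma>) \<le> (1 + \<bar>s\<bar>) powr (- \<gamma>) * (1 + \<bar>u\<bar>) powr \<gamma>"
    unfolding powr_minus by (simp add: field_simps)
  have 2: "exp (- \<bar>u\<bar>) \<le> 256 * (1 + \<bar>u\<bar>) powr (- (\<gamma> + 2))" using assms by (intro exp_neg_le_powr) auto
  have "(1 + \<bar>y\<bar>) powr (- \<gamma>) * exp (- \<bar>u\<bar>) \<le>
      ((1 + \<bar>s\<bar>) powr (- \<gamma>) * (1 + \<bar>u\<bar>) powr \<gamma>) * (256 * (1 + \<bar>u\<bar>) powr (- (\<gamma> + 2)))"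
    using 1 2 by (intro mult_mono) auto
  also have "\<dots> = 256 * (1 + \<bar>s\<bar>) powr (- \<gamma>) * ((1 + \<bar>u\<bar>) powr \<gamma> * (1 + \<bar>u\<bar>) powr (- (\<gamma> + 2)))" by simp
  also have "(1 + \<bar>u\<bar>) powr \<gamma> * (1 + \<bar>u\<bar>) powr (- (\<gamma> + 2)) = (1 + \<bar>u\<bar>) powr (- 2)"
    by (subst powr_add[symmetric]) simp
  finally show ?thesis by (simp add: u_def)
qed

text \<open>The exponential part of the error is concentrated near \<open>s\<close>, so it inherits
  the pointwise decay of \<phi> at \<open>s\<close>, one power better than a tail integral. The
  uniform part \<open>\<eta>\<close> is 0 for the thermal kernel and 1 / k for the vacuum
  kernel.\<close>

lemma step_kernel_estimate:
  fixes \<phi> V :: "real \<Rightarrow> complex"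
  assumes \<phi>: "integrable lborel \<phi>" and C: "\<And>y. norm (\<phi> y) \<le> C * (1 + \<bar>y\<bar>) powr (- \<gamma>)"
    and \<gamma>: "0 \<le> \<gamma>" "\<gamma> \<le> 2" and V: "V \<in> borel_measurable borel"
    and "A \<ge> 0" "\<eta> \<ge> 0" and step: "\<And>y. norm (V y - of_bool (s < y)) \<le> A * (exp (- \<bar>y - s\<bar>) + \<eta>)"
  shows "norm ((LINT y|lborel. \<phi> y * V y) - (LINT y:{s<..}|lborel. \<phi> y)) \<le>
     A * (256 * C * (LINT u|lborel. (1 + \<bar>u\<bar>) powr (-2)) * (1 + \<bar>s\<bar>) powr (- \<gamma>) + \<eta> * (LINT y|lborel. norm (\<phi> y)))"
proof -
  have [measurable]: "\<phi> \<in> borel_measurable borel" "V \<in> borel_measurable borel" using \<phi> V by auto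
  have "norm (\<phi> 0) \<le> C" using C[of 0] by simp
  then have C0: "C \<ge> 0" by (rule order_trans[OF norm_ge_zero])
  have 2: "integrable lborel (\<lambda>u::real. (1 + \<bar>u\<bar>) powr (-2))" by (rule integrable_one_plus_abs_powr) simp
  have i2: "integrable lborel (\<lambda>y. (1 + \<bar>y - s\<bar>) powr (-2))"
    using lborel_integrable_real_affine[OF 2, of 1 "- s"] by simp
  have eq2: "(LINT y|lborel. (1 + \<bar>y - s\<bar>) powr (-2)) = (LINT u|lborel. (1 + \<bar>u\<bar>) powr (-2))"
    using lborel_integral_real_affine[of 1 "\<lambda>u. (1 + \<bar>u\<bar>) powr (-2)" "- s"] by simp
  define I2 where "I2 = (LINT u|lborel. (1 + \<bar>u::real\<bar>) powr (-2))"
  have iV: "integrable lborel (\<lambda>y. \<phi> y * V y)"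
  proof (rule Bochner_Integration.integrable_bound)
    show "integrable lborel (\<lambda>y. \<phi> y * of_real (1 + A * (1 + \<eta>)))" using \<phi> by (intro integrable_mult_left)
    have "norm (V y) \<le> 1 + A * (1 + \<eta>)" for y
    proof -
      have "norm (V y) \<le> norm (of_bool (s < y) :: complex) + norm (V y - of_bool (s < y))"
        using norm_triangle_ineq[of "of_bool (s < y)" "V y - of_bool (s < y)"] by simp
      also have "\<dots> \<le> 1 + A * (1 + \<eta>)"
        using step[of y] \<open>A \<ge> 0\<close> by (intro add_mono order_trans[OF step] mult_left_mono) auto
      finally show ?thesis .
    qed
    then show "AE y in lborel. norm (\<phi> y * V y) \<le> norm (\<phi> y * of_real (1 + A * (1 + \<eta>)))"
      by (intro always_eventually allI) (auto simp: norm_mult intro!: mult_left_mono intro: order_trans[OF _ abs_ge_self] simp del: of_real_add of_real_mult)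
  qed simp
  have i1: "integrable lborel (\<lambda>y. indicator {s<..} y *\<^sub>R \<phi> y)"
    using \<phi> by (intro integrable_mult_indicator) auto
  have eq0: "(LINT y|lborel. \<phi> y * V y) - (LINT y:{s<..}|lborel. \<phi> y) = (LINT y|lborel. \<phi> y * V y - indicator {s<..} y *\<^sub>R \<phi> y)"
    unfolding set_lebesgue_integral_def using iV i1 by simp
  have le: "norm (LINT y|lborel. \<phi> y * V y - indicator {s<..} y *\<^sub>R \<phi> y) \<le> (LINT y|lborel. A * (256 * C * (1 + \<bar>s\<bar>) powr (- \<gamma>) * (1 + \<bar>y - s\<bar>) powr (-2) + \<eta> * norm (\<phi> y)))"
  proof (rule Bochner_Integration.integral_norm_bound_integral)
    show "integrable lborel (\<lambda>y. \<phi> y * V y - indicator {s<..} y *\<^sub>R \<phi> y)" using iV i1 by simp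
    show "integrable lborel (\<lambda>y. A * (256 * C * (1 + \<bar>s\<bar>) powr (- \<gamma>) * (1 + \<bar>y - s\<bar>) powr (-2) + \<eta> * norm (\<phi> y)))"
      by (intro integrable_mult_right Bochner_Integration.integrable_add i2 integrable_norm \<phi>)
    fix y
    have "\<phi> y * V y - indicator {s<..} y *\<^sub>R \<phi> y = \<phi> y * (V y - of_bool (s < y))"
      by (simp add: indicator_def algebra_simps)
    also have "norm \<dots> \<le> norm (\<phi> y) * (A * (exp (- \<bar>y - s\<bar>) + \<eta>))"
      unfolding norm_mult by (intro mult_left_mono step) auto
    also have "\<dots> = A * (norm (\<phi> y) * exp (- \<bar>y - s\<bar>) + \<eta> * norm (\<phi> y))" by (simp add: algebra_simps)
    also have "\<dots> \<le> A * (256 * C * (1 + \<bar>s\<bar>) powr (- \<gamma>) * (1 + \<bar>y - s\<bar>) powr (-2) + \<eta> * norm (\<phi> y))"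
    proof (intro mult_left_mono add_mono order_refl \<open>A \<ge> 0\<close>)
      have "norm (\<phi> y) * exp (- \<bar>y - s\<bar>) \<le> C * (1 + \<bar>y\<bar>) powr (- \<gamma>) * exp (- \<bar>y - s\<bar>)"
        using C by (intro mult_right_mono) auto
      also have "\<dots> \<le> C * (256 * (1 + \<bar>s\<bar>) powr (- \<gamma>) * (1 + \<bar>y - s\<bar>) powr (- 2))"
        unfolding mult.assoc[of C] using decay_times_exp_le[OF \<gamma>, of y s] C0
        by (intro mult_left_mono) (auto simp: mult.assoc)
      finally show "norm (\<phi> y) * exp (- \<bar>y - s\<bar>) \<le> 256 * C * (1 + \<bar>s\<bar>) powr (- \<gamma>) * (1 + \<bar>y - s\<bar>) powr (-2)"
        by (simp add: mult_ac)
    qed (use \<open>\<eta> \<ge> 0\<close> in auto)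
    finally show "norm (\<phi> y * V y - indicator {s<..} y *\<^sub>R \<phi> y) \<le>
      A * (256 * C * (1 + \<bar>s\<bar>) powr (- \<gamma>) * (1 + \<bar>y - s\<bar>) powr (-2) + \<eta> * norm (\<phi> y))" .
  qed
  have eq1: "(LINT y|lborel. A * (256 * C * (1 + \<bar>s\<bar>) powr (- \<gamma>) * (1 + \<bar>y - s\<bar>) powr (-2) + \<eta> * norm (\<phi> y)))
      = A * (256 * C * I2 * (1 + \<bar>s\<bar>) powr (- \<gamma>) + \<eta> * (LINT y|lborel. norm (\<phi> y)))"
  proof -
    define K where "K = 256 * C * (1 + \<bar>s\<bar>) powr (- \<gamma>)"
    have "(LINT y|lborel. K * (1 + \<bar>y - s\<bar>) powr (-2) + \<eta> * norm (\<phi> y)) =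
      (LINT y|lborel. K * (1 + \<bar>y - s\<bar>) powr (-2)) + (LINT y|lborel. \<eta> * norm (\<phi> y))"
      by (intro Bochner_Integration.integral_add integrable_mult_right i2 integrable_norm \<phi>)
    also have "(LINT y|lborel. K * (1 + \<bar>y - s\<bar>) powr (-2)) = K * I2"
      by (subst integral_mult_right_zero) (simp only: eq2 I2_def)
    also have "(LINT y|lborel. \<eta> * norm (\<phi> y)) = \<eta> * (LINT y|lborel. norm (\<phi> y))"
      by (rule integral_mult_right_zero)
    finally have "(LINT y|lborel. A * (K * (1 + \<bar>y - s\<bar>) powr (-2) + \<eta> * norm (\<phi> y))) =
        A * (K * I2 + \<eta> * (LINT y|lborel. norm (\<phi> y)))"
      by (subst integral_mult_right_zero) (rule arg_cong)
    moreover have "K * I2 = 256 * C * I2 * (1 + \<bar>s\<bar>) powr (- \<gamma>)" by (simp add: K_def)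
    ultimately show ?thesis by (simp only: K_def)
  qed
  show ?thesis using le unfolding eq0 eq1 I2_def .
qed

subsection \<open>Logarithmic integrals\<close>

lemma one_minus_ln_powr_deriv:
  assumes "k > 0" "k \<le> 1" "\<gamma> > 1"
  shows "((\<lambda>k. (1 - ln k) powr (1 - \<gamma>) / (\<gamma> - 1)) has_real_derivative (1 - ln k) powr (- \<gamma>) / k) (at k)"
proof -
  have "0 < 1 - ln k" using assms ln_le_zero_iff[of k] by linarith
  moreover have "((\<lambda>k. 1 - ln k) has_real_derivative (- (1 / k))) (at k)"
    using assms by (auto intro!: derivative_eq_intros)
  ultimately have "((\<lambda>k. (1 - ln k) powr (1 - \<gamma>)) has_real_derivative (1 - \<gamma>) * (1 - ln k) powr (1 - \<gamma> - 1) * (- (1 / k))) (at k)"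
    using DERIV_fun_powr[of "\<lambda>k. 1 - ln k" "- (1 / k)" k "1 - \<gamma>"] by simp
  from DERIV_cdivide[OF this, of "\<gamma> - 1"] show ?thesis
  proof (rule DERIV_cong)
    have "(1 - \<gamma>) * X * (- (1 / k)) / (\<gamma> - 1) = X / k" for X
      using assms by (simp add: divide_simps) (simp add: algebra_simps)
    from this[of "(1 - ln k) powr (- \<gamma>)"]
    show "(1 - \<gamma>) * (1 - ln k) powr (1 - \<gamma> - 1) * (- (1 / k)) / (\<gamma> - 1) = (1 - ln k) powr (- \<gamma>) / k"
      by simp
  qed
qed

text \<open>In the variable ln k the measure dk / k becomes Lebesgue measure and the integrand a
  power of 1 + |ln k|; the primitives below are its explicit antiderivatives on the two sides of k =
  1.\<close>

lemma nn_integral_log_decay_finite: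
  assumes "\<gamma> > 1"
  shows "(\<integral>\<^sup>+k\<in>{0<..}. ennreal ((1 + \<bar>ln k\<bar>) powr (- \<gamma>) / k) \<partial>lborel) < \<infinity>"
proof -
  let ?h = "\<lambda>k::real. (1 + \<bar>ln k\<bar>) powr (- \<gamma>) / k"
  have left: "set_integrable lborel {0<..<1} ?h"
  proof -
    have lim0: "((\<lambda>k. (1 - ln k) powr (1 - \<gamma>) / (\<gamma> - 1)) \<longlongrightarrow> 0) (at_right 0)"
      using assms by real_asymp
    have lim1: "((\<lambda>k. (1 - ln k) powr (1 - \<gamma>) / (\<gamma> - 1)) \<longlongrightarrow> (1 - ln 1) powr (1 - \<gamma>) / (\<gamma> - 1)) (at_left 1)"
      using assms by (intro tendsto_intros) auto
    have nz: "1 - ln k \<noteq> 0" if "0 < k" "k < 1" for k :: real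
      using ln_less_zero[OF that] by linarith
    have "set_integrable lborel (einterval (ereal 0) (ereal 1)) ?h"
    proof (rule interval_integral_FTC_nonneg(1)[where F = "\<lambda>k. (1 - ln k) powr (1 - \<gamma>) / (\<gamma> - 1)"])
      show "((\<lambda>k. (1 - ln k) powr (1 - \<gamma>) / (\<gamma> - 1)) has_real_derivative ?h k) (at k)"
        if "ereal 0 < ereal k" "ereal k < ereal 1" for k
        using one_minus_ln_powr_deriv[of k] that assms by simp
      show "isCont ?h k" if "ereal 0 < ereal k" "ereal k < ereal 1" for k
        using that nz[of k] by (intro continuous_intros) auto
      show "AE k in lborel. ereal 0 < ereal k \<longrightarrow> ereal k < ereal 1 \<longrightarrow> 0 \<le> ?h k"
        by (intro always_eventually) auto
      show "(((\<lambda>k. (1 - ln k) powr (1 - \<gamma>) / (\<gamma> - 1)) \<circ> real_of_ereal) \<longlongrightarrow> 0) (at_right (ereal 0))"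
        unfolding ereal_tendsto_simps by (rule lim0)
      show "(((\<lambda>k. (1 - ln k) powr (1 - \<gamma>) / (\<gamma> - 1)) \<circ> real_of_ereal) \<longlongrightarrow> (1 - ln 1) powr (1 - \<gamma>) / (\<gamma> - 1)) (at_left (ereal 1))"
        unfolding ereal_tendsto_simps by (rule lim1)
    qed simp
    then show ?thesis by simp
  qed
  have right: "set_integrable lborel {1<..} ?h"
  proof -
    have lim: "((\<lambda>k. - ((1 + ln k) powr (1 - \<gamma>) / (\<gamma> - 1))) \<longlongrightarrow> 0) at_top"
      using assms by real_asymp
    have lim1: "((\<lambda>k. - ((1 + ln k) powr (1 - \<gamma>) / (\<gamma> - 1))) \<longlongrightarrow> - ((1 + ln 1) powr (1 - \<gamma>) / (\<gamma> - 1))) (at_right 1)"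
      using assms by (intro tendsto_intros) auto
    have "set_integrable lborel (einterval (ereal 1) \<infinity>) ?h"
    proof (rule interval_integral_FTC_nonneg(1)[where F = "\<lambda>k. - ((1 + ln k) powr (1 - \<gamma>) / (\<gamma> - 1))"])
      show "((\<lambda>k. - ((1 + ln k) powr (1 - \<gamma>) / (\<gamma> - 1))) has_real_derivative ?h k) (at k)"
        if "ereal 1 < ereal k" for k
      proof -
        have k: "k > 1" using that by simp
        have "0 < 1 + ln k" using k ln_gt_zero[of k] by linarith
        moreover have "((\<lambda>k. 1 + ln k) has_real_derivative (1 / k)) (at k)"
          using k by (auto intro!: derivative_eq_intros)
        ultimately have "((\<lambda>k. (1 + ln k) powr (1 - \<gamma>)) has_real_derivative (1 - \<gamma>) * (1 + ln k) powr (1 - \<gamma> - 1) * (1 / k)) (at k)"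
          using DERIV_fun_powr[of "\<lambda>k. 1 + ln k" "1 / k" k "1 - \<gamma>"] by simp
        from DERIV_minus[OF DERIV_cdivide[OF this, of "\<gamma> - 1"]] show ?thesis
        proof (rule DERIV_cong)
          have "- ((1 - \<gamma>) * X * (1 / k) / (\<gamma> - 1)) = X / k" for X
            using assms k by (simp add: divide_simps) (simp add: algebra_simps)
          from this[of "(1 + ln k) powr (- \<gamma>)"]
          show "- ((1 - \<gamma>) * (1 + ln k) powr (1 - \<gamma> - 1) * (1 / k) / (\<gamma> - 1)) = (1 + \<bar>ln k\<bar>) powr (- \<gamma>) / k"
            using k by simp
        qed
      qed
      show "isCont ?h k" if "ereal 1 < ereal k" for k
      proof -
        have "1 + \<bar>ln k\<bar> \<noteq> 0" by linarith
        then show ?thesis using that by (intro continuous_intros) auto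
      qed
      show "AE k in lborel. ereal 1 < ereal k \<longrightarrow> ereal k < \<infinity> \<longrightarrow> 0 \<le> ?h k"
        by (intro always_eventually) auto
      show "(((\<lambda>k. - ((1 + ln k) powr (1 - \<gamma>) / (\<gamma> - 1))) \<circ> real_of_ereal) \<longlongrightarrow> - ((1 + ln 1) powr (1 - \<gamma>) / (\<gamma> - 1))) (at_right (ereal 1))"
        unfolding ereal_tendsto_simps by (rule lim1)
      show "(((\<lambda>k. - ((1 + ln k) powr (1 - \<gamma>) / (\<gamma> - 1))) \<circ> real_of_ereal) \<longlongrightarrow> 0) (at_left \<infinity>)"
        unfolding ereal_tendsto_simps by (rule lim)
    qed simp
    then show ?thesis by simp
  qed
  have "set_integrable lborel ({0<..<1} \<union> {1<..}) ?h"
    by (intro set_integrable_Un left right) auto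
  then have "integrable lborel (\<lambda>k. indicator ({0<..<1} \<union> {1<..}) k * ?h k)"
    by (simp add: set_integrable_def)
  then have "(\<integral>\<^sup>+k. ennreal (norm (indicator ({0<..<1} \<union> {1<..}) k * ?h k)) \<partial>lborel) < \<infinity>"
    by (simp add: integrable_iff_bounded)
  also have "(\<integral>\<^sup>+k. ennreal (norm (indicator ({0<..<1} \<union> {1<..}) k * ?h k)) \<partial>lborel) =
     (\<integral>\<^sup>+k\<in>{0<..}. ennreal (?h k) \<partial>lborel)"
  proof (rule nn_integral_cong_AE)
    show "AE k in lborel. ennreal (norm (indicator ({0<..<1} \<union> {1<..}) k * ?h k)) = ennreal (?h k) * indicator {0<..} k"
      using AE_lborel_singleton[of 1] by eventually_elim (auto simp: indicator_def abs_mult)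
  qed
  finally show ?thesis .
qed

lemma nn_integral_eq_infinity_unbounded:
  fixes F :: "real \<Rightarrow> real"
  assumes "\<And>N. ennreal (F N) \<le> I" "filterlim F at_top at_top"
  shows "I = \<infinity>"
proof (rule ccontr)
  assume "I \<noteq> \<infinity>"
  then obtain r where r: "I = ennreal r" "r \<ge> 0" by (cases I) auto
  from assms(2) have "\<forall>\<^sub>F N in at_top. F N \<ge> r + 1" by (simp add: filterlim_at_top)
  then obtain N where "F N \<ge> r + 1" by (auto simp: eventually_at_top_linorder)
  with assms(1)[of N] r show False by (simp add: ennreal_le_iff)
qed

text \<open>The primitives are iterated logarithms, so the divergence is doubly logarithmic and
  occurs at both ends. The cut-off \<open>K\<close> is free because the lower bounds to be inserted
  hold once |ln k| is large.\<close>

lemma nn_integral_inverse_log_infinite: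
  fixes K :: real
  assumes "K \<ge> 1"
  shows "(\<integral>\<^sup>+k\<in>{K..}. ennreal (1 / ((1 + \<bar>ln k\<bar>) * k)) \<partial>lborel) = \<infinity>"
    and "(\<integral>\<^sup>+k\<in>{0<..1 / K}. ennreal (1 / ((1 + \<bar>ln k\<bar>) * k)) \<partial>lborel) = \<infinity>"
proof -
  let ?h = "\<lambda>k::real. 1 / ((1 + \<bar>ln k\<bar>) * k)"
  have lim: "filterlim (\<lambda>N. ln (1 + ln N) - ln (1 + ln K)) at_top at_top" by real_asymp
  have F: "((\<lambda>k. ln (1 + ln k)) has_real_derivative ?h k) (at k)" if "1 \<le> k" for k
    using that ln_ge_zero[of k] by (auto intro!: derivative_eq_intros simp: add_pos_nonneg)
  have F': "((\<lambda>k. - ln (1 - ln k)) has_real_derivative ?h k) (at k)" if "0 < k" "k \<le> 1" for k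
  proof -
    have "ln k \<le> 0" using that by simp
    then have "ln k < 1" by linarith
    then show ?thesis using that \<open>ln k < 1\<close> by (auto intro!: derivative_eq_intros simp: field_simps)
  qed
  have bound1: "ennreal (ln (1 + ln N) - ln (1 + ln K)) \<le> (\<integral>\<^sup>+k\<in>{K..}. ennreal (?h k) \<partial>lborel)" if "K \<le> N" for N
  proof -
    have "ennreal (ln (1 + ln N) - ln (1 + ln K)) = (\<integral>\<^sup>+k. ennreal (?h k) * indicator {K..N} k \<partial>lborel)"
      using assms that by (intro nn_integral_FTC_Icc[symmetric] F) auto
    also have "\<dots> \<le> (\<integral>\<^sup>+k\<in>{K..}. ennreal (?h k) \<partial>lborel)"
      by (intro nn_integral_mono) (auto simp: indicator_def)
    finally show ?thesis .
  qed
  have bound2: "ennreal (ln (1 + ln N) - ln (1 + ln K)) \<le> (\<integral>\<^sup>+k\<in>{0<..1/K}. ennreal (?h k) \<partial>lborel)" if "K \<le> N" for N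
  proof -
    have N: "0 < 1 / N" "1 / N \<le> 1 / K" "1 / K \<le> 1" using that assms by (auto simp: field_simps)
    have k: "0 < k" "k \<le> 1" if "1 / N \<le> k" "k \<le> 1 / K" for k using N that by linarith+
    have "ln (1 + ln N) - ln (1 + ln K) = - ln (1 - ln (1 / K)) - - ln (1 - ln (1 / N))"
      using that assms by (simp add: ln_div)
    then have "ennreal (ln (1 + ln N) - ln (1 + ln K)) = ennreal (- ln (1 - ln (1 / K)) - - ln (1 - ln (1 / N)))"
      by (simp only:)
    moreover have "\<dots> = (\<integral>\<^sup>+k. ennreal (?h k) * indicator {1/N..1/K} k \<partial>lborel)"
    proof (rule nn_integral_FTC_Icc[symmetric])
      show "((\<lambda>k. - ln (1 - ln k)) has_real_derivative ?h k) (at k)" if "k \<in> {1/N..1/K}" for k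
        using k[of k] that by (intro F') auto
      show "0 \<le> ?h k" if "k \<in> {1/N..1/K}" for k
        by (intro divide_nonneg_nonneg mult_nonneg_nonneg add_nonneg_nonneg abs_ge_zero) (use k[of k] that in auto)
    qed (use N in auto)
    moreover have "(\<integral>\<^sup>+k. ennreal (?h k) * indicator {1/N..1/K} k \<partial>lborel) \<le> (\<integral>\<^sup>+k\<in>{0<..1/K}. ennreal (?h k) \<partial>lborel)"
    proof (rule nn_integral_mono)
      fix l :: real
      have "l \<in> {0<..1/K}" if "l \<in> {1/N..1/K}" using k(1)[of l] that by (simp only: atLeastAtMost_iff greaterThanAtMost_iff)
      then show "ennreal (?h l) * indicator {1/N..1/K} l \<le> ennreal (?h l) * indicator {0<..1/K} l"
        by (cases "l \<in> {1/N..1/K}") (auto simp del: atLeastAtMost_iff greaterThanAtMost_iff)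
    qed
    ultimately show ?thesis by (simp only:)
  qed
  \<comment> \<open>\<open>bound1\<close> and \<open>bound2\<close> require K \<le> N; passing to
    \<open>max N K\<close> makes them available for every \<open>N\<close>.\<close>
  have lim': "filterlim (\<lambda>N. ln (1 + ln (max N K)) - ln (1 + ln K)) at_top at_top"
    by (rule filterlim_mono_eventually[OF lim order_refl order_refl])
       (auto intro!: eventually_mono[OF eventually_ge_at_top[of K]] simp: max_def)
  show "(\<integral>\<^sup>+k\<in>{K..}. ennreal (?h k) \<partial>lborel) = \<infinity>"
    by (rule nn_integral_eq_infinity_unbounded[OF bound1 lim']) simp
  show "(\<integral>\<^sup>+k\<in>{0<..1 / K}. ennreal (?h k) \<partial>lborel) = \<infinity>"
    by (rule nn_integral_eq_infinity_unbounded[OF bound2 lim']) simp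
qed

lemma log_weighted_integral_finite:
  fixes g :: "real \<Rightarrow> real"
  assumes "\<gamma> > 1" "C \<ge> 0" "A \<subseteq> {0<..}" "\<And>k. k \<in> A \<Longrightarrow> g k \<le> C * (1 + \<bar>ln k\<bar>) powr (- \<gamma>)"
  shows "(\<integral>\<^sup>+k\<in>A. ennreal (g k / (2 * k)) \<partial>lborel) < \<infinity>"
proof -
  have "(\<integral>\<^sup>+k\<in>A. ennreal (g k / (2 * k)) \<partial>lborel) \<le>
     (\<integral>\<^sup>+k. ennreal C * (ennreal ((1 + \<bar>ln k\<bar>) powr (- \<gamma>) / k) * indicator {0<..} k) \<partial>lborel)"
  proof (rule nn_integral_mono)
    fix k :: real
    show "ennreal (g k / (2 * k)) * indicator A k \<le> ennreal C * (ennreal ((1 + \<bar>ln k\<bar>) powr (- \<gamma>) / k) * indicator {0<..} k)"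
    proof (cases "k \<in> A")
      case True
      then have k: "k > 0" using assms by auto
      have "g k / (2 * k) \<le> C * (1 + \<bar>ln k\<bar>) powr (- \<gamma>) / (2 * k)"
        using assms(4)[OF True] k by (intro divide_right_mono) auto
      also have "\<dots> \<le> C * (1 + \<bar>ln k\<bar>) powr (- \<gamma>) / k"
        using assms k by (intro divide_left_mono) auto
      finally show ?thesis using True k assms by (simp add: ennreal_mult[symmetric] ennreal_leI)
    qed simp
  qed
  also have "\<dots> = ennreal C * (\<integral>\<^sup>+k\<in>{0<..}. ennreal ((1 + \<bar>ln k\<bar>) powr (- \<gamma>) / k) \<partial>lborel)"
    by (rule nn_integral_cmult) measurable
  also have "\<dots> < \<infinity>"
    using nn_integral_log_decay_finite[OF assms(1)] by (simp add: ennreal_mult_less_top)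
  finally show ?thesis .
qed

text \<open>Since 1 + |ln k| \<ge> 1, an exponent \<gamma> \<le> 1 only makes the integrand larger
  than in the divergent borderline case \<gamma> = 1.\<close>

lemma log_weighted_integral_infinite:
  fixes g :: "real \<Rightarrow> real"
  assumes "\<gamma> \<le> 1" "c > 0" "B \<subseteq> A" "B \<subseteq> {0<..}"
    and inf: "(\<integral>\<^sup>+k\<in>B. ennreal (1 / ((1 + \<bar>ln k\<bar>) * k)) \<partial>lborel) = \<infinity>" and B: "B \<in> sets borel"
    and g: "\<And>k. k \<in> B \<Longrightarrow> c * (1 + \<bar>ln k\<bar>) powr (- \<gamma>) \<le> g k"
  shows "(\<integral>\<^sup>+k\<in>A. ennreal (g k / (2 * k)) \<partial>lborel) = \<infinity>"
proof -
  have [measurable]: "B \<in> sets borel" by fact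
  have "\<infinity> = ennreal (c / 2) * (\<integral>\<^sup>+k\<in>B. ennreal (1 / ((1 + \<bar>ln k\<bar>) * k)) \<partial>lborel)"
    unfolding inf using assms by (simp add: ennreal_mult_top)
  also have "\<dots> = (\<integral>\<^sup>+k. ennreal (c / 2) * (ennreal (1 / ((1 + \<bar>ln k\<bar>) * k)) * indicator B k) \<partial>lborel)"
    by (rule nn_integral_cmult[symmetric]) measurable
  also have "\<dots> \<le> (\<integral>\<^sup>+k\<in>A. ennreal (g k / (2 * k)) \<partial>lborel)"
  proof (rule nn_integral_mono)
    fix k :: real
    show "ennreal (c / 2) * (ennreal (1 / ((1 + \<bar>ln k\<bar>) * k)) * indicator B k) \<le> ennreal (g k / (2 * k)) * indicator A k"
    proof (cases "k \<in> B")
      case True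
      then have k: "k > 0" "k \<in> A" using assms by auto
      have "c / (1 + \<bar>ln k\<bar>) = c * (1 + \<bar>ln k\<bar>) powr (- 1)" by (simp add: powr_minus_divide)
      also have "\<dots> \<le> c * (1 + \<bar>ln k\<bar>) powr (- \<gamma>)"
        using assms by (intro mult_left_mono powr_mono) auto
      also have "\<dots> \<le> g k" by (rule g[OF True])
      finally have "c / (1 + \<bar>ln k\<bar>) / (2 * k) \<le> g k / (2 * k)" using k by (intro divide_right_mono) auto
      then have "ennreal (c / 2 * (1 / ((1 + \<bar>ln k\<bar>) * k))) \<le> ennreal (g k / (2 * k))"
        by (intro ennreal_leI) (simp add: mult_ac)
      then show ?thesis using True k assms(2) by (simp add: ennreal_mult[symmetric])
    qed simp
  qed
  finally show ?thesis by (simp add: top.extremum_unique)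
qed

subsection \<open>Finiteness of the particle numbers\<close>

text \<open>Where a kernel is close to a step, its transform is the tail \<open>T (ln k)\<close> up
  to one further power of |ln k|. For k \<le> 1 the vacuum kernel is close to 1 instead, and the
  zero integral of \<phi> removes the constant.\<close>

lemma kernel_transform_estimates:
  fixes \<phi> :: "real \<Rightarrow> complex" and C \<beta> :: real
  defines "a \<equiv> \<i> * complex_of_real (pi / 2)"
  defines "H \<equiv> \<lambda>k. LINT y|lborel. \<phi> y * thermal_kernel k (of_real y + a)"
    and "G \<equiv> \<lambda>k. LINT y|lborel. \<phi> y * vacuum_kernel k (of_real y + a)"
    and "T \<equiv> \<lambda>s. LINT y:{s<..}|lborel. \<phi> y"
  assumes \<phi>: "integrable lborel \<phi>" and 0: "(LINT y|lborel. \<phi> y) = 0"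
    and \<beta>: "0 < \<beta>" "\<beta> \<le> 1" and C: "\<And>y. norm (\<phi> y) \<le> C * (1 + \<bar>y\<bar>) powr (- (1 + \<beta>))"
  shows "\<exists>D>0. (\<forall>k>0. norm (H k - T (ln k)) \<le> D * (1 + \<bar>ln k\<bar>) powr (- (1 + \<beta>))) \<and>
    (\<forall>k\<ge>1. norm (G k - T (ln k)) \<le> D * (1 + \<bar>ln k\<bar>) powr (- (1 + \<beta>))) \<and>
    (\<forall>k>0. k \<le> 1 \<longrightarrow> norm (G k) \<le> D / (1 + \<bar>ln k\<bar>))"
proof -
  have C0: "C \<ge> 0" using order_trans[OF norm_ge_zero C[of 0]] by simp
  have \<gamma>: "0 \<le> 1 + \<beta>" "1 + \<beta> \<le> 2" using \<beta> by auto
  define I2 where "I2 = (LINT u|lborel. (1 + \<bar>u::real\<bar>) powr (-2))"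
  define N where "N = (LINT y|lborel. norm (\<phi> y))"
  \<comment> \<open>Half of \<beta> is spent on the growth in \<open>y\<close> of the kernel
    estimate; the other half keeps the exponent 1 + \<beta> - \<delta> = 1 + \<delta> above
    1.\<close>
  define \<delta> where "\<delta> = \<beta> / 2"
  have \<delta>: "0 < \<delta>" "\<delta> \<le> 1" using \<beta> by (auto simp: \<delta>_def)
  define I3 where "I3 = (LINT y|lborel. (1 + \<bar>y::real\<bar>) powr (- (1 + \<delta>)))"
  have pos: "I2 \<ge> 0" "N \<ge> 0" "I3 \<ge> 0" by (auto simp: I2_def N_def I3_def)
  have Vm: "(\<lambda>y. thermal_kernel k (of_real y + a)) \<in> borel_measurable borel"
      "(\<lambda>y. vacuum_kernel k (of_real y + a)) \<in> borel_measurable borel" for k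
    unfolding a_def thermal_kernel_shifted vacuum_kernel_shifted by measurable
  \<comment> \<open>The constants of the three estimates are added, so that \<open>D\<close> serves
    each of them; the 1 makes it positive.\<close>
  define D where "D = 256 * C * I2 + 2 * (256 * C * I2 + 256 * N) + 6 * C * I3 * (256 / \<delta>) + 1"
  have Dge: "256 * C * I2 \<le> D" "2 * (256 * C * I2 + 256 * N) \<le> D" "6 * C * I3 * (256 / \<delta>) \<le> D" "D > 0"
    using C0 pos \<delta> by (auto simp: D_def add_nonneg_nonneg add_nonneg_pos)
  show ?thesis
  proof (rule exI[of _ D], intro conjI allI impI)
    show "D > 0" by (rule Dge(4))
  next
    fix k :: real assume k: "k > 0"
    have "norm (H k - T (ln k)) \<le> 1 * (256 * C * I2 * (1 + \<bar>ln k\<bar>) powr (- (1 + \<beta>)) + 0 * N)"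
      unfolding H_def T_def I2_def N_def
      by (rule step_kernel_estimate[OF \<phi> C \<gamma> Vm(1)])
         (use thermal_kernel_indicator[OF k] in \<open>auto simp: a_def\<close>)
    also have "\<dots> \<le> D * (1 + \<bar>ln k\<bar>) powr (- (1 + \<beta>))"
      using Dge(1) by (simp add: mult_right_mono)
    finally show "norm (H k - T (ln k)) \<le> D * (1 + \<bar>ln k\<bar>) powr (- (1 + \<beta>))" .
  next
    fix k :: real assume k: "k \<ge> 1"
    \<comment> \<open>The uniform error 1 / k is exponentially small in ln k, hence absorbed by the
      power.\<close>
    have \<eta>: "exp (- ln k) \<le> 256 * (1 + \<bar>ln k\<bar>) powr (- (1 + \<beta>))"
      using exp_neg_le_powr[of "1 + \<beta>" "ln k"] \<beta> k by simp
    have "norm (G k - T (ln k)) \<le> 2 * (256 * C * I2 * (1 + \<bar>ln k\<bar>) powr (- (1 + \<beta>)) + exp (- ln k) * N)"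
      unfolding G_def T_def I2_def N_def
      by (rule step_kernel_estimate[OF \<phi> C \<gamma> Vm(2)])
         (use vacuum_kernel_indicator[OF k] in \<open>auto simp: a_def simp del: exp_ln\<close>)
    also have "\<dots> \<le> 2 * (256 * C * I2 * (1 + \<bar>ln k\<bar>) powr (- (1 + \<beta>)) + (256 * (1 + \<bar>ln k\<bar>) powr (- (1 + \<beta>))) * N)"
      using \<eta> pos by (intro mult_left_mono add_mono mult_right_mono) auto
    also have "\<dots> = (2 * (256 * C * I2 + 256 * N)) * (1 + \<bar>ln k\<bar>) powr (- (1 + \<beta>))"
      by (simp only: algebra_simps)
    also have "\<dots> \<le> D * (1 + \<bar>ln k\<bar>) powr (- (1 + \<beta>))"
      by (rule mult_right_mono[OF Dge(2)]) simp
    finally show "norm (G k - T (ln k)) \<le> D * (1 + \<bar>ln k\<bar>) powr (- (1 + \<beta>))" .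
  next
    fix k :: real assume k: "0 < k" "k \<le> 1"
    define V where "V y = vacuum_kernel k (of_real y + a)" for y
    have V1: "norm (V y) \<le> 1" for y
      unfolding V_def a_def using k by (intro norm_vacuum_kernel_le) auto
    have [measurable]: "V \<in> borel_measurable borel" "\<phi> \<in> borel_measurable borel"
      using Vm(2)[of k] \<phi> by (auto simp: V_def[abs_def])
    have iV: "integrable lborel (\<lambda>y. \<phi> y * V y)"
      by (rule Bochner_Integration.integrable_bound[OF \<phi>]) (auto simp: norm_mult V1 mult_left_le)
    have "G k = (LINT y|lborel. \<phi> y * V y) - (LINT y|lborel. \<phi> y)"
      unfolding G_def V_def 0 by simp
    then have eq: "G k = (LINT y|lborel. \<phi> y * V y - \<phi> y)" using iV \<phi> by simp
    have "norm (LINT y|lborel. \<phi> y * V y - \<phi> y) \<le> (LINT y|lborel. (6 * C * k powr \<delta>) * (1 + \<bar>y\<bar>) powr (- (1 + \<delta>)))"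
    proof (rule Bochner_Integration.integral_norm_bound_integral)
      show "integrable lborel (\<lambda>y. \<phi> y * V y - \<phi> y)" using iV \<phi> by simp
      show "integrable lborel (\<lambda>y. (6 * C * k powr \<delta>) * (1 + \<bar>y\<bar>) powr (- (1 + \<delta>)))"
        using \<delta> by (intro integrable_mult_right integrable_one_plus_abs_powr) auto
      fix y
      have "norm (\<phi> y * V y - \<phi> y) = norm (\<phi> y) * norm (V y - 1)"
        by (simp add: norm_mult[symmetric] algebra_simps)
      also have "\<dots> \<le> (C * (1 + \<bar>y\<bar>) powr (- (1 + \<beta>))) * (6 * (k powr \<delta> * (1 + \<bar>y\<bar>) powr \<delta>))"
        unfolding V_def a_def using C0 k \<delta> by (intro mult_mono C vacuum_kernel_small) auto
      also have "\<dots> = (6 * C * k powr \<delta>) * ((1 + \<bar>y\<bar>) powr (- (1 + \<beta>)) * (1 + \<bar>y\<bar>) powr \<delta>)" by simp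
      also have "(1 + \<bar>y\<bar>) powr (- (1 + \<beta>)) * (1 + \<bar>y\<bar>) powr \<delta> = (1 + \<bar>y\<bar>) powr (- (1 + \<delta>))"
          by (subst powr_add[symmetric]) (simp add: \<delta>_def algebra_simps)
      finally show "norm (\<phi> y * V y - \<phi> y) \<le> (6 * C * k powr \<delta>) * (1 + \<bar>y\<bar>) powr (- (1 + \<delta>))" .
    qed
    then have "norm (G k) \<le> 6 * C * k powr \<delta> * I3"
      unfolding eq I3_def integral_mult_right_zero .
    also have "\<dots> = (6 * C * I3) * k powr \<delta>" by simp
    also have "\<dots> \<le> (6 * C * I3) * (256 / \<delta> / (1 + \<bar>ln k\<bar>))"
    proof (intro mult_left_mono)
      \<comment> \<open>For k \<le> 1 the power of \<open>k\<close> is an exponential in - \<delta>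
        |ln k|, which beats the first power of 1 + |ln k|.\<close>
      have "k powr \<delta> = exp (- \<bar>\<delta> * ln k\<bar>)" using k \<delta> by (simp add: powr_def abs_mult)
      also have "\<dots> \<le> 256 * (1 + \<bar>\<delta> * ln k\<bar>) powr (- 1)" by (rule exp_neg_le_powr) auto
      also have "\<dots> = 256 / (1 + \<delta> * \<bar>ln k\<bar>)" using \<delta> by (simp add: powr_minus_divide abs_mult)
      also have "\<dots> \<le> 256 / (\<delta> * (1 + \<bar>ln k\<bar>))"
        using \<delta> by (intro divide_left_mono mult_pos_pos add_pos_nonneg) (auto simp: algebra_simps)
      finally show "k powr \<delta> \<le> 256 / \<delta> / (1 + \<bar>ln k\<bar>)" by simp
    qed (use C0 pos in auto)
    also have "\<dots> = 6 * C * I3 * (256 / \<delta>) / (1 + \<bar>ln k\<bar>)" by simp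
    also have "\<dots> \<le> D / (1 + \<bar>ln k\<bar>)" using Dge(3) by (intro divide_right_mono) auto
    finally show "norm (G k) \<le> D / (1 + \<bar>ln k\<bar>)" .
  qed
qed

text \<open>Bookkeeping of exponents of 1 + |ln k|, with 1 as the threshold against dk / k. Squaring
  the transforms gives 2 \<beta>, which exceeds 1 exactly for \<alpha> > 1/2. The squared vacuum
  transform on (0, 1] has exponent 2 and the difference of squares on [1, \<infinity>) has 1 +
  \<beta>, both above 1 for every \<alpha>.\<close>

lemma infrared_dichotomy:
  fixes f :: "real \<Rightarrow> complex" and \<alpha> D c :: real
  defines "\<beta> \<equiv> min \<alpha> 1"
  defines "g \<equiv> \<lambda>k. cmod (checkF f k)" and "h \<equiv> \<lambda>k. cmod (checkTh f k)"
    and "x \<equiv> \<lambda>k. 1 + \<bar>ln k\<bar>"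
  assumes pos: "\<alpha> > 0" "D > 0" "c > 0"
    and h: "\<And>k. k > 0 \<Longrightarrow> h k \<le> D * x k powr (- \<beta>)"
    and g1: "\<And>k. k \<ge> 1 \<Longrightarrow> g k \<le> D * x k powr (- \<beta>)"
    and g0: "\<And>k. 0 < k \<Longrightarrow> k \<le> 1 \<Longrightarrow> g k \<le> D / x k"
    and gh: "\<And>k. k \<ge> 1 \<Longrightarrow> \<bar>g k - h k\<bar> \<le> D * x k powr (- (1 + \<beta>))"
    and low: "\<And>k. k > 0 \<Longrightarrow> c * x k powr (- \<alpha>) - D / x k \<le> h k"
  shows "(Nbar f < \<infinity> \<longleftrightarrow> \<alpha> > 1/2)
       \<and> (DiffAbs f {0<..} < \<infinity> \<longleftrightarrow> \<alpha> > 1/2)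
       \<and> (\<alpha> \<le> 1/2 \<longrightarrow>
            Npart f {0<..1} < \<infinity> \<and> Npart f {1..} = \<infinity>
          \<and> NThpart f {0<..1} = \<infinity> \<and> NThpart f {1..} = \<infinity>
          \<and> DiffAbs f {1..} < \<infinity> \<and> DiffAbs f {0<..1} = \<infinity>)"
proof -
  have \<beta>: "0 < \<beta>" "\<beta> \<le> 1" using pos by (auto simp: \<beta>_def)
  have x1: "x k \<ge> 1" for k by (simp add: x_def)
  then have x0: "x k > 0" for k by (rule less_le_trans[OF zero_less_one])
  have gh0: "g k \<ge> 0" "h k \<ge> 0" for k by (auto simp: g_def h_def)
  have sq: "(d * x k powr (- r))\<^sup>2 = d\<^sup>2 * x k powr (- (2 * r))" for d k r
    by (simp add: power_mult_distrib power2_eq_square powr_add[symmetric])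
  have inv: "d / x k = d * x k powr (- 1)" for d k
    using x0[of k] by (simp add: powr_minus_divide)
  have mono: "x k powr (- r) \<le> x k powr (- t)" if "t \<le> r" for k r t
    using that x1 by (intro powr_mono) auto
  have gall: "g k \<le> D * x k powr (- \<beta>)" if "k > 0" for k
  proof (cases "k \<ge> 1")
    case False
    then have "g k \<le> D * x k powr (- 1)" using g0[of k] that by (simp add: inv)
    also have "\<dots> \<le> D * x k powr (- \<beta>)" using pos \<beta> by (intro mult_left_mono mono) auto
    finally show ?thesis .
  qed (rule g1)
  have g2: "(g k)\<^sup>2 \<le> D\<^sup>2 * x k powr (- (2 * \<beta>))" if "k > 0" for k
    unfolding sq[symmetric] using gall[OF that] gh0 by (intro power_mono)
  have h2: "(h k)\<^sup>2 \<le> D\<^sup>2 * x k powr (- (2 * \<beta>))" if "k > 0" for k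
    unfolding sq[symmetric] using h[OF that] gh0 by (intro power_mono)
  have g02: "(g k)\<^sup>2 \<le> D\<^sup>2 * x k powr (- 2)" if "0 < k" "k \<le> 1" for k
    using power_mono[OF g0[OF that] gh0(1), of 2] sq[of D k 1] by (simp add: inv)
  \<comment> \<open>Factor the difference of squares: the decay comes entirely from |g - h|, while g
    + h is merely bounded.\<close>
  have d1: "\<bar>(g k)\<^sup>2 - (h k)\<^sup>2\<bar> \<le> 2 * D\<^sup>2 * x k powr (- (1 + \<beta>))" if "k \<ge> 1" for k
  proof -
    have 1: "x k powr (- \<beta>) \<le> 1" using mono[of 0 \<beta> k] x0[of k] \<beta> by simp
    have "\<bar>(g k)\<^sup>2 - (h k)\<^sup>2\<bar> = \<bar>g k - h k\<bar> * (g k + h k)"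
      using gh0[of k] by (simp add: power2_eq_square abs_mult square_diff_square_factored)
    also have "\<dots> \<le> (D * x k powr (- (1 + \<beta>))) * (D + D)"
    proof (intro mult_mono add_mono gh that)
      have "D * x k powr (- \<beta>) \<le> D" using 1 pos by (simp add: mult_left_le)
      then show "g k \<le> D" "h k \<le> D" using gall[of k] h[of k] that by auto
    qed (use gh0 pos in auto)
    also have "\<dots> = 2 * D\<^sup>2 * x k powr (- (1 + \<beta>))" by (simp add: power2_eq_square)
    finally show ?thesis .
  qed
  have Diff1: "DiffAbs f {1..} < \<infinity>"
    unfolding DiffAbs_def
    by (rule log_weighted_integral_finite[of "1 + \<beta>" "2 * D\<^sup>2"])
       (use \<beta> d1 in \<open>auto simp: g_def h_def x_def\<close>)
  have N01: "Npart f {0<..1} < \<infinity>"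
    unfolding Npart_def
    by (rule log_weighted_integral_finite[of 2 "D\<^sup>2"])
       (use g02 in \<open>auto simp: g_def x_def\<close>)
  have fin: "Nbar f < \<infinity>" "DiffAbs f {0<..} < \<infinity>" if "\<alpha> > 1/2"
  proof -
    have 2: "2 * \<beta> > 1" using that by (auto simp: \<beta>_def)
    show "Nbar f < \<infinity>"
      unfolding Nbar_def Npart_def
      by (rule log_weighted_integral_finite[of "2 * \<beta>" "D\<^sup>2"])
         (use g2 2 in \<open>auto simp: g_def x_def\<close>)
    have "\<bar>(g k)\<^sup>2 - (h k)\<^sup>2\<bar> \<le> D\<^sup>2 * x k powr (- (2 * \<beta>))" if "k > 0" for k
      using g2[OF that] h2[OF that] zero_le_power2[of "g k"] zero_le_power2[of "h k"] by linarith
    then show "DiffAbs f {0<..} < \<infinity>"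
      unfolding DiffAbs_def
      by (intro log_weighted_integral_finite[of "2 * \<beta>" "D\<^sup>2"])
         (use 2 in \<open>auto simp: g_def h_def x_def\<close>)
  qed
  have inf: "Npart f {1..} = \<infinity>" "NThpart f {0<..1} = \<infinity>" "NThpart f {1..} = \<infinity>"
    "DiffAbs f {0<..1} = \<infinity>" if \<alpha>: "\<alpha> \<le> 1/2"
  proof -
    have \<beta>\<alpha>: "\<beta> = \<alpha>" using \<alpha> by (simp add: \<beta>_def)
    \<comment> \<open>As \<alpha> < 1, the error D / x is eventually at most c / 4 times the main
      term. One such error leaves more than c / 2 for \<open>h\<close>; the two errors met by
      \<open>g\<close> leave exactly c / 2.\<close>
    have "((\<lambda>t. D * t powr (\<alpha> - 1)) \<longlongrightarrow> 0) at_top" using \<alpha> by real_asymp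
    then have "\<forall>\<^sub>F t in at_top. D * t powr (\<alpha> - 1) < c / 4"
      using pos by (intro order_tendstoD(2)) auto
    then obtain X where X: "\<And>t. t \<ge> X \<Longrightarrow> D * t powr (\<alpha> - 1) < c / 4"
      by (auto simp: eventually_at_top_linorder)
    \<comment> \<open>With K \<ge> 1 and ln K \<ge> X, both k \<ge> K and k \<le> 1 / K force x k
      \<ge> X.\<close>
    define K where "K = exp (max X 0)"
    have K: "K \<ge> 1" "ln K \<ge> X" by (auto simp: K_def)
    have big: "D / x k \<le> c / 4 * x k powr (- \<alpha>)" if "x k \<ge> X" for k
    proof -
      have "D / x k = (D * x k powr (\<alpha> - 1)) * x k powr (- \<alpha>)"
        unfolding inv by (simp add: mult.assoc powr_add[symmetric])
      also have "\<dots> \<le> c / 4 * x k powr (- \<alpha>)"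
        using X[OF that] by (intro mult_right_mono) auto
      finally show ?thesis .
    qed
    have xK: "x k \<ge> X" if "k \<ge> K" for k
    proof -
      have "ln K \<le> ln k" using that K by simp
      then show ?thesis using K by (simp add: x_def)
    qed
    have xK': "x k \<ge> X" if "0 < k" "k \<le> 1 / K" for k
    proof -
      have "ln k \<le> ln (1 / K)" using that K by (subst ln_le_cancel_iff) auto
      also have "\<dots> = - ln K" using K by (simp add: ln_div)
      finally show ?thesis using K by (simp add: x_def)
    qed
    have hl: "c / 2 * x k powr (- \<alpha>) \<le> h k" if "k > 0" "x k \<ge> X" for k
    proof -
      have "0 \<le> c * x k powr (- \<alpha>)" using pos by simp
      then show ?thesis using low[OF that(1)] big[OF that(2)] by linarith
    qed
    have gl: "c / 2 * x k powr (- \<alpha>) \<le> g k" if "k \<ge> 1" "x k \<ge> X" for k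
    proof -
      have "D * x k powr (- (1 + \<beta>)) \<le> D / x k"
        unfolding inv using pos \<beta> by (intro mult_left_mono mono) auto
      then show ?thesis using low[of k] big[OF that(2)] gh[OF that(1)] that(1) by linarith
    qed
    have sq2: "c\<^sup>2 / 4 * x k powr (- (2 * \<alpha>)) \<le> u\<^sup>2" if "c / 2 * x k powr (- \<alpha>) \<le> u" for k u
      using power_mono[OF that, of 2] pos by (simp add: sq power_divide)
    have le1: "k \<le> 1" if "k \<le> 1 / K" for k
      by (rule order_trans[OF that]) (use K(1) in simp)
    have K1: "{K..} \<subseteq> {1..}" "{0<..1/K} \<subseteq> {0<..1}" "{K..} \<subseteq> {0<..}" "{0<..1/K} \<subseteq> {0<..}"
      using K(1) le1 by auto
    have c4: "c\<^sup>2 / 4 > 0" using pos by simp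
    have \<alpha>2: "2 * \<alpha> \<le> 1" using \<alpha> by simp
    note infinite1 = log_weighted_integral_infinite[OF \<alpha>2 _ _ K1(3) nn_integral_inverse_log_infinite(1)[OF K(1)]]
    note infinite0 = log_weighted_integral_infinite[OF \<alpha>2 _ _ K1(4) nn_integral_inverse_log_infinite(2)[OF K(1)]]
    show "Npart f {1..} = \<infinity>"
      unfolding Npart_def
    proof (rule infinite1[OF c4 K1(1)])
      show "c\<^sup>2 / 4 * (1 + \<bar>ln k\<bar>) powr (- (2 * \<alpha>)) \<le> (cmod (checkF f k))\<^sup>2" if "k \<in> {K..}" for k
        using sq2[OF gl[of k]] xK[of k] that K(1) by (auto simp: x_def g_def)
    qed simp
    show "NThpart f {1..} = \<infinity>"
      unfolding NThpart_def
    proof (rule infinite1[OF c4 K1(1)])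
      show "c\<^sup>2 / 4 * (1 + \<bar>ln k\<bar>) powr (- (2 * \<alpha>)) \<le> (cmod (checkTh f k))\<^sup>2" if "k \<in> {K..}" for k
        using sq2[OF hl[of k]] xK[of k] that K(1) by (auto simp: x_def h_def)
    qed simp
    show "NThpart f {0<..1} = \<infinity>"
      unfolding NThpart_def
    proof (rule infinite0[OF c4 K1(2)])
      show "c\<^sup>2 / 4 * (1 + \<bar>ln k\<bar>) powr (- (2 * \<alpha>)) \<le> (cmod (checkTh f k))\<^sup>2" if "k \<in> {0<..1/K}" for k
        using sq2[OF hl[of k]] xK'[of k] that by (auto simp: x_def h_def)
    qed simp
    show "DiffAbs f {0<..1} = \<infinity>"
      unfolding DiffAbs_def
    proof (rule infinite0[OF _ K1(2)])
      \<comment> \<open>Near 0 the squares satisfy g^2 \<le> c^2 / 16 and h^2 \<ge> c^2 / 4 in units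
        of the common power, and c^2 / 4 - c^2 / 16 exceeds c^2 / 8.\<close>
      show "0 < c\<^sup>2 / 8" using pos by simp
      show "c\<^sup>2 / 8 * (1 + \<bar>ln k\<bar>) powr (- (2 * \<alpha>)) \<le> \<bar>(cmod (checkF f k))\<^sup>2 - (cmod (checkTh f k))\<^sup>2\<bar>"
        if k: "k \<in> {0<..1/K}" for k
      proof -
        have k01: "0 < k" "k \<le> 1" using k K1(2) by auto
        have X: "x k \<ge> X" using xK'[of k] k by auto
        have "g k \<le> c / 4 * x k powr (- \<alpha>)" using g0[OF k01] big[OF X] by linarith
        then have "(g k)\<^sup>2 \<le> c\<^sup>2 / 16 * x k powr (- (2 * \<alpha>))"
          using power_mono[of "g k" _ 2] gh0(1)[of k] by (fastforce simp: sq power_divide)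
        moreover have "c\<^sup>2 / 4 * x k powr (- (2 * \<alpha>)) \<le> (h k)\<^sup>2"
          using sq2[OF hl[OF k01(1) X]] .
        moreover have "0 \<le> c\<^sup>2 * x k powr (- (2 * \<alpha>))" by simp
        ultimately have "c\<^sup>2 / 8 * x k powr (- (2 * \<alpha>)) \<le> (h k)\<^sup>2 - (g k)\<^sup>2" by linarith
        then have "c\<^sup>2 / 8 * x k powr (- (2 * \<alpha>)) \<le> \<bar>(g k)\<^sup>2 - (h k)\<^sup>2\<bar>" by linarith
        then show ?thesis unfolding x_def g_def h_def .
      qed
    qed simp
  qed
  have ge: "Npart f {1..} \<le> Nbar f" "DiffAbs f {0<..1} \<le> DiffAbs f {0<..}"
    unfolding Nbar_def Npart_def DiffAbs_def
    by (intro nn_integral_mono; auto simp: indicator_def)+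
  show ?thesis
  proof (cases "\<alpha> > 1/2")
    case True
    then show ?thesis using fin by simp
  next
    case False
    then have "\<alpha> \<le> 1/2" by simp
    note inf = inf[OF this]
    have "Nbar f = \<infinity>" "DiffAbs f {0<..} = \<infinity>"
      using ge unfolding inf by (auto simp: top.extremum_unique)
    then show ?thesis using False inf Diff1 N01 by simp
  qed
qed

lemma bounded_of_continuous_vanishing:
  fixes g :: "real \<Rightarrow> complex"
  assumes cont: "continuous_on UNIV g" and lim: "(g \<longlongrightarrow> 0) at_infinity"
  shows "\<exists>M. \<forall>x. norm (g x) \<le> M"
proof -
  have "\<forall>\<^sub>F x in at_infinity. norm (g x) < 1"
    using lim by (auto simp: tendsto_iff dist_norm)
  then obtain b where b: "\<And>x. \<bar>x\<bar> \<ge> b \<Longrightarrow> norm (g x) < 1"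
    by (auto simp: eventually_at_infinity)
  have "compact (g ` {-b..b})"
    using cont by (intro compact_continuous_image continuous_on_subset[OF cont]) auto
  then obtain B where B: "\<And>x. x \<in> {-b..b} \<Longrightarrow> norm (g x) \<le> B"
    using compact_imp_bounded bounded_iff by (metis imageI)
  have "norm (g x) \<le> max B 1" for x
  proof (cases "\<bar>x\<bar> \<ge> b")
    case False
    then have "x \<in> {-b..b}" by auto
    then show ?thesis using B by (simp add: le_max_iff_disj)
  qed (use b[of x] in simp)
  then show ?thesis by blast
qed

section \<open>The thermal mean through the Bose factor\<close>

lemma exp_2pi_minus_1_bounds:
  fixes p :: real
  assumes "p > 0"
  shows "p \<le> exp (2 * pi * p) - 1" and "p \<le> 1 \<Longrightarrow> exp (2 * pi * p) - 1 \<le> 2 * pi * exp (2 * pi) * p"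
proof -
  have "1 * p \<le> 2 * pi * p" using assms pi_gt3 by (intro mult_right_mono) auto
  moreover have "1 + 2 * pi * p \<le> exp (2 * pi * p)" by (rule exp_ge_add_one_self)
  ultimately show "p \<le> exp (2 * pi * p) - 1" by linarith
  assume "p \<le> 1"
  \<comment> \<open>Multiplying 1 - x \<le> exp (- x) by exp x gives exp x - 1 \<le> x exp
    x.\<close>
  have "1 + - (2 * pi * p) \<le> exp (- (2 * pi * p))" by (rule exp_ge_add_one_self)
  then have "(1 - 2 * pi * p) * exp (2 * pi * p) \<le> exp (- (2 * pi * p)) * exp (2 * pi * p)"
    by (intro mult_right_mono) auto
  then have "exp (2 * pi * p) - 1 \<le> 2 * pi * p * exp (2 * pi * p)"
    by (simp add: exp_add[symmetric] algebra_simps)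
  also have "\<dots> \<le> 2 * pi * p * exp (2 * pi)"
    using assms \<open>p \<le> 1\<close> by (intro mult_left_mono) auto
  finally show "exp (2 * pi * p) - 1 \<le> 2 * pi * exp (2 * pi) * p" by (simp add: mult_ac)
qed

text \<open>The Bose denominator is comparable with \<open>p\<close> near 0, so the integrand is
  controlled by p^(2 \<alpha> - 2) there. For p > 1 the denominator is at least 1 and the
  normalisation integral takes over.\<close>

lemma NTh_finite_iff:
  fixes F :: "real \<Rightarrow> complex"
  assumes f: "f \<in> borel_measurable borel" and "\<alpha> > 0"
    and ft: "\<And>p. p > 0 \<Longrightarrow> fourier f p = of_real (p powr \<alpha>) * F p"
    and cont: "isCont F 0" and F0: "F 0 \<noteq> 0" and M: "\<And>p. norm (F p) \<le> M"
    and norm: "(\<integral>\<^sup>+p\<in>{0<..}. ennreal ((cmod (fourier f p))\<^sup>2 / (2 * p)) \<partial>lborel) < \<infinity>"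
  shows "NTh (2 * pi) f < \<infinity> \<longleftrightarrow> \<alpha> > 1/2"
proof -
  define e where "e p = exp (2 * pi * p) - 1" for p :: real
  have e: "e p \<ge> p" "e p > 0" if "p > 0" for p
    using exp_2pi_minus_1_bounds(1)[OF that] that by (auto simp: e_def)
  have [measurable]: "f \<in> borel_measurable borel" by fact
  have sq: "(cmod (fourier f p))\<^sup>2 = p powr (2 * \<alpha>) * (norm (F p))\<^sup>2" if "p > 0" for p
    using ft[OF that] that by (simp add: norm_mult power_mult_distrib power2_eq_square powr_add[symmetric])
  have fin: "NTh (2 * pi) f < \<infinity>" if \<alpha>: "\<alpha> > 1/2"
  proof -
    \<comment> \<open>The factor exp (- p) makes the power integrable on the whole half-line as a
      Gamma integrand; on p \<le> 1 it is compensated by the constant exp 1.\<close>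
    let ?w = "\<lambda>p::real. p powr (2 * \<alpha> - 2) * exp (- (1 * p))"
    have w: "(\<integral>\<^sup>+p. ennreal (?w p) * indicator {0<..} p \<partial>lborel) < \<infinity>"
    proof -
      have "integrable lborel (\<lambda>p. indicator {0<..} p * ?w p)"
        using set_integrable_powr_exp[of 1 "2 * \<alpha> - 2"] \<alpha> by (simp add: set_integrable_def)
      then have "(\<integral>\<^sup>+p. ennreal (norm (indicator {0<..} p * ?w p)) \<partial>lborel) < \<infinity>"
        unfolding integrable_iff_bounded by simp
      also have "(\<integral>\<^sup>+p. ennreal (norm (indicator {0<..} p * ?w p)) \<partial>lborel) = (\<integral>\<^sup>+p. ennreal (?w p) * indicator {0<..} p \<partial>lborel)"
        by (intro nn_integral_cong) (auto simp: indicator_def)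
      finally show ?thesis .
    qed
    have "NTh (2 * pi) f \<le> (\<integral>\<^sup>+p. ennreal (M\<^sup>2 * exp 1) * (ennreal (?w p) * indicator {0<..} p)
        + ennreal ((cmod (fourier f p))\<^sup>2 / (2 * p)) * indicator {0<..} p \<partial>lborel)"
      unfolding NTh_def
    proof (rule nn_integral_mono)
      fix p :: real
      show "ennreal ((cmod (fourier f p))\<^sup>2 / (2 * p) / (exp (2 * pi * p) - 1)) * indicator {0<..} p
        \<le> ennreal (M\<^sup>2 * exp 1) * (ennreal (?w p) * indicator {0<..} p)
        + ennreal ((cmod (fourier f p))\<^sup>2 / (2 * p)) * indicator {0<..} p"
      proof (cases "p > 0")
        case True
        show ?thesis
        proof (cases "p \<le> 1")
          case p1: True
          have "(cmod (fourier f p))\<^sup>2 / (2 * p) / e p \<le> (p powr (2 * \<alpha>) * M\<^sup>2) / (2 * p) / p"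
            unfolding sq[OF True] using True e[OF True] M[of p]
            by (intro frac_le divide_right_mono mult_left_mono power_mono) auto
          also have "\<dots> = M\<^sup>2 / 2 * p powr (2 * \<alpha> - 2)"
            using True by (simp add: powr_diff powr_numeral power2_eq_square mult_ac)
          also have "\<dots> \<le> M\<^sup>2 * exp 1 * ?w p"
          proof -
            have "1 / 2 \<le> exp 1 * exp (- (1 * p))" using p1 exp_ge_add_one_self[of "1 - p"] by (simp add: exp_add[symmetric])
            then have "M\<^sup>2 * p powr (2 * \<alpha> - 2) * (1 / 2) \<le> M\<^sup>2 * p powr (2 * \<alpha> - 2) * (exp 1 * exp (- (1 * p)))"
              by (intro mult_left_mono) auto
            then show ?thesis by (simp add: mult_ac)
          qed
          finally have "ennreal ((cmod (fourier f p))\<^sup>2 / (2 * p) / e p) \<le> ennreal (M\<^sup>2 * exp 1) * ennreal (?w p)"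
            by (simp add: ennreal_mult[symmetric] ennreal_leI)
          then show ?thesis using True by (simp add: e_def add_increasing2)
        next
          case False
          have "(cmod (fourier f p))\<^sup>2 / (2 * p) / e p \<le> (cmod (fourier f p))\<^sup>2 / (2 * p) / 1"
            using True e[OF True] False by (intro divide_left_mono) auto
          then show ?thesis using True by (simp add: e_def add_increasing ennreal_leI)
        qed
      qed simp
    qed
    also have "\<dots> = ennreal (M\<^sup>2 * exp 1) * (\<integral>\<^sup>+p. ennreal (?w p) * indicator {0<..} p \<partial>lborel)
       + (\<integral>\<^sup>+p\<in>{0<..}. ennreal ((cmod (fourier f p))\<^sup>2 / (2 * p)) \<partial>lborel)"
      by (subst nn_integral_add, measurable, subst nn_integral_cmult, measurable)
    also have "\<dots> < \<infinity>" using w norm by (simp add: ennreal_mult_less_top)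
    finally show ?thesis .
  qed
  have inf: "NTh (2 * pi) f = \<infinity>" if \<alpha>: "\<alpha> \<le> 1/2"
  proof -
    define m where "m = norm (F 0) / 2"
    have m: "m > 0" using F0 by (simp add: m_def)
    obtain d where d: "d > 0" "\<And>p. \<bar>p\<bar> < d \<Longrightarrow> norm (F p - F 0) < m"
      using cont m unfolding continuous_at_eps_delta by (auto simp: dist_norm)
    have Fm: "m \<le> norm (F p)" if "\<bar>p\<bar> < d" for p
      using d(2)[OF that] norm_triangle_ineq2[of "F 0" "F p"] by (simp add: m_def norm_minus_commute)
    define K where "K = max 1 (2 / d)"
    have K: "K \<ge> 1" "1 / K < d" using d by (auto simp: K_def max_def field_simps)
    define c where "c = m\<^sup>2 / (2 * pi * exp (2 * pi))"
    have c: "c > 0" using m by (simp add: c_def)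
    \<comment> \<open>Dividing by \<open>e k\<close> first leaves a numerator over 2 k that is
      bounded below near 0 when \<alpha> \<le> 1/2, and a positive constant dominates a multiple of
      1 / (1 + |ln k|).\<close>
    have "(\<integral>\<^sup>+k\<in>{0<..}. ennreal (((cmod (fourier f k))\<^sup>2 / e k) / (2 * k)) \<partial>lborel) = \<infinity>"
    proof (rule log_weighted_integral_infinite[OF order_refl c _ _ nn_integral_inverse_log_infinite(2)[OF K(1)]])
      fix k assume "k \<in> {0<..1/K}"
      then have k: "0 < k" "k \<le> 1 / K" by auto
      have k1: "k \<le> 1" by (rule order_trans[OF k(2)]) (use K in simp)
      have ek: "e k \<le> 2 * pi * exp (2 * pi) * k" unfolding e_def using k k1 by (intro exp_2pi_minus_1_bounds)
      have mF: "m \<le> norm (F k)" using k K by (intro Fm) auto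
      have "c * (1 + \<bar>ln k\<bar>) powr - 1 \<le> c * 1"
        using c by (intro mult_left_mono) (auto simp: powr_minus_divide)
      also have "\<dots> \<le> c * k powr (2 * \<alpha> - 1)"
      proof -
        have "k powr 0 \<le> k powr (2 * \<alpha> - 1)" using k k1 \<alpha> by (intro powr_mono') auto
        then show ?thesis using c k by simp
      qed
      also have "\<dots> = k powr (2 * \<alpha>) * m\<^sup>2 / (2 * pi * exp (2 * pi) * k)"
        using k by (simp add: c_def powr_diff)
      also have "\<dots> \<le> k powr (2 * \<alpha>) * (norm (F k))\<^sup>2 / e k"
        using k e[OF k(1)] ek mF m by (intro frac_le mult_left_mono power_mono) auto
      finally show "c * (1 + \<bar>ln k\<bar>) powr - 1 \<le> (cmod (fourier f k))\<^sup>2 / e k"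
        unfolding sq[OF k(1)] .
    qed auto
    then show ?thesis by (simp add: NTh_def e_def mult_ac)
  qed
  show ?thesis using fin inf by (cases "\<alpha> > 1/2") auto
qed

theorem theorem1:
  fixes chi f :: "real \<Rightarrow> complex" and \<alpha> :: real
  assumes chi_int: "integrable lborel chi"
    and smooth: "\<forall>n x. vderivs n (fourier chi) differentiable (at x)"
    and nonzero: "fourier chi 0 \<noteq> 0"
    and decay: "(fourier chi \<longlongrightarrow> 0) at_infinity"
    and flat0: "\<forall>n\<ge>1. vderivs n (fourier chi) 0 = 0"
    and flatinf: "\<forall>n\<ge>1. (vderivs n (fourier chi) \<longlongrightarrow> 0) at_infinity"
    and alpha_pos: "\<alpha> > 0"
    and f_int: "integrable lborel f"
    and f_ft: "\<forall>p. fourier f p =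
                 (if p > 0 then complex_of_real (p powr \<alpha>) * fourier chi p else 0)"
    and normalised: "(\<integral>\<^sup>+ p \<in> {0<..}. ennreal ((cmod (fourier f p))\<^sup>2 / (2 * p)) \<partial>lborel) = 1"
  shows "(Nbar f < \<infinity> \<longleftrightarrow> \<alpha> > 1/2)
       \<and> (NTh (2 * pi) f < \<infinity> \<longleftrightarrow> \<alpha> > 1/2)
       \<and> (DiffAbs f {0<..} < \<infinity> \<longleftrightarrow> \<alpha> > 1/2)
       \<and> (\<alpha> \<le> 1/2 \<longrightarrow>
            Npart f {0<..1} < \<infinity> \<and> Npart f {1..} = \<infinity>
          \<and> NThpart f {0<..1} = \<infinity> \<and> NThpart f {1..} = \<infinity>
          \<and> DiffAbs f {1..} < \<infinity> \<and> DiffAbs f {0<..1} = \<infinity>)"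
proof -
  let ?F = "fourier chi"
  have deriv: "(vderivs n ?F has_vector_derivative vderivs (Suc n) ?F x) (at x)" for n x
    using smooth vector_derivative_works by auto
  have cont: "continuous_on UNIV (vderivs n ?F)" for n
    by (intro continuous_at_imp_continuous_on ballI has_vector_derivative_continuous[OF deriv])
  \<comment> \<open>Flatness at infinity enters here: a continuous second derivative with limit 0 is
    bounded, which supplies the constant of \<open>flat_symbol\<close>.\<close>
  have "(vderivs 2 ?F \<longlongrightarrow> 0) at_infinity" using flatinf by simp
  from bounded_of_continuous_vanishing[OF cont this]
  obtain M where M: "\<And>x. norm (vderivs 2 ?F x) \<le> M" by blast
  have flat: "flat_symbol ?F (vderivs 1 ?F) (vderivs 2 ?F) (pi / 2) \<alpha> M"
    using deriv[of 0] deriv[of 1] M flat0 alpha_pos cont[of 2]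
    by unfold_locales (auto simp: numeral_2_eq_2)
  interpret flat_symbol ?F "vderivs 1 ?F" "vderivs 2 ?F" "pi / 2" \<alpha> M by (rule flat)
  have sh: "shifted (pi / 2) f = \<phi>"
  proof
    fix y
    have "(LINT p:{0<..}|lborel. fourier f p * of_real (exp (- (pi / 2 * p))) * exp (\<i> * of_real (p * y))) =
      (LINT p:{0<..}|lborel. of_real (wexp (pi / 2) \<alpha> p) * ?F p * exp (\<i> * of_real (p * y)))"
      using f_ft by (intro set_lebesgue_integral_cong) (auto simp: wexp_def)
    then show "shifted (pi / 2) f y = \<phi> y" by (simp only: shifted_def \<phi>_def)
  qed
  define \<beta> where "\<beta> = min \<alpha> 1"
  have \<beta>: "0 < \<beta>" "\<beta> \<le> 1" using alpha_pos by (auto simp: \<beta>_def)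
  note int = \<phi>_asymptotics(1)
  obtain C where C: "C > 0" "\<forall>y. norm (\<phi> y) \<le> C * (1 + \<bar>y\<bar>) powr (- (1 + \<beta>))"
    and tail: "(LINT y|lborel. \<phi> y) = 0 \<longrightarrow> (\<forall>s. norm (LINT y:{s<..}|lborel. \<phi> y) \<le> C * (1 + \<bar>s\<bar>) powr (- \<beta>))"
    and low: "(LINT y|lborel. \<phi> y) = 0 \<longrightarrow> ?F 0 \<noteq> 0 \<longrightarrow>
      (\<exists>c>0. \<forall>s. c * (1 + \<bar>s\<bar>) powr (- \<alpha>) - C / (1 + \<bar>s\<bar>) \<le> norm (LINT y:{s<..}|lborel. \<phi> y))"
    using \<phi>_asymptotics(2)[folded \<beta>_def] by (elim exE conjE)
  have ft0: "fourier f p = 0" if "p \<le> 0" for p using f_ft that by simp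
  have shift: "(LINT y|lborel. f y * W (of_real y)) = (LINT y|lborel. \<phi> y * W (of_real y + \<i> * of_real (pi / 2)))"
    if "open S" "{z. 0 \<le> Im z \<and> Im z \<le> pi / 2} \<subseteq> S" "W holomorphic_on S"
      "\<And>z. 0 \<le> Im z \<Longrightarrow> Im z \<le> pi / 2 \<Longrightarrow> norm (W z) \<le> 1" for W S
    unfolding sh[symmetric]
    by (rule positive_frequency_shift[OF f_int ft0 _ _ that]) (use int in \<open>auto simp: sh\<close>)
  \<comment> \<open>Shifting the constant function 1 equates the integrals of \<open>\<phi>\<close>
    and \<open>f\<close>; the latter is a multiple of the transform of \<open>f\<close> at 0, which
    vanishes.\<close>
  have zero: "(LINT y|lborel. \<phi> y) = 0"
  proof -
    have "(LINT y|lborel. \<phi> y) = (LINT y|lborel. f y)"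
      using shift[of UNIV "\<lambda>_. 1"] by simp
    moreover have "fourier f 0 = 0" using ft0 by simp
    ultimately show ?thesis by (simp add: fourier_def)
  qed
  define T where "T s = (LINT y:{s<..}|lborel. \<phi> y)" for s
  define H where "H k = (LINT y|lborel. \<phi> y * thermal_kernel k (of_real y + \<i> * complex_of_real (pi / 2)))" for k
  define G where "G k = (LINT y|lborel. \<phi> y * vacuum_kernel k (of_real y + \<i> * complex_of_real (pi / 2)))" for k
  define r where "r = 1 / sqrt (2 * pi)"
  have r: "r > 0" by (simp add: r_def)
  have checkTh: "checkTh f k = of_real r * H k" if "k > 0" for k
  proof -
    have "(LINT y|lborel. f y * thermal_kernel k (of_real y)) = H k"
      unfolding H_def using that
      by (intro shift[OF open_UNIV _ thermal_kernel_holomorphic norm_thermal_kernel_le]) auto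
    then show ?thesis unfolding checkTh_def thermal_kernel_real r_def by simp
  qed
  have checkF: "checkF f k = of_real r * G k" if "k > 0" for k
  proof -
    have "(LINT y|lborel. f y * vacuum_kernel k (of_real y)) = G k"
      unfolding G_def using that
      by (intro shift[OF open_vacuum_domain vacuum_domain_strip vacuum_kernel_holomorphic norm_vacuum_kernel_le]) auto
    then show ?thesis unfolding checkF_def vacuum_kernel_real r_def by simp
  qed
  obtain D where D0: "D > 0"
    "\<forall>k>0. norm (H k - T (ln k)) \<le> D * (1 + \<bar>ln k\<bar>) powr (- (1 + \<beta>))"
    "\<forall>k\<ge>1. norm (G k - T (ln k)) \<le> D * (1 + \<bar>ln k\<bar>) powr (- (1 + \<beta>))"
    "\<forall>k>0. k \<le> 1 \<longrightarrow> norm (G k) \<le> D / (1 + \<bar>ln k\<bar>)"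
    using kernel_transform_estimates[OF int zero \<beta> C(2)[rule_format], folded H_def G_def T_def] by (elim exE conjE)
  note D = D0(1) D0(2-4)[rule_format]
  obtain c where c: "c > 0" "\<And>s. c * (1 + \<bar>s\<bar>) powr (- \<alpha>) - C / (1 + \<bar>s\<bar>) \<le> norm (T s)"
    using low zero nonzero unfolding T_def by blast
  have T: "norm (T s) \<le> C * (1 + \<bar>s\<bar>) powr (- \<beta>)" for s
    unfolding T_def using tail zero by blast
  \<comment> \<open>A common constant for all the estimates: \<open>C\<close> bounds the tail,
    \<open>2 * D\<close> the distance between the two transforms when each is within
    \<open>D\<close> of the tail, and \<open>r\<close> is the Fourier normalisation.\<close>
  define E where "E = r * (C + 2 * D)"
  have E: "E > 0" using r C D by (simp add: E_def add_pos_pos)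
  have p1: "(1 + \<bar>s\<bar>) powr (- (1 + \<beta>)) \<le> (1 + \<bar>s\<bar>) powr (- \<beta>)"
    "(1 + \<bar>s\<bar>) powr (- (1 + \<beta>)) \<le> 1 / (1 + \<bar>s\<bar>)" for s :: real
  proof -
    show "(1 + \<bar>s\<bar>) powr (- (1 + \<beta>)) \<le> (1 + \<bar>s\<bar>) powr (- \<beta>)" by (intro powr_mono) auto
    have "(1 + \<bar>s\<bar>) powr (- (1 + \<beta>)) \<le> (1 + \<bar>s\<bar>) powr (- 1)" using \<beta> by (intro powr_mono) auto
    then show "(1 + \<bar>s\<bar>) powr (- (1 + \<beta>)) \<le> 1 / (1 + \<bar>s\<bar>)" by (simp add: powr_minus_divide)
  qed
  have near: "norm z \<le> (C + 2 * D) * (1 + \<bar>s\<bar>) powr (- \<beta>)"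
    if "norm (z - T s) \<le> D * (1 + \<bar>s\<bar>) powr (- (1 + \<beta>))" for z s
  proof -
    have "norm z \<le> norm (T s) + norm (z - T s)" using norm_triangle_ineq[of "T s" "z - T s"] by simp
    also have "\<dots> \<le> C * (1 + \<bar>s\<bar>) powr (- \<beta>) + D * (1 + \<bar>s\<bar>) powr (- \<beta>)"
      using T[of s] that mult_left_mono[OF p1(1)[of s], of D] D(1) by linarith
    also have "\<dots> \<le> (C + 2 * D) * (1 + \<bar>s\<bar>) powr (- \<beta>)" using D(1) by (simp add: algebra_simps)
    finally show ?thesis .
  qed
  have scale: "norm (of_real r * z) \<le> E * t" if "norm z \<le> (C + 2 * D) * t" for z :: complex and t
    using mult_left_mono[OF that, of r] r by (simp add: norm_mult E_def mult.assoc)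
  have "(Nbar f < \<infinity> \<longleftrightarrow> \<alpha> > 1/2)
       \<and> (DiffAbs f {0<..} < \<infinity> \<longleftrightarrow> \<alpha> > 1/2)
       \<and> (\<alpha> \<le> 1/2 \<longrightarrow>
            Npart f {0<..1} < \<infinity> \<and> Npart f {1..} = \<infinity>
          \<and> NThpart f {0<..1} = \<infinity> \<and> NThpart f {1..} = \<infinity>
          \<and> DiffAbs f {1..} < \<infinity> \<and> DiffAbs f {0<..1} = \<infinity>)"
  proof (rule infrared_dichotomy[OF alpha_pos E, of "r * c", folded \<beta>_def])
    show "0 < r * c" using r c by simp
    show "cmod (checkTh f k) \<le> E * (1 + \<bar>ln k\<bar>) powr (- \<beta>)" if "k > 0" for k
      unfolding checkTh[OF that] by (intro scale near D that)
    show "cmod (checkF f k) \<le> E * (1 + \<bar>ln k\<bar>) powr (- \<beta>)" if "k \<ge> 1" for k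
    proof -
      have "k > 0" using that by simp
      then show ?thesis unfolding checkF[OF \<open>k > 0\<close>] by (intro scale near D that)
    qed
    show "cmod (checkF f k) \<le> E / (1 + \<bar>ln k\<bar>)" if "0 < k" "k \<le> 1" for k
    proof -
      have "norm (G k) \<le> (C + 2 * D) * (1 / (1 + \<bar>ln k\<bar>))"
        using C(1) D(1) by (intro order_trans[OF D(4)[OF that]]) (simp add: divide_right_mono)
      from scale[OF this] show ?thesis using checkF[OF that(1)] by simp
    qed
    show "\<bar>cmod (checkF f k) - cmod (checkTh f k)\<bar> \<le> E * (1 + \<bar>ln k\<bar>) powr (- (1 + \<beta>))" if "k \<ge> 1" for k
    proof -
      have k: "k > 0" using that by simp
      have "norm (G k - H k) \<le> norm (G k - T (ln k)) + norm (H k - T (ln k))"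
        using norm_triangle_ineq4[of "G k - T (ln k)" "H k - T (ln k)"] by simp
      also have "\<dots> \<le> (C + 2 * D) * (1 + \<bar>ln k\<bar>) powr (- (1 + \<beta>))"
      proof -
        define t where "t = (1 + \<bar>ln k\<bar>) powr (- (1 + \<beta>))"
        have "0 \<le> C * t" using C(1) by (simp add: t_def)
        then show ?thesis
          using D(2)[OF k] D(3)[OF that] unfolding t_def[symmetric] by (simp add: algebra_simps)
      qed
      finally have "norm (of_real r * (G k - H k)) \<le> E * (1 + \<bar>ln k\<bar>) powr (- (1 + \<beta>))" by (rule scale)
      moreover have "\<bar>cmod (checkF f k) - cmod (checkTh f k)\<bar> \<le> norm (checkF f k - checkTh f k)"
        by (rule norm_triangle_ineq3)
      ultimately show ?thesis by (simp add: checkF[OF k] checkTh[OF k] algebra_simps)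
    qed
    show "r * c * (1 + \<bar>ln k\<bar>) powr (- \<alpha>) - E / (1 + \<bar>ln k\<bar>) \<le> cmod (checkTh f k)" if "k > 0" for k
    proof -
      have "norm (T (ln k)) \<le> norm (H k) + norm (H k - T (ln k))"
        using norm_triangle_ineq4[of "H k" "H k - T (ln k)"] by simp
      moreover have "norm (H k - T (ln k)) \<le> D / (1 + \<bar>ln k\<bar>)"
        using D(2)[OF that] mult_left_mono[OF p1(2)[of "ln k"], of D] D(1) by simp
      moreover have "D / (1 + \<bar>ln k\<bar>) \<ge> 0" using D(1) by simp
      ultimately have "c * (1 + \<bar>ln k\<bar>) powr (- \<alpha>) - (C + 2 * D) / (1 + \<bar>ln k\<bar>) \<le> norm (H k)"
        using c(2)[of "ln k"] by (simp add: add_divide_distrib)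
      from mult_left_mono[OF this, of r] show ?thesis
        using r by (simp add: checkTh[OF that] norm_mult E_def right_diff_distrib mult.assoc)
    qed
  qed
  moreover have "NTh (2 * pi) f < \<infinity> \<longleftrightarrow> \<alpha> > 1/2"
  proof (rule NTh_finite_iff)
    show "norm (fourier chi p) \<le> 1 / sqrt (2 * pi) * (LINT y|lborel. norm (chi y))" for p
      by (rule norm_fourier_le)
    show "fourier f p = of_real (p powr \<alpha>) * fourier chi p" if "p > 0" for p
      using f_ft that by simp
    show "isCont (fourier chi) 0" using cont[of 0] by (simp add: continuous_on_eq_continuous_at)
    show "(\<integral>\<^sup>+p\<in>{0<..}. ennreal ((cmod (fourier f p))\<^sup>2 / (2 * p)) \<partial>lborel) < \<infinity>"
      unfolding normalised by simp
  qed (use f_int alpha_pos nonzero in auto)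
  ultimately show ?thesis by blast
qed

end
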